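(* Let $j>0$ and $\rho_{\rm init}\in L^\infty([0,1],\mathbb R_+)$ with $F(r;\rho_{\rm init})\ge\alpha(1-r)$ for all $r\in[0,1]$, for some $\alpha>0$. Let initial configurations $\xi=\xi^{(\epsilon)}$ satisfy, with $\ell=\lfloor\epsilon^{-9/10}\rfloor$ and $a=1/20$, $\max_{x\in\{0,\dots,\epsilon^{-1}-\ell+1\}}|\mathcal A_\ell(x,\xi)-\mathcal A'_\ell(x,\rho_{\rm init})|\le\epsilon^a$, and let $\rho(r,t)$ be the hydrodynamic limit, i.e. the non negative continuous function on $[0,1]\times(0,\infty)$ with $\lim_{t\to0}F(r;\rho(\cdot,t))=F(r;\rho_{\rm init})$ for all $r$ and such that for all $t>0,\zeta>0$, $\lim_{\epsilon\to0}P^{(\epsilon)}_\xi\big[\max_x|\epsilon F_\epsilon(x;\xi_{\epsilon^{-2}t})-F(\epsilon x;\rho(\cdot,t))|\le\zeta\big]=1$. Then there exists $T>0$ such that $\rho(1,t)>0$ for $t\in(0,T]$ and $$\rho(r,t)=G^{\rm neum}_t*\rho_{\rm init}(r)+j\int_0^t\big\{G^{\rm neum}_s(r,0)-G^{\rm neum}_s(r,1)\big\}ds,\qquad r\in[0,1],\ t\in(0,T].$$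
   Context: Particle system on $\Lambda_\epsilon=\{0,\dots,\epsilon^{-1}\}$ ($\epsilon^{-1}\in\mathbb N$): Markov process $(\xi_t)$ on $\mathbb N^{\Lambda_\epsilon}$ with generator $L=L^0+L_b+L_a$, $L^0f(\xi)=\frac12\sum_{x=0}^{\epsilon^{-1}-1}[\xi(x)(f(\xi^{x,x+1})-f(\xi))+\xi(x+1)(f(\xi^{x+1,x})-f(\xi))]$ ($\xi^{x,y}$: one particle moved from $x$ to $y$), $L_bf(\xi)=j\epsilon(f(\xi+\mathbf 1_{\{0\}})-f(\xi))$, $L_af(\xi)=j\epsilon(f(\xi-\mathbf 1_{\{R_\xi\}})-f(\xi))$ with $R_\xi$ the rightmost occupied site ($L_af=0$ if $\xi\equiv 0$). $P^{(\epsilon)}_\xi$ is the law started at $\xi$. $F_\epsilon(x;\xi)=\sum_{y\ge x}\xi(y)$; $F(r;u)=\int_r^1u$. $\mathcal A_\ell(x,\xi)=\frac1\ell\sum_{y=x}^{x+\ell-1}\xi(y)$, $\mathcal A'_\ell(x,u)=\frac1{\epsilon\ell}(F(\epsilon x;u)-F(\epsilon(x+\ell);u))$. $G^{\rm neum}_t(r,r')=\sum_kG_t(r,r'_k)$, $G_t(r,r')=e^{-(r-r')^2/2t}/\sqrt{2\pi t}$, $r'_k$ the images of $r'$ under repeated reflections of $[0,1]$ (Neumann heat kernel on $[0,1]$); $G^{\rm neum}_t*f(r)=\int G^{\rm neum}_t(r,r')f(r')dr'$. *)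

theory Defs
  imports "HOL-Analysis.Analysis"
begin

text \<open>Conventions: eps = 1 / n with n = eps^{-1} a positive natural number; Lambda_eps = {0..n}.
A configuration is a function nat => nat vanishing outside {0..n}.\<close>

type_synonym config = "nat \<Rightarrow> nat"

definition move :: "config \<Rightarrow> nat \<Rightarrow> nat \<Rightarrow> config" where
  "move \<xi> x y = (\<xi>(x := \<xi> x - 1))(y := (\<xi>(x := \<xi> x - 1)) y + 1)"

definition rightmost :: "nat \<Rightarrow> config \<Rightarrow> nat" where
  "rightmost n \<xi> = (GREATEST y. y \<le> n \<and> 0 < \<xi> y)"

definition gen :: "nat \<Rightarrow> real \<Rightarrow> (config \<Rightarrow> real) \<Rightarrow> config \<Rightarrow> real" where
  "gen n j f \<xi> =
     (1/2) * (\<Sum>x<n. real (\<xi> x) * (f (move \<xi> x (x+1)) - f \<xi>)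
                     + real (\<xi> (x+1)) * (f (move \<xi> (x+1) x) - f \<xi>))
     + j * (1 / real n) * (f (\<xi>(0 := \<xi> 0 + 1)) - f \<xi>)
     + (if (\<exists>y\<le>n. 0 < \<xi> y)
        then j * (1 / real n) * (f (\<xi>(rightmost n \<xi> := \<xi> (rightmost n \<xi>) - 1)) - f \<xi>)
        else 0)"

definition box :: "nat \<Rightarrow> nat \<Rightarrow> config set" where
  "box n N = {\<eta>. (\<forall>y>n. \<eta> y = 0) \<and> (\<forall>y\<le>n. \<eta> y \<le> N)}"

text \<open>Generator of the chain killed on leaving box n N (finite sub-Markov matrix Q restricted to the box).\<close>
definition killgen :: "nat \<Rightarrow> real \<Rightarrow> nat \<Rightarrow> (config \<Rightarrow> real) \<Rightarrow> config \<Rightarrow> real" where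
  "killgen n j N f = gen n j (\<lambda>\<zeta>. if \<zeta> \<in> box n N then f \<zeta> else 0)"

definition ptrans_kill :: "nat \<Rightarrow> real \<Rightarrow> nat \<Rightarrow> real \<Rightarrow> config \<Rightarrow> config \<Rightarrow> real" where
  "ptrans_kill n j N t \<xi> \<eta> =
     (\<Sum>k. t ^ k / fact k * ((killgen n j N ^^ k) (\<lambda>\<zeta>. if \<zeta> = \<eta> then 1 else 0)) \<xi>)"

text \<open>P^{(eps)}_xi [xi_t in A]: the (minimal = actual, the chain being non-explosive)
  transition probability, obtained as the monotone limit of the killed chains.\<close>
definition prob_at :: "nat \<Rightarrow> real \<Rightarrow> config \<Rightarrow> real \<Rightarrow> config set \<Rightarrow> real" where
  "prob_at n j \<xi> t A = lim (\<lambda>N. \<Sum>\<eta>\<in>box n N \<inter> A. ptrans_kill n j N t \<xi> \<eta>)"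

definition Feps :: "nat \<Rightarrow> nat \<Rightarrow> config \<Rightarrow> real" where
  "Feps n x \<xi> = (\<Sum>y\<in>{x..n}. real (\<xi> y))"

text \<open>F(r; u) = int_r^1 u  (0 if r > 1).\<close>
definition Fmac :: "real \<Rightarrow> (real \<Rightarrow> real) \<Rightarrow> real" where
  "Fmac r u = (LINT s:{r..1}|lborel. u s)"

definition avg :: "nat \<Rightarrow> nat \<Rightarrow> config \<Rightarrow> real" where
  "avg l x \<xi> = (1 / real l) * (\<Sum>y\<in>{x..x+l-1}. real (\<xi> y))"

definition avg' :: "nat \<Rightarrow> nat \<Rightarrow> nat \<Rightarrow> (real \<Rightarrow> real) \<Rightarrow> real" where
  "avg' n l x u = (1 / ((1 / real n) * real l)) *
      (Fmac (real x / real n) u - Fmac (real (x + l) / real n) u)"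

text \<open>Gaussian kernel and Neumann heat kernel on [0,1] (method of images: images 2m + r', 2m - r').\<close>
definition gauss :: "real \<Rightarrow> real \<Rightarrow> real \<Rightarrow> real" where
  "gauss t r r' = exp (- ((r - r')^2) / (2 * t)) / sqrt (2 * pi * t)"

definition Gneum :: "real \<Rightarrow> real \<Rightarrow> real \<Rightarrow> real" where
  "Gneum t r r' = (\<Sum>\<^sub>\<infinity>m\<in>(UNIV::int set). gauss t r (2 * real_of_int m + r') + gauss t r (2 * real_of_int m - r'))"

definition Gneum_conv :: "real \<Rightarrow> (real \<Rightarrow> real) \<Rightarrow> real \<Rightarrow> real" where
  "Gneum_conv t f r = (LINT r':{0..1}|lborel. Gneum t r r' * f r')"

end

(*
  The generator acts on a linear functional sum_x phi(x) xi(x) as the discrete Neumann Laplacian of phi,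
  up to the source term j (phi(0) - phi(R)), with R the rightmost particle.  With site x placed at
  (x + 1/2) / (n + 1) the functions cos (k pi r) are exact eigenfunctions, so their expectations solve
  scalar linear ODEs, and the only nonlinear ingredient is the law of R.

  Positivity: q_m = b_m ((1 - cos pi r) / 2)^m is increasing on [0,1], has integral 1 and satisfies
  q_m'' / 2 = mu_m (q_(m-1) - q_m) with mu_m = (m pi)^2 / 2.  Hence y_m = <q_m, rho> obeys
  y_m' >= mu_m (y_(m-1) - y_m) - j b_m, whence y_m(t) >= alpha - j sum_(i <= m) b_i min(t, 1 / mu_i).
  As b_i = O(sqrt i), this exceeds alpha / 2 for small t uniformly in m, and q_m concentrates at 1, so
  rho(1,t) >= alpha / 2.  By the hydrodynamic limit there are then particles arbitrarily close to the right
  end, i.e. R / n -> 1 in probability, so the source becomes j (phi(0) - phi(1)) and all cosine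
  coefficients of rho(.,t) are determined; they agree with those of the explicit formula, which are
  obtained by unfolding the method of images into a Gaussian Fourier integral.
*)
theory Submission
  imports Defs "HOL-Probability.Probability" "HOL-Real_Asymp.Real_Asymp"
begin

section \<open>Generator and killed semigroup\<close>

text \<open>The process is available only as the limit N to infinity of chains killed on leaving a
  finite box. Every estimate is therefore made for the killed chain, with n fixed and N large:
  statements hold eventually in n and, for such n, eventually in N. Killing errors may explode with
  n provided they vanish in N; the second moment of mass / n, which survives the limit in n, must be
  bounded uniformly. It also turns convergence in probability at a fixed time into convergence of
  expectations. The obstacle is a circle: the source is known only once R is near the right end,
  which follows from rho(1,.) > 0, which must thus be proved without knowing R. Increasing test
  functions break the circle: for them R at the right end is the worst case, so the loss rate is at
  most j q_m(1) = j b_m wherever R is. Relaxation of y_m towards y_(m-1) makes level m pay this only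
  over a time of order 1 / mu_m instead of t. The total cost is then controlled by the sum of b_i /
  mu_i, with terms of order i^(-3/2), and this is why the bound is uniform in m.\<close>

definition gain :: "nat \<Rightarrow> real \<Rightarrow> (config \<Rightarrow> real) \<Rightarrow> config \<Rightarrow> real" where
  "gain n j f \<xi> =
     (1/2) * (\<Sum>x<n. real (\<xi> x) * f (move \<xi> x (x+1)) + real (\<xi> (x+1)) * f (move \<xi> (x+1) x))
     + j * (1 / real n) * f (\<xi>(0 := \<xi> 0 + 1))
     + (if (\<exists>y\<le>n. 0 < \<xi> y)
        then j * (1 / real n) * f (\<xi>(rightmost n \<xi> := \<xi> (rightmost n \<xi>) - 1)) else 0)"

text \<open>Targets of the jumps of positive rate, the only configurations that matter when
  \<open>gain\<close> of two functions is compared. In the last set \<open>y\<close> only witnesses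
  that there is a particle to remove.\<close>

definition succs :: "nat \<Rightarrow> config \<Rightarrow> config set" where
  "succs n \<xi> = {move \<xi> x (x+1) | x. x < n \<and> 0 < \<xi> x}
     \<union> {move \<xi> (x+1) x | x. x < n \<and> 0 < \<xi> (x+1)}
     \<union> {\<xi>(0 := \<xi> 0 + 1)}
     \<union> {\<xi>(rightmost n \<xi> := \<xi> (rightmost n \<xi>) - 1) | y. y \<le> n \<and> 0 < \<xi> y}"

text \<open>\<open>gain\<close> collects rate times value at the target, so \<open>gain\<close> of
  the constant 1 is the total jump rate. Splitting off this positive part is what makes comparison
  arguments possible.\<close>

lemma gen_eq_gain: "gen n j f \<xi> = gain n j f \<xi> - gain n j (\<lambda>_. 1) \<xi> * f \<xi>"
proof -
  have "(\<Sum>x<n. real (\<xi> x) * (f (move \<xi> x (x+1)) - f \<xi>) + real (\<xi> (x+1)) * (f (move \<xi> (x+1) x) - f \<xi>))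
     = (\<Sum>x<n. real (\<xi> x) * f (move \<xi> x (x+1)) + real (\<xi> (x+1)) * f (move \<xi> (x+1) x))
       - (\<Sum>x<n. real (\<xi> x) * 1 + real (\<xi> (x+1)) * 1) * f \<xi>"
    unfolding sum_distrib_right sum_subtractf[symmetric]
    by (rule sum.cong) (auto simp: algebra_simps)
  \<comment> \<open>With the sum, the rates and the target values abstracted to real variables, only
    algebra and a case split on emptiness remain; the same device recurs below.\<close>
  moreover have X: "S = S1 - S2 * v \<Longrightarrow> (1/2) * S + a * (p - v) + (if b then a * (q - v) else 0)
     = ((1/2) * S1 + a * p + (if b then a * q else 0)) - ((1/2) * S2 + a * 1 + (if b then a * 1 else 0)) * v"
    for S S1 S2 a p q v :: real and b
    by (cases b) (simp_all add: right_diff_distrib distrib_right left_diff_distrib)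
  ultimately show ?thesis
    unfolding gen_def gain_def by (intro X)
qed

lemma gain_mono:
  assumes "0 \<le> j" and le: "\<And>\<zeta>. \<zeta> \<in> succs n \<xi> \<Longrightarrow> f \<zeta> \<le> g \<zeta>"
  shows "gain n j f \<xi> \<le> gain n j g \<xi>"
proof -
  have "real (\<xi> x) * f (move \<xi> x (x+1)) + real (\<xi> (x+1)) * f (move \<xi> (x+1) x)
     \<le> real (\<xi> x) * g (move \<xi> x (x+1)) + real (\<xi> (x+1)) * g (move \<xi> (x+1) x)" if "x < n" for x
  proof (intro add_mono)
    show "real (\<xi> x) * f (move \<xi> x (x+1)) \<le> real (\<xi> x) * g (move \<xi> x (x+1))"
      by (cases "\<xi> x = 0") (use that in \<open>auto intro!: mult_left_mono le simp: succs_def\<close>)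
    show "real (\<xi> (x+1)) * f (move \<xi> (x+1) x) \<le> real (\<xi> (x+1)) * g (move \<xi> (x+1) x)"
      by (cases "\<xi> (x+1) = 0") (use that in \<open>auto intro!: mult_left_mono le simp: succs_def\<close>)
  qed
  moreover have "f (\<xi>(0 := \<xi> 0 + 1)) \<le> g (\<xi>(0 := \<xi> 0 + 1))"
    by (rule le) (simp add: succs_def)
  moreover have "f (\<xi>(rightmost n \<xi> := \<xi> (rightmost n \<xi>) - 1)) \<le> g (\<xi>(rightmost n \<xi> := \<xi> (rightmost n \<xi>) - 1))"
    if "\<exists>y\<le>n. 0 < \<xi> y"
    by (rule le) (use that in \<open>auto simp: succs_def\<close>)
  moreover have X: "S \<le> S' \<Longrightarrow> p \<le> p' \<Longrightarrow> (b \<Longrightarrow> q \<le> q') \<Longrightarrow> 0 \<le> a \<Longrightarrow>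
     (1/2) * S + a * p + (if b then a * q else 0) \<le> (1/2) * S' + a * p' + (if b then a * q' else 0)"
    for S S' a p q p' q' :: real and b
    by (cases b) (auto intro!: add_mono mult_left_mono)
  ultimately show ?thesis
    unfolding gain_def using \<open>0 \<le> j\<close> by (intro X sum_mono) auto
qed

lemma gain_add: "gain n j (\<lambda>\<zeta>. f \<zeta> + g \<zeta>) \<xi> = gain n j f \<xi> + gain n j g \<xi>"
proof -
  have "(\<Sum>x<n. real (\<xi> x) * (f (move \<xi> x (x+1)) + g (move \<xi> x (x+1)))
        + real (\<xi> (x+1)) * (f (move \<xi> (x+1) x) + g (move \<xi> (x+1) x)))
    = (\<Sum>x<n. real (\<xi> x) * f (move \<xi> x (x+1)) + real (\<xi> (x+1)) * f (move \<xi> (x+1) x))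
     + (\<Sum>x<n. real (\<xi> x) * g (move \<xi> x (x+1)) + real (\<xi> (x+1)) * g (move \<xi> (x+1) x))"
    unfolding sum.distrib[symmetric] by (rule sum.cong) (auto simp: distrib_left)
  moreover have X: "S = S1 + S2 \<Longrightarrow> (1/2) * S + a * (p + p') + (if b then a * (q + q') else 0)
     = ((1/2) * S1 + a * p + (if b then a * q else 0)) + ((1/2) * S2 + a * p' + (if b then a * q' else 0))"
    for S S1 S2 a p q p' q' :: real and b
    by (cases b) (simp_all add: distrib_left)
  ultimately show ?thesis
    unfolding gain_def by (intro X)
qed

lemma gain_cmult: "gain n j (\<lambda>\<zeta>. c * f \<zeta>) \<xi> = c * gain n j f \<xi>"
proof -
  have "(\<Sum>x<n. real (\<xi> x) * (c * f (move \<xi> x (x+1))) + real (\<xi> (x+1)) * (c * f (move \<xi> (x+1) x)))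
    = c * (\<Sum>x<n. real (\<xi> x) * f (move \<xi> x (x+1)) + real (\<xi> (x+1)) * f (move \<xi> (x+1) x))"
    unfolding sum_distrib_left by (rule sum.cong) (auto simp: distrib_left)
  moreover have X: "S = c * S1 \<Longrightarrow> (1/2) * S + a * (c * p) + (if b then a * (c * q) else 0)
     = c * ((1/2) * S1 + a * p + (if b then a * q else 0))"
    for S S1 a p q :: real and b
    by (cases b) (simp_all add: distrib_left)
  ultimately show ?thesis
    unfolding gain_def by (intro X)
qed

lemma gain_0: "gain n j (\<lambda>\<zeta>. 0) \<xi> = 0"
  unfolding gain_def by simp

lemma gain_nonneg: "0 \<le> j \<Longrightarrow> (\<And>\<zeta>. 0 \<le> f \<zeta>) \<Longrightarrow> 0 \<le> gain n j f \<xi>"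
  using gain_mono[of j n \<xi> "\<lambda>_. 0" f] by (simp add: gain_0)

lemma gen_add: "gen n j (\<lambda>\<zeta>. f \<zeta> + g \<zeta>) \<xi> = gen n j f \<xi> + gen n j g \<xi>"
  unfolding gen_eq_gain gain_add by (simp add: algebra_simps)

lemma gen_cmult: "gen n j (\<lambda>\<zeta>. c * f \<zeta>) \<xi> = c * gen n j f \<xi>"
  unfolding gen_eq_gain gain_cmult by (simp add: algebra_simps)

section \<open>The finite box and the generator killed outside it\<close>

lemma finite_box: "finite (box n N)"
proof -
  have "box n N \<subseteq> (\<lambda>g y. if y \<le> n then g y else 0) ` (PiE {..n} (\<lambda>_. {..N}))"
  proof
    fix \<eta> assume \<eta>: "\<eta> \<in> box n N"
    have "\<eta> = (\<lambda>y. if y \<le> n then (restrict \<eta> {..n}) y else 0)"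
      using \<eta> by (auto simp: box_def fun_eq_iff)
    moreover have "restrict \<eta> {..n} \<in> PiE {..n} (\<lambda>_. {..N})"
      using \<eta> by (auto simp: box_def)
    ultimately show "\<eta> \<in> (\<lambda>g y. if y \<le> n then g y else 0) ` (PiE {..n} (\<lambda>_. {..N}))"
      by blast
  qed
  then show ?thesis by (rule finite_subset) (auto intro!: finite_PiE)
qed

lemma box_mono: "N \<le> N' \<Longrightarrow> box n N \<subseteq> box n N'"
  unfolding box_def using le_trans by blast

text \<open>Each of the n bonds carries rate at most (N + N) / 2, and creation and removal have rate
  at most j each.\<close>

definition rate_bound :: "nat \<Rightarrow> real \<Rightarrow> nat \<Rightarrow> real" where
  "rate_bound n j N = real n * real N + 2 * j"

lemma gain_one_le:
  assumes "0 \<le> j" "\<xi> \<in> box n N"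
  shows "gain n j (\<lambda>_. 1) \<xi> \<le> rate_bound n j N"
proof -
  have "(\<Sum>x<n. real (\<xi> x) * 1 + real (\<xi> (x+1)) * 1) \<le> (\<Sum>x<n. 2 * real N)"
  proof (rule sum_mono)
    fix x assume "x \<in> {..<n}"
    then have "\<xi> x \<le> N" "\<xi> (x+1) \<le> N" using assms(2) by (auto simp: box_def)
    then show "real (\<xi> x) * 1 + real (\<xi> (x+1)) * 1 \<le> 2 * real N" by simp
  qed
  moreover have "j * (1 / real n) \<le> j"
    using assms(1) by (cases "n = 0") (auto simp: field_simps mult_le_cancel_left1)
  moreover have X: "S \<le> (\<Sum>x<n. 2 * real N) \<Longrightarrow> a \<le> j \<Longrightarrow>
     (1/2) * S + a * 1 + (if b then a * 1 else 0) \<le> real n * real N + 2 * j"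
    for S a :: real and b
    using assms(1) by (cases b) simp_all
  ultimately show ?thesis
    unfolding gain_def rate_bound_def by (intro X)
qed

definition ind :: "config set \<Rightarrow> config \<Rightarrow> real" where
  "ind A \<eta> = (if \<eta> \<in> A then 1 else 0)"

lemma killgen_eq: "killgen n j N f \<xi> = gain n j (\<lambda>\<zeta>. if \<zeta> \<in> box n N then f \<zeta> else 0) \<xi>
    - gain n j (\<lambda>_. 1) \<xi> * (if \<xi> \<in> box n N then f \<xi> else 0)"
  unfolding killgen_def gen_eq_gain ..

lemma killgen_cong:
  assumes "\<And>\<zeta>. \<zeta> \<in> box n N \<Longrightarrow> f \<zeta> = g \<zeta>"
  shows "killgen n j N f = killgen n j N g"
proof -
  have "(\<lambda>\<zeta>. if \<zeta> \<in> box n N then f \<zeta> else 0) = (\<lambda>\<zeta>. if \<zeta> \<in> box n N then g \<zeta> else 0)"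
    using assms by auto
  then show ?thesis unfolding killgen_def by metis
qed

lemma killgen_add: "killgen n j N (\<lambda>\<zeta>. f \<zeta> + g \<zeta>) \<xi> = killgen n j N f \<xi> + killgen n j N g \<xi>"
proof -
  have "(\<lambda>\<zeta>. if \<zeta> \<in> box n N then f \<zeta> + g \<zeta> else 0)
    = (\<lambda>\<zeta>. (if \<zeta> \<in> box n N then f \<zeta> else 0) + (if \<zeta> \<in> box n N then g \<zeta> else 0))" by auto
  then show ?thesis unfolding killgen_def by (simp add: gen_add)
qed

lemma killgen_cmult: "killgen n j N (\<lambda>\<zeta>. c * f \<zeta>) \<xi> = c * killgen n j N f \<xi>"
proof -
  have "(\<lambda>\<zeta>. if \<zeta> \<in> box n N then c * f \<zeta> else 0)
    = (\<lambda>\<zeta>. c * (if \<zeta> \<in> box n N then f \<zeta> else 0))" by auto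
  then show ?thesis unfolding killgen_def by (simp add: gen_cmult)
qed

lemma killgen_sum: "finite I \<Longrightarrow> killgen n j N (\<lambda>\<zeta>. \<Sum>i\<in>I. f i \<zeta>) \<xi> = (\<Sum>i\<in>I. killgen n j N (f i) \<xi>)"
proof (induction I rule: finite_induct)
  case empty
  show ?case by (simp add: killgen_def gen_def)
qed (simp add: killgen_add)

text \<open>The gain and the loss part are each at most the total jump rate times the bound on
  \<open>f\<close>. Iterated, this makes the exponential series converge.\<close>

lemma abs_killgen_le:
  assumes j: "0 \<le> j" and bd: "\<And>\<zeta>. \<zeta> \<in> box n N \<Longrightarrow> \<bar>f \<zeta>\<bar> \<le> C" and C: "0 \<le> C" and \<xi>: "\<xi> \<in> box n N"
  shows "\<bar>killgen n j N f \<xi>\<bar> \<le> 2 * rate_bound n j N * C"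
proof -
  let ?f = "\<lambda>\<zeta>. if \<zeta> \<in> box n N then f \<zeta> else 0"
  have r0: "0 \<le> gain n j (\<lambda>_. 1) \<xi>" by (rule gain_nonneg) (use j in auto)
  have rb: "gain n j (\<lambda>_. 1) \<xi> \<le> rate_bound n j N" by (rule gain_one_le[OF j \<xi>])
  have c: "gain n j (\<lambda>_. c) \<xi> = c * gain n j (\<lambda>_. 1) \<xi>" for c
    using gain_cmult[of n j c "\<lambda>_. 1" \<xi>] by simp
  have bd': "- C \<le> f \<zeta> \<and> f \<zeta> \<le> C" if "\<zeta> \<in> box n N" for \<zeta>
    using bd[OF that] by linarith
  have "gain n j ?f \<xi> \<le> gain n j (\<lambda>_. C) \<xi>"
    by (rule gain_mono[OF j]) (use bd' C in auto)
  moreover have "gain n j (\<lambda>_. - C) \<xi> \<le> gain n j ?f \<xi>"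
    by (rule gain_mono[OF j]) (use bd' C in auto)
  ultimately have "\<bar>gain n j ?f \<xi>\<bar> \<le> C * gain n j (\<lambda>_. 1) \<xi>"
    unfolding c[of C] c[of "- C"] by linarith
  moreover have "\<bar>gain n j (\<lambda>_. 1) \<xi> * ?f \<xi>\<bar> \<le> gain n j (\<lambda>_. 1) \<xi> * C"
    unfolding abs_mult using r0 bd[OF \<xi>] \<xi> by (auto intro!: mult_left_mono)
  moreover have "gain n j (\<lambda>_. 1) \<xi> * C \<le> rate_bound n j N * C"
    using rb C by (rule mult_right_mono)
  moreover have X: "\<bar>A\<bar> \<le> C * g \<Longrightarrow> \<bar>D\<bar> \<le> g * C \<Longrightarrow> g * C \<le> r * C \<Longrightarrow> \<bar>A - D\<bar> \<le> 2 * r * C" for A D g r :: real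
    using abs_triangle_ineq4[of A D] by (simp add: mult.commute)
  ultimately show ?thesis unfolding killgen_eq by (intro X)
qed

lemma rate_bound_nonneg: "0 \<le> j \<Longrightarrow> 0 \<le> rate_bound n j N"
  by (simp add: rate_bound_def)

section \<open>The killed semigroup as an exponential series\<close>

lemma abs_killgen_power_le:
  assumes j: "0 \<le> j" and bd: "\<And>\<zeta>. \<zeta> \<in> box n N \<Longrightarrow> \<bar>f \<zeta>\<bar> \<le> C" and C: "0 \<le> C" and \<xi>: "\<xi> \<in> box n N"
  shows "\<bar>(killgen n j N ^^ k) f \<xi>\<bar> \<le> (2 * rate_bound n j N) ^ k * C"
  using \<xi>
proof (induction k arbitrary: \<xi>)
  case 0
  then show ?case using bd by simp
next
  case (Suc k)
  have "0 \<le> (2 * rate_bound n j N) ^ k * C"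
    using C rate_bound_nonneg[OF j] by simp
  from abs_killgen_le[OF j Suc.IH this Suc.prems] show ?case by (simp add: mult_ac)
qed

text \<open>The exponential of t times the killed generator applied to \<open>f\<close>: the
  expectation of \<open>f\<close> at time t over the trajectories that have not left the box. The
  power series matches the one in \<open>ptrans_kill\<close>.\<close>

definition kexp :: "nat \<Rightarrow> real \<Rightarrow> nat \<Rightarrow> real \<Rightarrow> (config \<Rightarrow> real) \<Rightarrow> config \<Rightarrow> real" where
  "kexp n j N t f \<xi> = (\<Sum>k. t ^ k / fact k * (killgen n j N ^^ k) f \<xi>)"

lemma bounded_on_box: "\<exists>C\<ge>0. \<forall>\<zeta>\<in>box n N. \<bar>f \<zeta> :: real\<bar> \<le> C"
proof -
  have "\<exists>C. \<forall>\<zeta>\<in>box n N. \<bar>f \<zeta>\<bar> \<le> C"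
    using finite_box[of n N] by (intro exI[of _ "Max (insert 0 ((\<lambda>\<zeta>. \<bar>f \<zeta>\<bar>) ` box n N))"]) auto
  then obtain C where "\<forall>\<zeta>\<in>box n N. \<bar>f \<zeta>\<bar> \<le> C" by blast
  then show ?thesis by (intro exI[of _ "max C 0"]) auto
qed

lemma kexp_abs_summable:
  assumes j: "0 \<le> j" and \<xi>: "\<xi> \<in> box n N"
  shows "summable (\<lambda>k. \<bar>t ^ k / fact k * (killgen n j N ^^ k) f \<xi>\<bar>)"
proof -
  obtain C where C: "C \<ge> 0" "\<And>\<zeta>. \<zeta> \<in> box n N \<Longrightarrow> \<bar>f \<zeta>\<bar> \<le> C" using bounded_on_box by blast
  let ?r = "2 * rate_bound n j N"
  have "summable (\<lambda>k. (\<bar>t\<bar> * ?r) ^ k /\<^sub>R fact k * C)"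
    by (intro summable_mult2 summable_exp_generic)
  moreover have "norm \<bar>t ^ k / fact k * (killgen n j N ^^ k) f \<xi>\<bar> \<le> (\<bar>t\<bar> * ?r) ^ k /\<^sub>R fact k * C" for k
  proof -
    have "\<bar>t ^ k / fact k * (killgen n j N ^^ k) f \<xi>\<bar> = \<bar>t\<bar> ^ k / fact k * \<bar>(killgen n j N ^^ k) f \<xi>\<bar>"
      by (simp add: abs_mult power_abs)
    also have "\<dots> \<le> \<bar>t\<bar> ^ k / fact k * (?r ^ k * C)"
      by (intro mult_left_mono abs_killgen_power_le j C \<xi>) auto
    finally show ?thesis by (simp add: power_mult_distrib field_simps)
  qed
  ultimately show ?thesis by (rule summable_comparison_test'[where N = 0])
qed

lemma kexp_summable:
  assumes "0 \<le> j" "\<xi> \<in> box n N"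
  shows "summable (\<lambda>k. t ^ k / fact k * (killgen n j N ^^ k) f \<xi>)"
  using kexp_abs_summable[OF assms] by (rule summable_rabs_cancel)

lemma kexp_0: "kexp n j N 0 f \<xi> = f \<xi>"
proof -
  have "kexp n j N 0 f \<xi> = (\<Sum>k\<in>{0::nat}. 0 ^ k / fact k * (killgen n j N ^^ k) f \<xi>)"
    unfolding kexp_def by (rule suminf_finite) auto
  then show ?thesis by simp
qed

text \<open>Kolmogorov's equation with the generator acting on the observable. The evolution
  equations and moment bounds below are all instances of it for a suitable \<open>f\<close>.\<close>

lemma kexp_has_derivative:
  assumes "0 \<le> j" "\<xi> \<in> box n N"
  shows "((\<lambda>t. kexp n j N t f \<xi>) has_real_derivative kexp n j N t (killgen n j N f) \<xi>) (at t)"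
proof -
  let ?c = "\<lambda>k. (killgen n j N ^^ k) f \<xi> / fact k"
  have "summable (\<lambda>k. ?c k * y ^ k)" for y
    using kexp_summable[OF assms, of y f] by (simp add: mult.commute)
  from termdiffs_strong_converges_everywhere[OF this]
  have "((\<lambda>t. \<Sum>k. ?c k * t ^ k) has_field_derivative (\<Sum>k. diffs ?c k * t ^ k)) (at t)" .
  moreover have "diffs ?c k * t ^ k = t ^ k / fact k * (killgen n j N ^^ k) (killgen n j N f) \<xi>" for k
    by (simp add: diffs_def funpow_swap1 divide_simps del: of_nat_Suc)
  ultimately show ?thesis unfolding kexp_def by (simp add: mult.commute)
qed

lemma killgen_power_cong:
  assumes "\<And>\<zeta>. \<zeta> \<in> box n N \<Longrightarrow> f \<zeta> = g \<zeta>" "\<xi> \<in> box n N"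
  shows "(killgen n j N ^^ k) f \<xi> = (killgen n j N ^^ k) g \<xi>"
proof (cases k)
  case 0
  then show ?thesis using assms by simp
next
  case (Suc m)
  have "killgen n j N f = killgen n j N g" using assms(1) by (rule killgen_cong)
  then show ?thesis unfolding Suc by (simp only: funpow_Suc_right o_apply)
qed

lemma kexp_cong:
  assumes "\<And>\<zeta>. \<zeta> \<in> box n N \<Longrightarrow> f \<zeta> = g \<zeta>" "\<xi> \<in> box n N"
  shows "kexp n j N t f \<xi> = kexp n j N t g \<xi>"
  unfolding kexp_def using killgen_power_cong[OF assms] by simp

lemma killgen_power_add: "(killgen n j N ^^ k) (\<lambda>\<zeta>. f \<zeta> + g \<zeta>) \<xi>
   = (killgen n j N ^^ k) f \<xi> + (killgen n j N ^^ k) g \<xi>"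
proof (induction k arbitrary: \<xi>)
  case (Suc k)
  have "(killgen n j N ^^ k) (\<lambda>\<zeta>. f \<zeta> + g \<zeta>) = (\<lambda>\<xi>. (killgen n j N ^^ k) f \<xi> + (killgen n j N ^^ k) g \<xi>)"
    using Suc.IH by auto
  then show ?case by (simp add: killgen_add)
qed simp

lemma killgen_power_cmult: "(killgen n j N ^^ k) (\<lambda>\<zeta>. c * f \<zeta>) \<xi> = c * (killgen n j N ^^ k) f \<xi>"
proof (induction k arbitrary: \<xi>)
  case (Suc k)
  have "(killgen n j N ^^ k) (\<lambda>\<zeta>. c * f \<zeta>) = (\<lambda>\<xi>. c * (killgen n j N ^^ k) f \<xi>)"
    using Suc.IH by auto
  then show ?case by (simp add: killgen_cmult)
qed simp

lemma kexp_add: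
  assumes "0 \<le> j" "\<xi> \<in> box n N"
  shows "kexp n j N t (\<lambda>\<zeta>. f \<zeta> + g \<zeta>) \<xi> = kexp n j N t f \<xi> + kexp n j N t g \<xi>"
  unfolding kexp_def killgen_power_add distrib_left
  by (intro suminf_add[symmetric] kexp_summable assms)

lemma kexp_cmult:
  assumes "0 \<le> j" "\<xi> \<in> box n N"
  shows "kexp n j N t (\<lambda>\<zeta>. c * f \<zeta>) \<xi> = c * kexp n j N t f \<xi>"
  unfolding kexp_def killgen_power_cmult
  using suminf_mult[OF kexp_summable[OF assms, of t f], of c] by (simp add: mult_ac)

lemma kexp_diff:
  assumes "0 \<le> j" "\<xi> \<in> box n N"
  shows "kexp n j N t (\<lambda>\<zeta>. f \<zeta> - g \<zeta>) \<xi> = kexp n j N t f \<xi> - kexp n j N t g \<xi>"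
  using kexp_add[OF assms, of t f "\<lambda>\<zeta>. (-1) * g \<zeta>"] kexp_cmult[OF assms, of t "-1" g] by simp

lemma kexp_sum:
  assumes "0 \<le> j" "\<xi> \<in> box n N" "finite I"
  shows "kexp n j N t (\<lambda>\<zeta>. \<Sum>i\<in>I. f i \<zeta>) \<xi> = (\<Sum>i\<in>I. kexp n j N t (f i) \<xi>)"
  using assms(3)
proof (induction I rule: finite_induct)
  case empty
  show ?case using kexp_cmult[OF assms(1,2), of t 0 "\<lambda>_. 0"] by simp
qed (simp add: kexp_add[OF assms(1,2)])

text \<open>Links the transition probabilities of the statement to \<open>kexp\<close>: on the box
  the indicator of \<open>A\<close> is a finite sum of point indicators.\<close>

lemma sum_ptrans_kill:
  assumes "0 \<le> j" "\<xi> \<in> box n N"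
  shows "(\<Sum>\<eta>\<in>box n N \<inter> A. ptrans_kill n j N t \<xi> \<eta>) = kexp n j N t (ind A) \<xi>"
proof -
  have "ptrans_kill n j N t \<xi> \<eta> = kexp n j N t (ind {\<eta>}) \<xi>" for \<eta>
    unfolding ptrans_kill_def kexp_def ind_def by simp
  then have "(\<Sum>\<eta>\<in>box n N \<inter> A. ptrans_kill n j N t \<xi> \<eta>)
     = kexp n j N t (\<lambda>\<zeta>. \<Sum>\<eta>\<in>box n N \<inter> A. ind {\<eta>} \<zeta>) \<xi>"
    by (simp add: kexp_sum[OF assms] finite_box)
  also have "\<dots> = kexp n j N t (ind A) \<xi>"
    by (rule kexp_cong) (auto simp: ind_def finite_box assms)
  finally show ?thesis .
qed

section \<open>Positivity, monotonicity and moments of the killed semigroup\<close>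

definition kpos :: "nat \<Rightarrow> real \<Rightarrow> nat \<Rightarrow> real \<Rightarrow> (config \<Rightarrow> real) \<Rightarrow> config \<Rightarrow> real" where
  "kpos n j N \<Lambda> f \<xi> = killgen n j N f \<xi> + \<Lambda> * f \<xi>"

text \<open>Two effects point the same way: targets lying only in the larger box add nonnegative
  terms, and the diagonal coefficient, \<open>\<Lambda>\<close> minus the total jump rate, is
  nonnegative.\<close>

lemma kpos_mono:
  assumes j: "0 \<le> j" and N: "N \<le> N'" and \<Lambda>: "rate_bound n j N \<le> \<Lambda>"
    and g0: "\<And>\<zeta>. \<zeta> \<in> box n N' \<Longrightarrow> 0 \<le> g \<zeta>"
    and le: "\<And>\<zeta>. \<zeta> \<in> box n N \<Longrightarrow> f \<zeta> \<le> g \<zeta>" and \<xi>: "\<xi> \<in> box n N"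
  shows "kpos n j N \<Lambda> f \<xi> \<le> kpos n j N' \<Lambda> g \<xi>"
proof -
  have \<xi>': "\<xi> \<in> box n N'" using box_mono[OF N] \<xi> by blast
  have "gain n j (\<lambda>\<zeta>. if \<zeta> \<in> box n N then f \<zeta> else 0) \<xi> \<le> gain n j (\<lambda>\<zeta>. if \<zeta> \<in> box n N' then g \<zeta> else 0) \<xi>"
  proof (rule gain_mono[OF j])
    fix \<zeta>
    show "(if \<zeta> \<in> box n N then f \<zeta> else 0) \<le> (if \<zeta> \<in> box n N' then g \<zeta> else 0)"
      using le[of \<zeta>] g0[of \<zeta>] box_mono[OF N, of n] by auto
  qed
  moreover have "(\<Lambda> - gain n j (\<lambda>_. 1) \<xi>) * f \<xi> \<le> (\<Lambda> - gain n j (\<lambda>_. 1) \<xi>) * g \<xi>"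
    using gain_one_le[OF j \<xi>] \<Lambda> le[OF \<xi>] by (intro mult_left_mono) auto
  ultimately show ?thesis
    unfolding kpos_def killgen_eq using \<xi> \<xi>' by (simp add: left_diff_distrib)
qed

text \<open>Both claims share one induction, because comparing the boxes at step k + 1 needs the
  k-th iterate on the larger box to be nonnegative.\<close>

lemma kpos_power_nonneg_mono:
  assumes j: "0 \<le> j" and N: "N \<le> N'" and \<Lambda>: "rate_bound n j N' \<le> \<Lambda>"
    and g0: "\<And>\<zeta>. \<zeta> \<in> box n N' \<Longrightarrow> 0 \<le> g \<zeta>"
    and f0: "\<And>\<zeta>. \<zeta> \<in> box n N \<Longrightarrow> 0 \<le> f \<zeta>"
    and le: "\<And>\<zeta>. \<zeta> \<in> box n N \<Longrightarrow> f \<zeta> \<le> g \<zeta>"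
  shows "(\<forall>\<xi>\<in>box n N. (kpos n j N \<Lambda> ^^ k) f \<xi> \<le> (kpos n j N' \<Lambda> ^^ k) g \<xi>)
     \<and> (\<forall>\<xi>\<in>box n N'. 0 \<le> (kpos n j N' \<Lambda> ^^ k) g \<xi>)"
proof (induction k)
  case 0
  then show ?case using assms by simp
next
  case (Suc k)
  have rb: "rate_bound n j N \<le> rate_bound n j N'"
    unfolding rate_bound_def using N by (simp add: mult_left_mono)
  have z: "kpos n j N' \<Lambda> (\<lambda>_. 0) \<xi> = 0" for \<xi>
    unfolding kpos_def killgen_eq by (simp add: gain_0)
  have "(kpos n j N \<Lambda> ^^ Suc k) f \<xi> \<le> (kpos n j N' \<Lambda> ^^ Suc k) g \<xi>" if "\<xi> \<in> box n N" for \<xi>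
    unfolding funpow.simps o_apply
    by (rule kpos_mono) (use Suc that j N \<Lambda> rb in auto)
  moreover have "0 \<le> (kpos n j N' \<Lambda> ^^ Suc k) g \<xi>" if "\<xi> \<in> box n N'" for \<xi>
  proof -
    have "kpos n j N' \<Lambda> (\<lambda>_. 0) \<xi> \<le> kpos n j N' \<Lambda> ((kpos n j N' \<Lambda> ^^ k) g) \<xi>"
      by (rule kpos_mono) (use Suc that j \<Lambda> in auto)
    then show ?thesis by (simp add: z)
  qed
  ultimately show ?case by blast
qed

text \<open>The binomial theorem for \<open>killgen\<close> as \<open>kpos\<close> minus
  \<open>\<Lambda>\<close> times the identity, proved by Pascal's rule on the iterates.\<close>

lemma killgen_power_binomial:
  "(killgen n j N ^^ k) f \<xi> = (\<Sum>i\<le>k. real (k choose i) * (- \<Lambda>) ^ (k - i) * (kpos n j N \<Lambda> ^^ i) f \<xi>)"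
proof (induction k arbitrary: \<xi>)
  case 0
  show ?case by simp
next
  case (Suc k)
  let ?B = "\<lambda>i. (kpos n j N \<Lambda> ^^ i) f \<xi>"
  let ?c = "\<lambda>i. real (k choose i) * (- \<Lambda>) ^ (k - i)"
  have "(killgen n j N ^^ k) f = (\<lambda>\<xi>. \<Sum>i\<le>k. ?c i * (kpos n j N \<Lambda> ^^ i) f \<xi>)"
    using Suc.IH by auto
  then have "(killgen n j N ^^ Suc k) f \<xi> = (\<Sum>i\<le>k. ?c i * killgen n j N ((kpos n j N \<Lambda> ^^ i) f) \<xi>)"
    by (simp add: killgen_sum killgen_cmult)
  also have "\<dots> = (\<Sum>i\<le>k. ?c i * (?B (Suc i) + (- \<Lambda>) * ?B i))"
    by (simp add: kpos_def)
  also have "\<dots> = (\<Sum>i\<le>k. ?c i * ?B (Suc i)) + (\<Sum>i\<le>k. ?c i * (- \<Lambda>) * ?B i)"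
    by (simp only: distrib_left sum.distrib mult.assoc)
  also have "(\<Sum>i\<le>k. ?c i * (- \<Lambda>) * ?B i) = (\<Sum>i\<le>k. real (k choose i) * (- \<Lambda>) ^ (Suc k - i) * ?B i)"
  proof (rule sum.cong[OF refl])
    fix i assume "i \<in> {..k}"
    then have "(- \<Lambda>) ^ (Suc k - i) = (- \<Lambda>) ^ (k - i) * (- \<Lambda>)" by (simp add: Suc_diff_le)
    then show "?c i * (- \<Lambda>) * ?B i = real (k choose i) * (- \<Lambda>) ^ (Suc k - i) * ?B i"
      by (simp only: mult.assoc)
  qed
  also have "\<dots> = (\<Sum>i\<le>Suc k. real (k choose i) * (- \<Lambda>) ^ (Suc k - i) * ?B i)"
    by (simp only: sum.atMost_Suc binomial_eq_0[OF lessI] of_nat_0 mult_zero_left add_0_right)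
  also have "\<dots> = (- \<Lambda>) ^ Suc k * ?B 0 + (\<Sum>i\<le>k. real (k choose Suc i) * (- \<Lambda>) ^ (k - i) * ?B (Suc i))"
    by (simp only: sum.atMost_Suc_shift binomial_n_0 diff_Suc_Suc diff_zero of_nat_1 mult_1_left)
  also have "(\<Sum>i\<le>k. ?c i * ?B (Suc i)) + \<dots>
     = (- \<Lambda>) ^ Suc k * ?B 0 + ((\<Sum>i\<le>k. ?c i * ?B (Suc i)) + (\<Sum>i\<le>k. real (k choose Suc i) * (- \<Lambda>) ^ (k - i) * ?B (Suc i)))"
    by linarith
  also have "\<dots> = (- \<Lambda>) ^ Suc k * ?B 0 + (\<Sum>i\<le>k. real (Suc k choose Suc i) * (- \<Lambda>) ^ (k - i) * ?B (Suc i))"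
    by (simp only: binomial_Suc_Suc of_nat_add distrib_right sum.distrib)
  also have "\<dots> = (\<Sum>i\<le>Suc k. real (Suc k choose i) * (- \<Lambda>) ^ (Suc k - i) * ?B i)"
    by (simp only: sum.atMost_Suc_shift binomial_n_0 diff_Suc_Suc diff_zero of_nat_1 mult_1_left)
  finally show ?case .
qed

lemma kpos_power_bound:
  assumes j: "0 \<le> j" and \<Lambda>: "0 \<le> \<Lambda>" and bd: "\<And>\<zeta>. \<zeta> \<in> box n N \<Longrightarrow> \<bar>f \<zeta>\<bar> \<le> C" and C: "0 \<le> C" and \<xi>: "\<xi> \<in> box n N"
  shows "\<bar>(kpos n j N \<Lambda> ^^ k) f \<xi>\<bar> \<le> (2 * rate_bound n j N + \<Lambda>) ^ k * C"
  using \<xi>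
proof (induction k arbitrary: \<xi>)
  case 0
  then show ?case using bd by simp
next
  case (Suc k)
  let ?D = "(2 * rate_bound n j N + \<Lambda>) ^ k * C"
  have "0 \<le> ?D"
    using C rate_bound_nonneg[OF j] \<Lambda> by simp
  from abs_killgen_le[OF j Suc.IH this Suc.prems]
  have 1: "\<bar>killgen n j N ((kpos n j N \<Lambda> ^^ k) f) \<xi>\<bar> \<le> 2 * rate_bound n j N * ?D" by simp
  have 2: "\<bar>\<Lambda> * (kpos n j N \<Lambda> ^^ k) f \<xi>\<bar> \<le> \<Lambda> * ?D"
    using Suc.IH[OF Suc.prems] \<Lambda> by (simp add: abs_mult mult_left_mono)
  have "\<bar>(kpos n j N \<Lambda> ^^ Suc k) f \<xi>\<bar> \<le> 2 * rate_bound n j N * ?D + \<Lambda> * ?D"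
    unfolding funpow.simps o_apply kpos_def[of _ _ _ _ "(kpos n j N \<Lambda> ^^ k) f"] using 1 2 by linarith
  then show ?case by (simp add: distrib_right mult.assoc)
qed

text \<open>Adding a multiple of the identity that dominates all jump rates turns the generator into a
positive operator; positivity of the semigroup and monotonicity in the box can then be read off termwise.\<close>

lemma kexp_eq_kpos:
  assumes j: "0 \<le> j" and \<xi>: "\<xi> \<in> box n N" and \<Lambda>: "0 \<le> \<Lambda>"
  shows "summable (\<lambda>k. t ^ k / fact k * (kpos n j N \<Lambda> ^^ k) f \<xi>)"
    and "kexp n j N t f \<xi> = (\<Sum>k. t ^ k / fact k * (kpos n j N \<Lambda> ^^ k) f \<xi>) * exp (- \<Lambda> * t)"
proof -
  let ?a = "\<lambda>k. t ^ k / fact k * (kpos n j N \<Lambda> ^^ k) f \<xi>"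
  let ?b = "\<lambda>k. (- \<Lambda> * t) ^ k /\<^sub>R fact k"
  obtain C where C: "C \<ge> 0" "\<And>\<zeta>. \<zeta> \<in> box n N \<Longrightarrow> \<bar>f \<zeta>\<bar> \<le> C" using bounded_on_box by blast
  let ?r = "2 * rate_bound n j N + \<Lambda>"
  have "summable (\<lambda>k. (\<bar>t\<bar> * ?r) ^ k /\<^sub>R fact k * C)"
    by (intro summable_mult2 summable_exp_generic)
  moreover have "norm (norm (?a k)) \<le> (\<bar>t\<bar> * ?r) ^ k /\<^sub>R fact k * C" for k
  proof -
    have "norm (norm (?a k)) = \<bar>t\<bar> ^ k / fact k * \<bar>(kpos n j N \<Lambda> ^^ k) f \<xi>\<bar>"
      by (simp add: abs_mult power_abs)
    also have "\<dots> \<le> \<bar>t\<bar> ^ k / fact k * (?r ^ k * C)"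
      by (intro mult_left_mono kpos_power_bound j C \<xi> \<Lambda>) auto
    finally show ?thesis by (simp add: power_mult_distrib divide_inverse mult_ac)
  qed
  ultimately have sa: "summable (\<lambda>k. norm (?a k))" by (rule summable_comparison_test'[where N = 0])
  then show "summable ?a" by (rule summable_norm_cancel)
  have sb: "summable (\<lambda>k. norm (?b k))"
    by (rule summable_norm_exp)
  \<comment> \<open>The k-th coefficient of the product with the series of exp (- \<Lambda> t) is
    the binomial expansion of the k-th iterate of \<open>killgen\<close>.\<close>
  have CP: "(\<Sum>k. ?a k) * (\<Sum>k. ?b k) = (\<Sum>k. \<Sum>i\<le>k. ?a i * ?b (k - i))"
    by (rule Cauchy_product[OF sa sb])
  have "(\<Sum>i\<le>k. ?a i * ?b (k - i)) = t ^ k / fact k * (killgen n j N ^^ k) f \<xi>" for k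
  proof -
    have "?a i * ?b (k - i) = t ^ k / fact k * (real (k choose i) * (- \<Lambda>) ^ (k - i) * (kpos n j N \<Lambda> ^^ i) f \<xi>)"
      if "i \<le> k" for i
    proof -
      have tk: "t ^ k = t ^ i * t ^ (k - i)" using that by (simp add: power_add[symmetric])
      have X: "F \<noteq> 0 \<Longrightarrow> p / a * A * ((L * T) /\<^sub>R b) = (p * T) / F * (F / (a * b) * L * A)"
        for p a A L T b F :: real
        by (simp add: divide_inverse)
      have Y: "t ^ i / fact i * A * (((-\<Lambda>) ^ (k-i) * t ^ (k-i)) /\<^sub>R fact (k-i))
        = t ^ k / fact k * (fact k / (fact i * fact (k-i)) * (-\<Lambda>) ^ (k-i) * A)" for A
        unfolding tk by (rule X) simp
      show ?thesis
        unfolding power_mult_distrib[of "-\<Lambda>" t] binomial_fact[OF that] by (rule Y)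
    qed
    then have "(\<Sum>i\<le>k. ?a i * ?b (k - i)) = (\<Sum>i\<le>k. t ^ k / fact k * (real (k choose i) * (- \<Lambda>) ^ (k - i) * (kpos n j N \<Lambda> ^^ i) f \<xi>))"
      by (intro sum.cong[OF refl]) (simp only: atMost_iff)
    also have "\<dots> = t ^ k / fact k * (killgen n j N ^^ k) f \<xi>"
      by (subst killgen_power_binomial[where \<Lambda>=\<Lambda>]) (rule sum_distrib_left[symmetric])
    finally show ?thesis .
  qed
  then show "kexp n j N t f \<xi> = (\<Sum>k. ?a k) * exp (- \<Lambda> * t)"
    unfolding kexp_def exp_def CP by presburger
qed

lemma kexp_mono_box:
  assumes j: "0 \<le> j" and N: "N \<le> N'" and t: "0 \<le> t" and \<xi>: "\<xi> \<in> box n N"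
    and f0: "\<And>\<zeta>. \<zeta> \<in> box n N' \<Longrightarrow> 0 \<le> f \<zeta>"
  shows "kexp n j N t f \<xi> \<le> kexp n j N' t f \<xi>"
proof -
  \<comment> \<open>The shift is the rate bound of the larger box, which also dominates the rates in
    the smaller one; the two series can then be compared term by term.\<close>
  let ?\<Lambda> = "rate_bound n j N'"
  have \<xi>': "\<xi> \<in> box n N'" using box_mono[OF N] \<xi> by blast
  have \<Lambda>: "0 \<le> ?\<Lambda>" by (rule rate_bound_nonneg[OF j])
  have "(\<Sum>k. t ^ k / fact k * (kpos n j N ?\<Lambda> ^^ k) f \<xi>) \<le> (\<Sum>k. t ^ k / fact k * (kpos n j N' ?\<Lambda> ^^ k) f \<xi>)"
  proof (rule suminf_le)
    fix k
    have "(kpos n j N ?\<Lambda> ^^ k) f \<xi> \<le> (kpos n j N' ?\<Lambda> ^^ k) f \<xi>"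
      by (rule bspec[OF conjunct1[OF kpos_power_nonneg_mono[OF j N order_refl f0]] \<xi>])
        (use f0 box_mono[OF N, of n] in auto)
    then show "t ^ k / fact k * (kpos n j N ?\<Lambda> ^^ k) f \<xi> \<le> t ^ k / fact k * (kpos n j N' ?\<Lambda> ^^ k) f \<xi>"
      using t by (intro mult_left_mono) auto
  qed (rule kexp_eq_kpos(1)[OF j _ \<Lambda>]; fact)+
  then show ?thesis
    unfolding kexp_eq_kpos(2)[OF j \<xi> \<Lambda>] kexp_eq_kpos(2)[OF j \<xi>' \<Lambda>]
    by (intro mult_right_mono) auto
qed

lemma kexp_nonneg:
  assumes j: "0 \<le> j" and t: "0 \<le> t" and \<xi>: "\<xi> \<in> box n N"
    and f0: "\<And>\<zeta>. \<zeta> \<in> box n N \<Longrightarrow> 0 \<le> f \<zeta>"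
  shows "0 \<le> kexp n j N t f \<xi>"
proof -
  let ?\<Lambda> = "rate_bound n j N"
  have \<Lambda>: "0 \<le> ?\<Lambda>" by (rule rate_bound_nonneg[OF j])
  have "0 \<le> (\<Sum>k. t ^ k / fact k * (kpos n j N ?\<Lambda> ^^ k) f \<xi>)"
  proof (rule suminf_nonneg)
    show "summable (\<lambda>k. t ^ k / fact k * (kpos n j N ?\<Lambda> ^^ k) f \<xi>)"
      by (rule kexp_eq_kpos(1)[OF j \<xi> \<Lambda>])
    fix k
    have "0 \<le> (kpos n j N ?\<Lambda> ^^ k) f \<xi>"
      by (rule bspec[OF conjunct2[OF kpos_power_nonneg_mono[where f=f and g=f, OF j order_refl order_refl f0]] \<xi>])
        (use f0 in auto)
    then show "0 \<le> t ^ k / fact k * (kpos n j N ?\<Lambda> ^^ k) f \<xi>" using t by simp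
  qed
  then show ?thesis unfolding kexp_eq_kpos(2)[OF j \<xi> \<Lambda>] by simp
qed

lemma kexp_mono:
  assumes j: "0 \<le> j" and t: "0 \<le> t" and \<xi>: "\<xi> \<in> box n N"
    and le: "\<And>\<zeta>. \<zeta> \<in> box n N \<Longrightarrow> f \<zeta> \<le> g \<zeta>"
  shows "kexp n j N t f \<xi> \<le> kexp n j N t g \<xi>"
  using kexp_nonneg[OF j t \<xi>, of "\<lambda>\<zeta>. g \<zeta> - f \<zeta>"] le by (simp add: kexp_diff[OF j \<xi>])

lemma kexp_const:
  assumes "0 \<le> j" "\<xi> \<in> box n N"
  shows "kexp n j N t (\<lambda>_. c) \<xi> = c * kexp n j N t (\<lambda>_. 1) \<xi>"
  using kexp_cmult[OF assms, of t c "\<lambda>_. 1"] by simp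

text \<open>The killed generator maps 1 to minus the rate of leaving the box, so the surviving
  probability decreases in time.\<close>

lemma kexp_one_le:
  assumes j: "0 \<le> j" and t: "0 \<le> t" and \<xi>: "\<xi> \<in> box n N"
  shows "kexp n j N t (\<lambda>_. 1) \<xi> \<le> 1"
proof -
  have "kexp n j N t (\<lambda>_. 1) \<xi> \<le> kexp n j N 0 (\<lambda>_. 1) \<xi>"
  proof (rule DERIV_nonpos_imp_nonincreasing[OF t])
    fix s :: real assume s: "0 \<le> s"
    have "killgen n j N (\<lambda>_. 1) \<zeta> \<le> 0" if "\<zeta> \<in> box n N" for \<zeta>
      unfolding killgen_eq using that gain_mono[OF j, of n \<zeta> "\<lambda>\<zeta>. if \<zeta> \<in> box n N then 1 else 0" "\<lambda>_. 1"] by simp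
    then have "kexp n j N s (killgen n j N (\<lambda>_. 1)) \<xi> \<le> kexp n j N s (\<lambda>_. 0) \<xi>"
      by (intro kexp_mono[OF j s \<xi>])
    also have "\<dots> = 0" using kexp_const[OF j \<xi>, of s 0] by simp
    finally show "\<exists>y. ((\<lambda>t. kexp n j N t (\<lambda>_. 1) \<xi>) has_real_derivative y) (at s) \<and> y \<le> 0"
      using kexp_has_derivative[OF j \<xi>] by blast
  qed
  then show ?thesis by (simp add: kexp_0)
qed

text \<open>Gronwall for a Lyapunov function. Since \<open>V\<close> is nonnegative everywhere,
  cutting it off outside the box only lowers the generator; adding b / a makes the differential
  inequality homogeneous.\<close>

lemma kexp_moment_bound:
  assumes j: "0 \<le> j" and t: "0 \<le> t" and \<xi>: "\<xi> \<in> box n N" and a: "0 < a" and b: "0 \<le> b"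
    and V0: "\<And>\<zeta>. 0 \<le> V \<zeta>" and V: "\<And>\<zeta>. \<zeta> \<in> box n N \<Longrightarrow> gen n j V \<zeta> \<le> a * V \<zeta> + b"
  shows "kexp n j N t V \<xi> \<le> (V \<xi> + b / a) * exp (a * t)"
proof -
  let ?g = "\<lambda>t. exp (- (a * t)) * (kexp n j N t V \<xi> + b / a)"
  have "?g t \<le> ?g 0"
  proof (rule DERIV_nonpos_imp_nonincreasing[OF t])
    fix s :: real assume s: "0 \<le> s"
    have "killgen n j N V \<zeta> \<le> a * V \<zeta> + b" if "\<zeta> \<in> box n N" for \<zeta>
    proof -
      have "gain n j (\<lambda>\<zeta>. if \<zeta> \<in> box n N then V \<zeta> else 0) \<zeta> \<le> gain n j V \<zeta>"
        by (rule gain_mono[OF j]) (use V0 in auto)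
      then have "killgen n j N V \<zeta> \<le> gen n j V \<zeta>"
        unfolding killgen_eq gen_eq_gain using that by simp
      then show ?thesis using V[OF that] by simp
    qed
    then have "kexp n j N s (killgen n j N V) \<xi> \<le> kexp n j N s (\<lambda>\<zeta>. a * V \<zeta> + b) \<xi>"
      by (intro kexp_mono[OF j s \<xi>])
    also have "\<dots> = a * kexp n j N s V \<xi> + b * kexp n j N s (\<lambda>_. 1) \<xi>"
      by (simp add: kexp_add[OF j \<xi>] kexp_cmult[OF j \<xi>] kexp_const[OF j \<xi>, of s b])
    also have "\<dots> \<le> a * kexp n j N s V \<xi> + b"
      using mult_left_mono[OF kexp_one_le[OF j s \<xi>] b] by simp
    finally have le: "kexp n j N s (killgen n j N V) \<xi> \<le> a * kexp n j N s V \<xi> + b" .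
    have D: "(?g has_real_derivative (exp (- (a * s)) * (kexp n j N s (killgen n j N V) \<xi>)
        + (exp (- (a * s)) * (- a)) * (kexp n j N s V \<xi> + b / a))) (at s)"
      by (auto intro!: derivative_eq_intros kexp_has_derivative[OF j \<xi>])
    have "(exp (- (a * s)) * (kexp n j N s (killgen n j N V) \<xi>)
        + (exp (- (a * s)) * (- a)) * (kexp n j N s V \<xi> + b / a))
      = exp (- (a * s)) * (kexp n j N s (killgen n j N V) \<xi> - (a * kexp n j N s V \<xi> + b))"
      using a by (simp add: field_simps)
    also have "\<dots> \<le> 0" using le by (intro mult_nonneg_nonpos) auto
    finally show "\<exists>y. (?g has_real_derivative y) (at s) \<and> y \<le> 0" using D by blast
  qed
  then have "exp (- (a * t)) * (kexp n j N t V \<xi> + b / a) \<le> V \<xi> + b / a" by (simp add: kexp_0)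
  then have "exp (a * t) * (exp (- (a * t)) * (kexp n j N t V \<xi> + b / a)) \<le> exp (a * t) * (V \<xi> + b / a)"
    by (intro mult_left_mono) auto
  then have "kexp n j N t V \<xi> + b / a \<le> (V \<xi> + b / a) * exp (a * t)"
    by (simp add: mult.assoc[symmetric] mult_exp_exp mult.commute)
  moreover have "0 \<le> b / a" using a b by simp
  ultimately show ?thesis by linarith
qed

lemma kexp_abs_le:
  assumes j: "0 \<le> j" and t: "0 \<le> t" and \<xi>: "\<xi> \<in> box n N"
    and le: "\<And>\<zeta>. \<zeta> \<in> box n N \<Longrightarrow> \<bar>f \<zeta>\<bar> \<le> g \<zeta>"
  shows "\<bar>kexp n j N t f \<xi>\<bar> \<le> kexp n j N t g \<xi>"
proof -
  have "kexp n j N t f \<xi> \<le> kexp n j N t g \<xi>"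
    by (rule kexp_mono[OF j t \<xi>]) (use le in fastforce)
  moreover have "kexp n j N t (\<lambda>\<zeta>. (-1) * f \<zeta>) \<xi> \<le> kexp n j N t g \<xi>"
    by (rule kexp_mono[OF j t \<xi>]) (use le in fastforce)
  ultimately show ?thesis unfolding kexp_cmult[OF j \<xi>] by linarith
qed

lemma continuous_on_kexp:
  assumes "0 \<le> j" "\<xi> \<in> box n N"
  shows "continuous_on S (\<lambda>t. kexp n j N t f \<xi>)"
  by (rule continuous_at_imp_continuous_on) (use kexp_has_derivative[OF assms] DERIV_isCont in blast)

text \<open>From the first box containing \<xi> on, the killed probabilities increase in N and stay
  below 1, so the \<open>lim\<close> in \<open>prob_at\<close> is a genuine limit.\<close>

lemma prob_at_tendsto:
  assumes j: "0 \<le> j" and t: "0 \<le> t" and \<xi>: "\<xi> \<in> box n N0"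
  shows "(\<lambda>N. kexp n j N t (ind A) \<xi>) \<longlonglongrightarrow> prob_at n j \<xi> t A"
    and "N \<ge> N0 \<Longrightarrow> kexp n j N t (ind A) \<xi> \<le> prob_at n j \<xi> t A"
    and "prob_at n j \<xi> t A \<le> 1" and "0 \<le> prob_at n j \<xi> t A"
proof -
  let ?a = "\<lambda>N. kexp n j N t (ind A) \<xi>"
  have box: "\<xi> \<in> box n N" if "N \<ge> N0" for N using box_mono[OF that] \<xi> by blast
  have le1: "?a N \<le> 1" if "N \<ge> N0" for N
    using kexp_mono[OF j t box[OF that], of "ind A" "\<lambda>_. 1"] kexp_one_le[OF j t box[OF that]]
    by (fastforce simp: ind_def)
  have inc: "?a N \<le> ?a N'" if "N \<ge> N0" "N \<le> N'" for N N'
    by (rule kexp_mono_box[OF j that(2) t box[OF that(1)]]) (simp add: ind_def)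
  have "incseq (\<lambda>k. ?a (k + N0))"
    unfolding incseq_def using inc by simp
  then obtain L where L: "(\<lambda>k. ?a (k + N0)) \<longlonglongrightarrow> L" and Lb: "\<And>i. ?a (i + N0) \<le> L"
    using incseq_convergent[of "\<lambda>k. ?a (k + N0)" 1] le1 by auto
  from L have L': "?a \<longlonglongrightarrow> L" by (rule LIMSEQ_offset)
  have "(\<lambda>N. \<Sum>\<eta>\<in>box n N \<inter> A. ptrans_kill n j N t \<xi> \<eta>) \<longlonglongrightarrow> L"
  proof (rule Lim_transform_eventually[OF L'])
    show "\<forall>\<^sub>F N in sequentially. ?a N = (\<Sum>\<eta>\<in>box n N \<inter> A. ptrans_kill n j N t \<xi> \<eta>)"
      using eventually_ge_at_top[of N0] by eventually_elim (simp add: sum_ptrans_kill[OF j box])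
  qed
  then have eq: "prob_at n j \<xi> t A = L" unfolding prob_at_def by (rule limI)
  show "?a \<longlonglongrightarrow> prob_at n j \<xi> t A" using L' eq by simp
  show "?a N \<le> prob_at n j \<xi> t A" if "N \<ge> N0" for N
    using Lb[of "N - N0"] that eq by simp
  show "prob_at n j \<xi> t A \<le> 1"
    unfolding eq by (rule LIMSEQ_le_const2[OF L]) (use le1 in auto)
  have "0 \<le> ?a N0" by (rule kexp_nonneg[OF j t \<xi>]) (simp add: ind_def)
  then show "0 \<le> prob_at n j \<xi> t A" using Lb[of 0] eq by simp
qed

section \<open>Linear functionals of the configuration\<close>

definition lin :: "nat \<Rightarrow> (nat \<Rightarrow> real) \<Rightarrow> config \<Rightarrow> real" where
  "lin n \<phi> \<xi> = (\<Sum>x\<le>n. \<phi> x * real (\<xi> x))"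

abbreviation mass :: "nat \<Rightarrow> config \<Rightarrow> real" where
  "mass n \<equiv> lin n (\<lambda>_. 1)"

lemma mass_nonneg: "0 \<le> mass n \<xi>"
  unfolding lin_def by (intro sum_nonneg) simp

lemma lin_upd:
  assumes "x \<le> n"
  shows "lin n \<phi> (\<xi>(x := v)) = lin n \<phi> \<xi> + \<phi> x * (real v - real (\<xi> x))"
proof -
  have "(\<Sum>y\<in>{..n} - {x}. \<phi> y * real ((\<xi>(x := v)) y)) = (\<Sum>y\<in>{..n} - {x}. \<phi> y * real (\<xi> y))"
    by (rule sum.cong) auto
  then show ?thesis
    unfolding lin_def using assms
    by (simp add: sum.remove[of "{..n}" x] right_diff_distrib)
qed

lemma lin_move:
  assumes "x \<le> n" "y \<le> n" "x \<noteq> y" "0 < \<xi> x"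
  shows "lin n \<phi> (move \<xi> x y) = lin n \<phi> \<xi> + \<phi> y - \<phi> x"
  unfolding move_def lin_upd[OF assms(2)] lin_upd[OF assms(1)] using assms by (simp add: of_nat_diff right_diff_distrib)

lemma abs_lin_le:
  assumes "\<And>x. x \<le> n \<Longrightarrow> \<bar>\<phi> x\<bar> \<le> K"
  shows "\<bar>lin n \<phi> \<xi>\<bar> \<le> K * mass n \<xi>"
proof -
  have "\<bar>lin n \<phi> \<xi>\<bar> \<le> (\<Sum>x\<le>n. \<bar>\<phi> x * real (\<xi> x)\<bar>)"
    unfolding lin_def by (rule sum_abs)
  also have "\<dots> \<le> (\<Sum>x\<le>n. K * (1 * real (\<xi> x)))"
    by (rule sum_mono) (use assms in \<open>auto simp: abs_mult intro!: mult_right_mono\<close>)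
  finally show ?thesis unfolding lin_def sum_distrib_left by simp
qed

lemma rightmost_props:
  assumes "\<exists>y\<le>n. 0 < \<xi> y"
  shows "rightmost n \<xi> \<le> n" "0 < \<xi> (rightmost n \<xi>)" "\<And>y. y \<le> n \<Longrightarrow> 0 < \<xi> y \<Longrightarrow> y \<le> rightmost n \<xi>"
proof -
  obtain y where y: "y \<le> n \<and> 0 < \<xi> y" using assms by blast
  have "rightmost n \<xi> \<le> n \<and> 0 < \<xi> (rightmost n \<xi>)"
    unfolding rightmost_def by (rule GreatestI_nat[where P = "\<lambda>y. y \<le> n \<and> 0 < \<xi> y" and b=n, OF y]) blast
  then show "rightmost n \<xi> \<le> n" "0 < \<xi> (rightmost n \<xi>)" by auto
  show "z \<le> rightmost n \<xi>" if "z \<le> n" "0 < \<xi> z" for z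
    unfolding rightmost_def by (rule Greatest_le_nat[where b=n]) (use that in auto)
qed

text \<open>The value of a linear functional on the particle created at 0 minus that on the particle
  removed at R. From the empty configuration nothing is removed, which keeps the value nonnegative
  for nonnegative \<phi>.\<close>

definition bdry :: "nat \<Rightarrow> (nat \<Rightarrow> real) \<Rightarrow> config \<Rightarrow> real" where
  "bdry n \<phi> \<xi> = \<phi> 0 - (if \<exists>y\<le>n. 0 < \<xi> y then \<phi> (rightmost n \<xi>) else 0)"

lemma gen_lin:
  "gen n j (lin n \<phi>) \<xi> = (1/2) * (\<Sum>x<n. real (\<xi> x) * (\<phi> (x+1) - \<phi> x) + real (\<xi> (x+1)) * (\<phi> x - \<phi> (x+1)))
     + j / real n * bdry n \<phi> \<xi>"
proof -
  have "(\<Sum>x<n. real (\<xi> x) * (lin n \<phi> (move \<xi> x (x+1)) - lin n \<phi> \<xi>)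
        + real (\<xi> (x+1)) * (lin n \<phi> (move \<xi> (x+1) x) - lin n \<phi> \<xi>))
    = (\<Sum>x<n. real (\<xi> x) * (\<phi> (x+1) - \<phi> x) + real (\<xi> (x+1)) * (\<phi> x - \<phi> (x+1)))"
  proof (rule sum.cong[OF refl])
    fix x assume "x \<in> {..<n}"
    then have x: "x \<le> n" "x + 1 \<le> n" by auto
    have "real (\<xi> x) * (lin n \<phi> (move \<xi> x (x+1)) - lin n \<phi> \<xi>) = real (\<xi> x) * (\<phi> (x+1) - \<phi> x)"
      by (cases "\<xi> x = 0") (use lin_move[of x n "x+1" \<xi> \<phi>] x in simp_all)
    moreover have "real (\<xi> (x+1)) * (lin n \<phi> (move \<xi> (x+1) x) - lin n \<phi> \<xi>) = real (\<xi> (x+1)) * (\<phi> x - \<phi> (x+1))"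
      by (cases "\<xi> (x+1) = 0") (use lin_move[of "x+1" n x \<xi> \<phi>] x in simp_all)
    ultimately show "real (\<xi> x) * (lin n \<phi> (move \<xi> x (x+1)) - lin n \<phi> \<xi>)
        + real (\<xi> (x+1)) * (lin n \<phi> (move \<xi> (x+1) x) - lin n \<phi> \<xi>)
      = real (\<xi> x) * (\<phi> (x+1) - \<phi> x) + real (\<xi> (x+1)) * (\<phi> x - \<phi> (x+1))" by (simp only:)
  qed
  moreover have "lin n \<phi> (\<xi>(0 := \<xi> 0 + 1)) - lin n \<phi> \<xi> = \<phi> 0"
    by (simp add: lin_upd)
  moreover have "lin n \<phi> (\<xi>(rightmost n \<xi> := \<xi> (rightmost n \<xi>) - 1)) - lin n \<phi> \<xi> = - \<phi> (rightmost n \<xi>)"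
    if "\<exists>y\<le>n. 0 < \<xi> y"
    using rightmost_props(1,2)[OF that] by (simp add: lin_upd of_nat_diff)
  moreover have X: "S = S' \<Longrightarrow> p = \<phi> 0 \<Longrightarrow> (b \<Longrightarrow> q = - r) \<Longrightarrow>
     (1/2) * S + a * (1 / m) * p + (if b then a * (1/m) * q else 0) = (1/2) * S' + a / m * (\<phi> 0 - (if b then r else 0))"
    for S S' a p q r m :: real and b
    by (cases b) (simp_all add: right_diff_distrib)
  ultimately show ?thesis
    unfolding gen_def bdry_def by (intro X)
qed

text \<open>With sites at half-integer multiples of h, the missing neighbours of 0 and n would carry
  the same value as 0 and n themselves, since cos is symmetric about 0 and about k pi. The bulk
  recurrence cos (a + h) + cos (a - h) = 2 cos h cos a therefore holds at the two ends as
  well.\<close>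

lemma neumann_cos_eigen:
  fixes h :: real
  assumes n: "1 \<le> n" and h: "h * (real n + 1) = real k * pi"
    and \<phi>: "\<And>x. \<phi> x = cos (h * (real x + 1/2))"
  shows "(\<Sum>x<n. real (\<xi> x) * (\<phi> (x+1) - \<phi> x) + real (\<xi> (x+1)) * (\<phi> x - \<phi> (x+1)))
     = 2 * (cos h - 1) * lin n \<phi> \<xi>"
proof -
  \<comment> \<open>\<open>A\<close> and \<open>B\<close> are the coefficients of \<xi>(x)
    contributed by jumps to the right and to the left; \<open>A\<close> vanishes at n and
    \<open>B\<close> at 0.\<close>
  define A where "A x = (if x < n then \<phi> (x+1) - \<phi> x else 0)" for x
  define B where "B x = (if 0 < x then \<phi> (x-1) - \<phi> x else 0)" for x
  have "(\<Sum>x<n. real (\<xi> x) * (\<phi> (x+1) - \<phi> x)) = (\<Sum>x<n. real (\<xi> x) * A x)"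
    by (rule sum.cong) (auto simp: A_def)
  also have "\<dots> = (\<Sum>x\<le>n. real (\<xi> x) * A x)"
    by (simp add: lessThan_Suc_atMost[symmetric] A_def)
  finally have 1: "(\<Sum>x<n. real (\<xi> x) * (\<phi> (x+1) - \<phi> x)) = (\<Sum>x\<le>n. real (\<xi> x) * A x)" .
  have "(\<Sum>x\<le>n. real (\<xi> x) * B x) = (\<Sum>x<Suc n. real (\<xi> x) * B x)"
    by (simp only: lessThan_Suc_atMost)
  also have "\<dots> = real (\<xi> 0) * B 0 + (\<Sum>x<n. real (\<xi> (Suc x)) * B (Suc x))"
    by (rule sum.lessThan_Suc_shift)
  finally have 2: "(\<Sum>x<n. real (\<xi> (x+1)) * (\<phi> x - \<phi> (x+1))) = (\<Sum>x\<le>n. real (\<xi> x) * B x)"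
    by (simp add: B_def)
  have AB: "A x + B x = 2 * (cos h - 1) * \<phi> x" if x: "x \<le> n" for x
  proof -
    define a where "a = h * (real x + 1/2)"
    have sumc: "cos (a + h) + cos (a - h) = 2 * cos h * cos a"
      by (simp add: cos_add cos_diff)
    have px: "\<phi> x = cos a" unfolding \<phi> a_def ..
    have 3: "A x = cos (a + h) - cos a"
    proof (cases "x < n")
      case True
      have "\<phi> (x+1) = cos (a + h)" unfolding \<phi> a_def by (simp add: algebra_simps)
      then show ?thesis using True px by (simp add: A_def)
    next
      case False
      then have "x = n" using x by simp
      have "a = real k * pi - h/2" "a + h = real k * pi + h/2"
        unfolding a_def \<open>x = n\<close> h[symmetric] by (simp_all add: algebra_simps)
      moreover have "sin (real k * pi) = 0" by simp
      ultimately have "cos (a + h) = cos a"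
        by (simp only: cos_add cos_diff)
      then show ?thesis using False by (simp add: A_def)
    qed
    have 4: "B x = cos (a - h) - cos a"
    proof (cases "0 < x")
      case True
      have "\<phi> (x-1) = cos (a - h)" unfolding \<phi> a_def using True by (simp add: algebra_simps of_nat_diff)
      then show ?thesis using True px by (simp add: B_def)
    next
      case False
      then have "a - h = - (h/2)" "a = h/2" unfolding a_def by simp_all
      then have "cos (a - h) = cos a" by (simp only: cos_minus)
      then show ?thesis using False by (simp add: B_def)
    qed
    show ?thesis unfolding 3 4 px using sumc by (simp add: algebra_simps)
  qed
  have "(\<Sum>x<n. real (\<xi> x) * (\<phi> (x+1) - \<phi> x) + real (\<xi> (x+1)) * (\<phi> x - \<phi> (x+1)))
     = (\<Sum>x\<le>n. real (\<xi> x) * (A x + B x))"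
    by (simp only: sum.distrib 1 2 distrib_left)
  also have "\<dots> = (\<Sum>x\<le>n. 2 * (cos h - 1) * (\<phi> x * real (\<xi> x)))"
  proof (rule sum.cong[OF refl])
    fix x assume "x \<in> {..n}"
    then have "A x + B x = 2 * (cos h - 1) * \<phi> x" by (intro AB) simp
    then show "real (\<xi> x) * (A x + B x) = 2 * (cos h - 1) * (\<phi> x * real (\<xi> x))" by simp
  qed
  finally show ?thesis by (simp only: lin_def sum_distrib_left)
qed

definition cosg :: "nat \<Rightarrow> nat \<Rightarrow> nat \<Rightarrow> real" where
  "cosg n k x = cos (real k * pi * ((real x + 1/2) / (real n + 1)))"

text \<open>Decay rate of the k-th mode in diffusive time, the factor n^2 being the time scale; its
  limit in n is \<open>mu k\<close>.\<close>

definition lam :: "nat \<Rightarrow> nat \<Rightarrow> real" where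
  "lam n k = (real n)\<^sup>2 * (1 - cos (real k * pi / (real n + 1)))"

lemma gen_cosg:
  assumes n: "1 \<le> n"
  shows "gen n j (lin n (cosg n k)) \<xi> = - (lam n k / (real n)\<^sup>2) * lin n (cosg n k) \<xi> + j / real n * bdry n (cosg n k) \<xi>"
proof -
  have h: "real k * pi / (real n + 1) * (real n + 1) = real k * pi" by simp
  have c: "cosg n k x = cos (real k * pi / (real n + 1) * (real x + 1/2))" for x
    unfolding cosg_def by simp
  have "lam n k / (real n)\<^sup>2 = 1 - cos (real k * pi / (real n + 1))"
    unfolding lam_def using n by simp
  moreover have X: "l = 1 - c \<Longrightarrow> 1 / 2 * (2 * (c - 1) * y) + z = - l * y + z" for l c y z :: real
    by hypsubst (simp add: algebra_simps)
  ultimately show ?thesis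
    unfolding gen_lin neumann_cos_eigen[OF n h c] by (intro X)
qed

lemma succs_mass_le:
  assumes "\<zeta> \<in> succs n \<xi>"
  shows "mass n \<zeta> \<le> mass n \<xi> + 1"
proof -
  have "mass n (move \<xi> x (x+1)) \<le> mass n \<xi> + 1" if "x < n" "0 < \<xi> x" for x
    using that by (subst lin_move) auto
  moreover have "mass n (move \<xi> (x+1) x) \<le> mass n \<xi> + 1" if "x < n" "0 < \<xi> (x+1)" for x
    using that by (subst lin_move) auto
  moreover have "mass n (\<xi>(0 := \<xi> 0 + 1)) \<le> mass n \<xi> + 1"
    by (subst lin_upd) auto
  moreover have "mass n (\<xi>(rightmost n \<xi> := \<xi> (rightmost n \<xi>) - 1)) \<le> mass n \<xi> + 1" if "y \<le> n" "0 < \<xi> y" for y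
  proof -
    have "\<exists>y\<le>n. 0 < \<xi> y" using that by blast
    from rightmost_props(1,2)[OF this] show ?thesis by (subst lin_upd) (auto simp: of_nat_diff)
  qed
  ultimately show ?thesis using assms unfolding succs_def by blast
qed

lemma succs_supp:
  assumes "\<zeta> \<in> succs n \<xi>" and "\<forall>y>n. \<xi> y = 0"
  shows "\<forall>y>n. \<zeta> y = 0"
proof (intro allI impI)
  fix z assume z: "n < z"
  have 0: "\<xi> z = 0" using assms(2) z by simp
  show "\<zeta> z = 0"
    using assms(1) z 0 unfolding succs_def move_def
    by (elim UnE CollectE exE conjE insertE emptyE) auto
qed

text \<open>Each particle jumps at rate at most 1, half to either side. Unlike
  \<open>rate_bound\<close>, this bound does not depend on the box.\<close>

lemma gain_one_le_mass:
  assumes j: "0 \<le> j" and n: "1 \<le> n"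
  shows "gain n j (\<lambda>_. 1) \<xi> \<le> mass n \<xi> + 2 * j"
proof -
  have "(\<Sum>x<n. real (\<xi> x)) \<le> mass n \<xi>"
    unfolding lin_def by (simp add: lessThan_Suc_atMost[symmetric])
  moreover have "(\<Sum>x<n. real (\<xi> (x+1))) \<le> mass n \<xi>"
  proof -
    have "mass n \<xi> = (\<Sum>x<Suc n. real (\<xi> x))" unfolding lin_def by (simp add: lessThan_Suc_atMost)
    also have "\<dots> = real (\<xi> 0) + (\<Sum>x<n. real (\<xi> (Suc x)))" by (rule sum.lessThan_Suc_shift)
    finally show ?thesis by simp
  qed
  ultimately have "(\<Sum>x<n. real (\<xi> x) * 1 + real (\<xi> (x+1)) * 1) \<le> 2 * mass n \<xi>"
    by (simp only: sum.distrib mult_1_right)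
  moreover have "j * (1 / real n) \<le> j"
    using j n by (simp add: field_simps mult_le_cancel_left1)
  moreover have X: "S \<le> 2 * m \<Longrightarrow> a \<le> j \<Longrightarrow> (1/2) * S + a * 1 + (if b then a * 1 else 0) \<le> m + 2 * j"
    for S a m :: real and b
    using j by (cases b) simp_all
  ultimately show ?thesis
    unfolding gain_def by (intro X)
qed

text \<open>A configuration outside the box has mass at least N, so the boundary loss is paid for by a third moment.\<close>

lemma killgen_loss:
  assumes j: "0 \<le> j" and n: "1 \<le> n" and N: "1 \<le> N" and K: "0 \<le> K"
    and f: "\<And>\<zeta>. \<bar>f \<zeta>\<bar> \<le> K * mass n \<zeta>" and \<xi>: "\<xi> \<in> box n N"
  shows "\<bar>killgen n j N f \<xi> - gen n j f \<xi>\<bar> \<le> K * (1 + 2 * j) / real N * (mass n \<xi> + 1) ^ 3"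
proof -
  let ?m = "mass n \<xi>"
  let ?c = "K * (?m + 1)\<^sup>2 / real N"
  let ?g = "\<lambda>\<zeta>. if \<zeta> \<in> box n N then 0 else - f \<zeta>"
  have c0: "0 \<le> ?c" using K by simp
  have gb: "\<bar>?g \<zeta>\<bar> \<le> ?c" if \<zeta>: "\<zeta> \<in> succs n \<xi>" for \<zeta>
  proof (cases "\<zeta> \<in> box n N")
    case True
    then show ?thesis using c0 by simp
  next
    case False
    have "\<forall>y>n. \<zeta> y = 0" using succs_supp[OF \<zeta>] \<xi> by (auto simp: box_def)
    then obtain y where y: "y \<le> n" "N < \<zeta> y" using False by (auto simp: box_def not_le)
    have "real (\<zeta> y) \<le> mass n \<zeta>"
      unfolding lin_def mult_1 by (rule member_le_sum) (use y in auto)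
    then have big: "real N \<le> mass n \<zeta>" using y by linarith
    have "\<bar>?g \<zeta>\<bar> \<le> K * mass n \<zeta>" using f False by simp
    also have "\<dots> \<le> K * (?m + 1)\<^sup>2 / real N"
    proof -
      have "mass n \<zeta> * real N \<le> mass n \<zeta> * mass n \<zeta>"
        using big mass_nonneg by (intro mult_left_mono) auto
      also have "\<dots> \<le> (?m + 1) * (?m + 1)"
        using succs_mass_le[OF \<zeta>] mass_nonneg by (intro mult_mono) auto
      finally have "mass n \<zeta> \<le> (?m + 1)\<^sup>2 / real N"
        using N by (simp add: power2_eq_square pos_le_divide_eq)
      then have "K * mass n \<zeta> \<le> K * ((?m + 1)\<^sup>2 / real N)" using K by (rule mult_left_mono)
      then show ?thesis by simp
    qed
    finally show ?thesis .
  qed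
  have "(\<lambda>\<zeta>. if \<zeta> \<in> box n N then f \<zeta> else 0) = (\<lambda>\<zeta>. f \<zeta> + ?g \<zeta>)" by auto
  then have "killgen n j N f \<xi> - gen n j f \<xi> = gain n j ?g \<xi>"
    unfolding killgen_eq gen_eq_gain using \<xi> by (simp add: gain_add)
  moreover have "gain n j ?g \<xi> \<le> gain n j (\<lambda>_. ?c * 1) \<xi>"
    by (rule gain_mono[OF j]) (use gb in fastforce)
  moreover have "gain n j (\<lambda>_. (- ?c) * 1) \<xi> \<le> gain n j ?g \<xi>"
    by (rule gain_mono[OF j]) (use gb in fastforce)
  ultimately have "\<bar>killgen n j N f \<xi> - gen n j f \<xi>\<bar> \<le> ?c * gain n j (\<lambda>_. 1) \<xi>"
    unfolding gain_cmult by linarith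
  also have "\<dots> \<le> ?c * ((1 + 2 * j) * (?m + 1))"
  proof (rule mult_left_mono[OF _ c0])
    have "?m + 2 * j \<le> (1 + 2 * j) * (?m + 1)"
      using j mass_nonneg[of n \<xi>] by (simp add: algebra_simps)
    then show "gain n j (\<lambda>_. 1) \<xi> \<le> (1 + 2 * j) * (?m + 1)"
      using gain_one_le_mass[OF j n, of \<xi>] by linarith
  qed
  also have "\<dots> = K * (1 + 2 * j) / real N * (?m + 1) ^ 3"
    by (simp add: power2_eq_square power3_eq_cube)
  finally show ?thesis .
qed

text \<open>Hopping conserves the mass and removal can only lower \<open>v\<close>, so creation at
  0, of rate j / n, is the only positive contribution.\<close>

lemma gen_mass_le:
  assumes j: "0 \<le> j" and v: "\<And>a. 0 \<le> a \<Longrightarrow> v a \<le> v (a + 1)"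
  shows "gen n j (\<lambda>\<zeta>. v (mass n \<zeta>)) \<xi> \<le> j / real n * (v (mass n \<xi> + 1) - v (mass n \<xi>))"
proof -
  have "(\<Sum>x<n. real (\<xi> x) * (v (mass n (move \<xi> x (x+1))) - v (mass n \<xi>))
        + real (\<xi> (x+1)) * (v (mass n (move \<xi> (x+1) x)) - v (mass n \<xi>))) = (\<Sum>x<n. 0)"
  proof (rule sum.cong[OF refl])
    fix x assume "x \<in> {..<n}"
    then have x: "x \<le> n" "x + 1 \<le> n" by auto
    have "real (\<xi> x) * (v (mass n (move \<xi> x (x+1))) - v (mass n \<xi>)) = 0"
      by (cases "\<xi> x = 0") (use lin_move[of x n "x+1" \<xi> "\<lambda>_. 1"] x in simp_all)
    moreover have "real (\<xi> (x+1)) * (v (mass n (move \<xi> (x+1) x)) - v (mass n \<xi>)) = 0"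
      by (cases "\<xi> (x+1) = 0") (use lin_move[of "x+1" n x \<xi> "\<lambda>_. 1"] x in simp_all)
    ultimately show "real (\<xi> x) * (v (mass n (move \<xi> x (x+1))) - v (mass n \<xi>))
        + real (\<xi> (x+1)) * (v (mass n (move \<xi> (x+1) x)) - v (mass n \<xi>)) = 0" by (simp only: add_0_left)
  qed
  moreover have "mass n (\<xi>(0 := \<xi> 0 + 1)) = mass n \<xi> + 1"
    by (simp add: lin_upd)
  moreover have "v (mass n (\<xi>(rightmost n \<xi> := \<xi> (rightmost n \<xi>) - 1))) - v (mass n \<xi>) \<le> 0"
    if "\<exists>y\<le>n. 0 < \<xi> y"
  proof -
    let ?\<zeta> = "\<xi>(rightmost n \<xi> := \<xi> (rightmost n \<xi>) - 1)"
    have "mass n ?\<zeta> + 1 = mass n \<xi>"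
      using rightmost_props(1,2)[OF that] by (simp add: lin_upd of_nat_diff)
    then show ?thesis using v[OF mass_nonneg[of n ?\<zeta>]] by simp
  qed
  moreover have X: "S = (\<Sum>x<n. 0) \<Longrightarrow> m' = m + 1 \<Longrightarrow> (b \<Longrightarrow> q \<le> 0) \<Longrightarrow>
     (1/2) * S + j * (1 / real n) * (v m' - v m) + (if b then j * (1 / real n) * q else 0) \<le> j / real n * (v (m + 1) - v m)"
    for S m m' q :: real and b
    using j by (cases b) (simp_all add: mult_nonneg_nonpos divide_nonpos_nonneg)
  ultimately show ?thesis
    unfolding gen_def by (intro X)
qed

text \<open>The constant 7 = 8 - 1 comes from (m + 2)^3 \<le> 8 (m + 1)^3. Over a diffusive time the
  bound is as large as exp (7 j n^2 t), which is harmless: it gets divided by N, and N tends to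
  infinity first.\<close>

lemma kexp_third_moment:
  assumes j: "0 < j" and n: "1 \<le> n" and t: "0 \<le> t" and \<xi>: "\<xi> \<in> box n N"
  shows "kexp n j N t (\<lambda>\<zeta>. (mass n \<zeta> + 1) ^ 3) \<xi> \<le> (mass n \<xi> + 1) ^ 3 * exp (7 * j * t)"
proof -
  have "kexp n j N t (\<lambda>\<zeta>. (mass n \<zeta> + 1) ^ 3) \<xi> \<le> ((mass n \<xi> + 1) ^ 3 + 0 / (7 * j)) * exp (7 * j * t)"
  proof (rule kexp_moment_bound[OF _ t \<xi>])
    show "0 \<le> (mass n \<zeta> + 1) ^ 3" for \<zeta> using mass_nonneg[of n \<zeta>] by simp
    fix \<zeta>
    let ?m = "mass n \<zeta>"
    have m: "0 \<le> ?m" by (rule mass_nonneg)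
    have "gen n j (\<lambda>\<zeta>. (mass n \<zeta> + 1) ^ 3) \<zeta> \<le> j / real n * ((?m + 1 + 1) ^ 3 - (?m + 1) ^ 3)"
      by (rule gen_mass_le[where v = "\<lambda>a. (a + 1) ^ 3"]) (use j in \<open>auto intro!: power_mono\<close>)
    also have "\<dots> \<le> j * (7 * (?m + 1) ^ 3)"
    proof (rule mult_mono)
      show "j / real n \<le> j" using j n by (simp add: field_simps)
      have "(?m + 1 + 1) ^ 3 \<le> (2 * (?m + 1)) ^ 3" using m by (intro power_mono) auto
      moreover have "(2 * (?m + 1)) ^ 3 = 8 * (?m + 1) ^ 3" by (simp only: power_mult_distrib) simp
      ultimately show "(?m + 1 + 1) ^ 3 - (?m + 1) ^ 3 \<le> 7 * (?m + 1) ^ 3" by linarith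
      show "0 \<le> (?m + 1 + 1) ^ 3 - (?m + 1) ^ 3" using m by (simp add: power_mono)
    qed (use j in auto)
    finally show "gen n j (\<lambda>\<zeta>. (mass n \<zeta> + 1) ^ 3) \<zeta> \<le> 7 * j * (mass n \<zeta> + 1) ^ 3 + 0" by simp
  qed (use j in auto)
  then show ?thesis by simp
qed

text \<open>In diffusive time particles enter at rate j n, and each changes (mass / n)^2 by (2 mass
  / n + 1 / n) / n, so the growth rate is free of n. This uniformity is what survives the limit in
  n.\<close>

lemma kexp_second_moment:
  assumes j: "0 < j" and n: "1 \<le> n" and t: "0 \<le> t" and \<xi>: "\<xi> \<in> box n N"
  shows "kexp n j N ((real n)\<^sup>2 * t) (\<lambda>\<zeta>. (mass n \<zeta> / real n)\<^sup>2) \<xi> \<le> ((mass n \<xi> / real n)\<^sup>2 + 2) * exp (j * t)"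
proof -
  let ?a = "j / (real n)\<^sup>2"
  have n0: "0 < real n" using n by simp
  have a: "0 < ?a" using j n0 by simp
  have "kexp n j N ((real n)\<^sup>2 * t) (\<lambda>\<zeta>. (mass n \<zeta> / real n)\<^sup>2) \<xi>
     \<le> ((mass n \<xi> / real n)\<^sup>2 + (2 * ?a) / ?a) * exp (?a * ((real n)\<^sup>2 * t))"
  proof (rule kexp_moment_bound[OF _ _ \<xi> a])
    fix \<zeta>
    let ?m = "mass n \<zeta>"
    have m: "0 \<le> ?m" by (rule mass_nonneg)
    have "gen n j (\<lambda>\<zeta>. (mass n \<zeta> / real n)\<^sup>2) \<zeta> \<le> j / real n * (((?m + 1) / real n)\<^sup>2 - (?m / real n)\<^sup>2)"
      by (rule gen_mass_le[where v = "\<lambda>a. (a / real n)\<^sup>2"]) (use j n0 in \<open>auto intro!: power_mono divide_right_mono\<close>)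
    also have "((?m + 1) / real n)\<^sup>2 - (?m / real n)\<^sup>2 = (2 * (?m / real n) + 1 / real n) / real n"
      using n0 by (simp add: field_simps power2_eq_square)
    also have "j / real n * ((2 * (?m / real n) + 1 / real n) / real n) = ?a * (2 * (?m / real n) + 1 / real n)"
      by (simp add: power2_eq_square)
    also have "\<dots> \<le> ?a * ((?m / real n)\<^sup>2 + 2)"
    proof (rule mult_left_mono)
      have "1 / real n \<le> 1" using n by simp
      moreover have "0 \<le> (?m / real n - 1)\<^sup>2" by simp
      then have "2 * (?m / real n) \<le> (?m / real n)\<^sup>2 + 1" by (simp add: power2_diff)
      ultimately show "2 * (?m / real n) + 1 / real n \<le> (?m / real n)\<^sup>2 + 2" by linarith
    qed (use a in auto)
    finally show "gen n j (\<lambda>\<zeta>. (mass n \<zeta> / real n)\<^sup>2) \<zeta> \<le> ?a * (mass n \<zeta> / real n)\<^sup>2 + 2 * ?a"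
      by (simp only: distrib_left mult.commute)
  qed (use j a t in auto)
  moreover have "(2 * ?a) / ?a = 2"
    by (rule nonzero_mult_div_cancel_right[OF less_imp_neq[OF a, symmetric]])
  moreover have "?a * ((real n)\<^sup>2 * t) = j * t" using n0 by simp
  ultimately show ?thesis by (simp only:)
qed

section \<open>Equations for the expected cosine modes in diffusive time\<close>

definition Uk :: "nat \<Rightarrow> real \<Rightarrow> nat \<Rightarrow> config \<Rightarrow> nat \<Rightarrow> real \<Rightarrow> real" where
  "Uk n j N \<xi> k s = kexp n j N ((real n)\<^sup>2 * s) (lin n (cosg n k)) \<xi> / real n"

definition Bk :: "nat \<Rightarrow> real \<Rightarrow> nat \<Rightarrow> config \<Rightarrow> nat \<Rightarrow> real \<Rightarrow> real" where
  "Bk n j N \<xi> k s = kexp n j N ((real n)\<^sup>2 * s) (bdry n (cosg n k)) \<xi>"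

text \<open>Effect of the killing on the k-th mode. The prefactor n is n^2 from the time scale
  divided by n from the normalisation.\<close>

definition Ek :: "nat \<Rightarrow> real \<Rightarrow> nat \<Rightarrow> config \<Rightarrow> nat \<Rightarrow> real \<Rightarrow> real" where
  "Ek n j N \<xi> k s = real n * kexp n j N ((real n)\<^sup>2 * s)
     (\<lambda>\<zeta>. killgen n j N (lin n (cosg n k)) \<zeta> - gen n j (lin n (cosg n k)) \<zeta>) \<xi>"

lemma Uk_has_derivative:
  assumes j: "0 \<le> j" and n: "1 \<le> n" and \<xi>: "\<xi> \<in> box n N"
  shows "(Uk n j N \<xi> k has_real_derivative - lam n k * Uk n j N \<xi> k s + j * Bk n j N \<xi> k s + Ek n j N \<xi> k s) (at s)"
proof -
  let ?f = "lin n (cosg n k)"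
  let ?\<tau> = "(real n)\<^sup>2 * s"
  have n0: "0 < real n" using n by simp
  have "((\<lambda>s. kexp n j N ((real n)\<^sup>2 * s) ?f \<xi>) has_real_derivative kexp n j N ?\<tau> (killgen n j N ?f) \<xi> * (real n)\<^sup>2) (at s)"
    by (rule DERIV_chain'[where f = "\<lambda>s. (real n)\<^sup>2 * s", OF _ kexp_has_derivative[OF j \<xi>]])
       (auto intro!: derivative_eq_intros)
  then have D: "(Uk n j N \<xi> k has_real_derivative kexp n j N ?\<tau> (killgen n j N ?f) \<xi> * (real n)\<^sup>2 / real n) (at s)"
    unfolding Uk_def by (rule DERIV_cdivide)
  have "kexp n j N ?\<tau> (killgen n j N ?f) \<xi>
     = kexp n j N ?\<tau> (\<lambda>\<zeta>. (- (lam n k / (real n)\<^sup>2) * ?f \<zeta> + j / real n * bdry n (cosg n k) \<zeta>)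
          + (killgen n j N ?f \<zeta> - gen n j ?f \<zeta>)) \<xi>"
    by (simp only: gen_cosg[OF n] add_diff_cancel_left' diff_add_cancel add_diff_eq add.commute)
       (simp add: algebra_simps)
  also have "\<dots> = - (lam n k / (real n)\<^sup>2) * kexp n j N ?\<tau> ?f \<xi> + j / real n * kexp n j N ?\<tau> (bdry n (cosg n k)) \<xi>
      + kexp n j N ?\<tau> (\<lambda>\<zeta>. killgen n j N ?f \<zeta> - gen n j ?f \<zeta>) \<xi>"
    by (simp only: kexp_add[OF j \<xi>] kexp_cmult[OF j \<xi>])
  finally have E: "kexp n j N ?\<tau> (killgen n j N ?f) \<xi> = \<dots>" .
  have "kexp n j N ?\<tau> (killgen n j N ?f) \<xi> * (real n)\<^sup>2 / real n
     = - lam n k * Uk n j N \<xi> k s + j * Bk n j N \<xi> k s + Ek n j N \<xi> k s"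
  proof -
    have X: "(- (l / m\<^sup>2) * a + j / m * b + c) * m\<^sup>2 / m = - l * (a / m) + j * b + m * c" if "0 < m" for l m a b c :: real
      using that by (simp add: field_simps power2_eq_square)
    show ?thesis unfolding E Uk_def Bk_def Ek_def by (rule X[OF n0])
  qed
  with D show ?thesis by simp
qed

lemma abs_cosg_le: "\<bar>cosg n k x\<bar> \<le> 1"
  unfolding cosg_def by simp

text \<open>The loss across the box boundary is a third moment over N. For fixed n the error thus
  vanishes as N grows, uniformly in s \<le> t and in k.\<close>

lemma Ek_bound:
  assumes j: "0 < j" and n: "1 \<le> n" and N: "1 \<le> N" and \<xi>: "\<xi> \<in> box n N" and s: "0 \<le> s" "s \<le> t"
  shows "\<bar>Ek n j N \<xi> k s\<bar> \<le> real n * (1 + 2 * j) * (mass n \<xi> + 1) ^ 3 * exp (7 * j * ((real n)\<^sup>2 * t)) / real N"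
proof -
  let ?f = "lin n (cosg n k)"
  let ?\<tau> = "(real n)\<^sup>2 * s"
  have \<tau>: "0 \<le> ?\<tau>" using s by simp
  have j0: "0 \<le> j" using j by simp
  let ?C = "(1 + 2 * j) / real N"
  have C0: "0 \<le> ?C" using j by simp
  have "\<bar>kexp n j N ?\<tau> (\<lambda>\<zeta>. killgen n j N ?f \<zeta> - gen n j ?f \<zeta>) \<xi>\<bar> \<le> kexp n j N ?\<tau> (\<lambda>\<zeta>. ?C * (mass n \<zeta> + 1) ^ 3) \<xi>"
  proof (rule kexp_abs_le[OF j0 \<tau> \<xi>])
    fix \<zeta> assume \<zeta>: "\<zeta> \<in> box n N"
    have "\<bar>killgen n j N ?f \<zeta> - gen n j ?f \<zeta>\<bar> \<le> 1 * (1 + 2 * j) / real N * (mass n \<zeta> + 1) ^ 3"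
      by (rule killgen_loss[OF j0 n N _ abs_lin_le \<zeta>]) (auto intro!: abs_cosg_le)
    then show "\<bar>killgen n j N ?f \<zeta> - gen n j ?f \<zeta>\<bar> \<le> ?C * (mass n \<zeta> + 1) ^ 3" by simp
  qed
  also have "\<dots> \<le> ?C * ((mass n \<xi> + 1) ^ 3 * exp (7 * j * ?\<tau>))"
    unfolding kexp_cmult[OF j0 \<xi>] by (intro mult_left_mono kexp_third_moment j n \<tau> \<xi> C0)
  also have "\<dots> \<le> ?C * ((mass n \<xi> + 1) ^ 3 * exp (7 * j * ((real n)\<^sup>2 * t)))"
    using s j mass_nonneg[of n \<xi>] by (intro mult_left_mono C0) (auto intro!: mult_left_mono)
  finally have "real n * \<bar>kexp n j N ?\<tau> (\<lambda>\<zeta>. killgen n j N ?f \<zeta> - gen n j ?f \<zeta>) \<xi>\<bar>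
     \<le> real n * (?C * ((mass n \<xi> + 1) ^ 3 * exp (7 * j * ((real n)\<^sup>2 * t))))"
    by (rule mult_left_mono) simp
  then show ?thesis unfolding Ek_def abs_mult by simp
qed

section \<open>Cosine polynomials\<close>

definition cospoly :: "nat \<Rightarrow> (real \<Rightarrow> real) \<Rightarrow> bool" where
  "cospoly m f \<longleftrightarrow> (\<exists>a. \<forall>r. f r = (\<Sum>k\<le>m. a k * cos (real k * pi * r)))"

lemma cospoly_cos: "k \<le> m \<Longrightarrow> cospoly m (\<lambda>r. cos (real k * pi * r))"
  unfolding cospoly_def
  by (rule exI[of _ "\<lambda>i. if i = k then 1 else 0"]) (simp add: if_distrib[of "\<lambda>x. x * _"] cong: if_cong)

lemma cospoly_add: "cospoly m f \<Longrightarrow> cospoly m g \<Longrightarrow> cospoly m (\<lambda>r. f r + g r)"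
  unfolding cospoly_def
proof (elim exE)
  fix a b
  assume "\<forall>r. f r = (\<Sum>k\<le>m. a k * cos (real k * pi * r))" "\<forall>r. g r = (\<Sum>k\<le>m. b k * cos (real k * pi * r))"
  then show "\<exists>a. \<forall>r. f r + g r = (\<Sum>k\<le>m. a k * cos (real k * pi * r))"
    by (intro exI[of _ "\<lambda>k. a k + b k"]) (simp add: distrib_right sum.distrib)
qed

lemma cospoly_cmult: "cospoly m f \<Longrightarrow> cospoly m (\<lambda>r. c * f r)"
  unfolding cospoly_def
proof (elim exE)
  fix a
  assume "\<forall>r. f r = (\<Sum>k\<le>m. a k * cos (real k * pi * r))"
  then show "\<exists>a. \<forall>r. c * f r = (\<Sum>k\<le>m. a k * cos (real k * pi * r))"
    by (intro exI[of _ "\<lambda>k. c * a k"]) (simp add: sum_distrib_left mult.assoc)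
qed

lemma cospoly_const: "cospoly m (\<lambda>r. c)"
  using cospoly_cmult[OF cospoly_cos[of 0 m], of c] by simp

lemma cospoly_sum: "finite I \<Longrightarrow> (\<And>i. i \<in> I \<Longrightarrow> cospoly m (f i)) \<Longrightarrow> cospoly m (\<lambda>r. \<Sum>i\<in>I. f i r)"
  by (induction I rule: finite_induct) (auto intro: cospoly_add cospoly_const)

text \<open>Product-to-sum formula; since cos is even, the difference frequency can be kept a
  natural number by the conditional.\<close>

lemma cos_mult_cos_nat:
  "cos (real i * pi * r) * cos (real k * pi * r)
    = 1/2 * cos (real (i + k) * pi * r) + 1/2 * cos (real (if i \<le> k then k - i else i - k) * pi * r)"
proof -
  have "cos (real (if i \<le> k then k - i else i - k) * pi * r) = cos (real i * pi * r - real k * pi * r)"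
  proof (cases "i \<le> k")
    case True
    then have "real (k - i) * pi * r = - (real i * pi * r - real k * pi * r)"
      by (simp add: of_nat_diff algebra_simps)
    then show ?thesis using True by (simp only: if_True cos_minus)
  next
    case False
    then have "real (i - k) * pi * r = real i * pi * r - real k * pi * r"
      by (simp add: of_nat_diff algebra_simps)
    then show ?thesis using False by (simp only: if_False)
  qed
  moreover have "real (i + k) * pi * r = real i * pi * r + real k * pi * r" by (simp add: algebra_simps)
  ultimately show ?thesis by (simp only: cos_add cos_diff) (simp add: field_simps)
qed

lemma cospoly_mult:
  assumes "cospoly m f" "cospoly l g"
  shows "cospoly (m + l) (\<lambda>r. f r * g r)"
proof -
  obtain a b where a: "\<And>r. f r = (\<Sum>k\<le>m. a k * cos (real k * pi * r))"
    and b: "\<And>r. g r = (\<Sum>k\<le>l. b k * cos (real k * pi * r))"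
    using assms unfolding cospoly_def by blast
  have "f r * g r = (\<Sum>i\<le>m. \<Sum>k\<le>l. (a i * b k) * (1/2 * cos (real (i + k) * pi * r)
     + 1/2 * cos (real (if i \<le> k then k - i else i - k) * pi * r)))" for r
    unfolding a b sum_product cos_mult_cos_nat[symmetric]
    by (intro sum.cong refl) (simp only: mult_ac)
  moreover have "cospoly (m + l) (\<lambda>r. \<Sum>i\<le>m. \<Sum>k\<le>l. (a i * b k) * (1/2 * cos (real (i + k) * pi * r)
     + 1/2 * cos (real (if i \<le> k then k - i else i - k) * pi * r)))"
    by (intro cospoly_sum cospoly_cmult cospoly_add cospoly_cos finite_atMost) auto
  ultimately show ?thesis by presburger
qed

section \<open>The increasing test functions \<open>q m\<close>\<close>

fun bq :: "nat \<Rightarrow> real" where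
  "bq 0 = 1"
| "bq (Suc m) = bq m * (2 * (real m + 1) / (2 * real m + 1))"

text \<open>This is sin^2 (pi r / 2). By Wallis the integral of its m-th power over [0,1] is (2m
  choose m) / 4^m, whose reciprocal is \<open>bq m\<close>.\<close>

definition wq :: "real \<Rightarrow> real" where
  "wq r = (1 - cos (pi * r)) / 2"

definition q :: "nat \<Rightarrow> real \<Rightarrow> real" where
  "q m r = bq m * wq r ^ m"

text \<open>The eigenvalue of minus one half of the second derivative on cos (k pi r).\<close>

definition mu :: "nat \<Rightarrow> real" where
  "mu k = (real k * pi)\<^sup>2 / 2"

lemma bq_pos: "0 < bq m"
  by (induction m) auto

lemma wq_bounds: "0 \<le> wq r" "wq r \<le> 1"
proof -
  have "-1 \<le> cos (pi * r)" "cos (pi * r) \<le> 1" by auto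
  then show "0 \<le> wq r" "wq r \<le> 1" unfolding wq_def by auto
qed

lemma q_nonneg: "0 \<le> q m r"
  unfolding q_def using bq_pos[of m] wq_bounds[of r] by simp

lemma q_le: "q m r \<le> bq m"
proof -
  have "wq r ^ m \<le> 1" by (rule power_le_one) (use wq_bounds[of r] in auto)
  then show ?thesis unfolding q_def using bq_pos[of m] by (simp add: mult_le_cancel_left1)
qed

lemma q_mono:
  assumes "0 \<le> x" "x \<le> y" "y \<le> 1"
  shows "q m x \<le> q m y"
proof -
  have "cos (pi * y) \<le> cos (pi * x)"
    by (rule cos_monotone_0_pi_le) (use assms in \<open>auto intro: mult_left_mono simp: mult_le_cancel_left1\<close>)
  then have "wq x \<le> wq y" unfolding wq_def by simp
  then show ?thesis unfolding q_def using bq_pos[of m] wq_bounds(1)[of x]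
    by (intro mult_left_mono power_mono) auto
qed

lemma cospoly_q: "cospoly m (q m)"
proof -
  have w: "cospoly 1 wq"
  proof -
    have "cospoly 1 (\<lambda>r. 1/2 + (-1/2) * cos (real 1 * pi * r))"
      by (intro cospoly_add cospoly_const cospoly_cmult cospoly_cos) simp
    moreover have "(\<lambda>r. 1/2 + (-1/2) * cos (real 1 * pi * r)) = wq"
      unfolding wq_def by (auto simp: fun_eq_iff)
    ultimately show ?thesis by simp
  qed
  have "cospoly m (\<lambda>r. wq r ^ m)"
  proof (induction m)
    case 0
    then show ?case using cospoly_const[of 0 1] by simp
  next
    case (Suc m)
    from cospoly_mult[OF w Suc] show ?case by simp
  qed
  then show ?thesis unfolding q_def by (rule cospoly_cmult)
qed

definition dq :: "nat \<Rightarrow> real \<Rightarrow> real" where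
  "dq m r = bq m * (real m * wq r ^ (m - 1) * (pi / 2 * sin (pi * r)))"

lemma wq_deriv: "(wq has_real_derivative pi / 2 * sin (pi * r)) (at r)"
  unfolding wq_def by (auto intro!: derivative_eq_intros)

lemma q_deriv: "(q m has_real_derivative dq m r) (at r)"
  unfolding q_def dq_def
  by (rule DERIV_cmult) (use DERIV_power[OF wq_deriv[of r], of m] in \<open>simp add: mult_ac\<close>)

text \<open>With w = \<open>wq\<close> one has w'^2 = pi^2 w (1 - w) and w'' = (pi^2 / 2) (1 - 2 w),
  so (w^m)'' = pi^2 m ((m - 1/2) w^(m-1) - m w^m). The recursion b_m (m - 1/2) = m b_(m-1) turns
  this into (m pi)^2 (q_(m-1) - q_m).\<close>

lemma dq_deriv:
  "(dq (Suc l) has_real_derivative 2 * (mu (Suc l) * (q l r - q (Suc l) r))) (at r)"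
proof -
  have sin2: "(sin (pi * r))\<^sup>2 = 4 * wq r * (1 - wq r)"
    unfolding wq_def sin_squared_eq by (simp add: power2_eq_square field_simps)
  have cosw: "cos (pi * r) = 1 - 2 * wq r" unfolding wq_def by (simp add: field_simps)
  have P: "((\<lambda>r. wq r ^ l) has_real_derivative real l * wq r ^ (l - 1) * (pi / 2 * sin (pi * r))) (at r)"
    using DERIV_power[OF wq_deriv[of r], of l] by (simp add: mult_ac)
  have S: "((\<lambda>r. pi / 2 * sin (pi * r)) has_real_derivative (pi\<^sup>2 / 2 * cos (pi * r))) (at r)"
    by (auto intro!: derivative_eq_intros simp: power2_eq_square)
  have D: "((\<lambda>r. bq (Suc l) * real (Suc l) * (wq r ^ l * (pi / 2 * sin (pi * r)))) has_real_derivative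
      bq (Suc l) * real (Suc l) * ((real l * wq r ^ (l - 1) * (pi / 2 * sin (pi * r))) * (pi / 2 * sin (pi * r))
        + (pi\<^sup>2 / 2 * cos (pi * r)) * wq r ^ l)) (at r)"
    by (rule DERIV_cmult[OF DERIV_mult'[OF P S, THEN DERIV_cong]]) simp
  have fe: "dq (Suc l) = (\<lambda>r. bq (Suc l) * real (Suc l) * (wq r ^ l * (pi / 2 * sin (pi * r))))"
    unfolding dq_def by (auto simp: fun_eq_iff simp del: bq.simps of_nat_Suc)
  have 1: "(real l * wq r ^ (l - 1) * (pi / 2 * sin (pi * r))) * (pi / 2 * sin (pi * r)) = pi\<^sup>2 * real l * wq r ^ l * (1 - wq r)"
  proof -
    have "(real l * wq r ^ (l - 1) * (pi / 2 * sin (pi * r))) * (pi / 2 * sin (pi * r))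
      = real l * wq r ^ (l - 1) * (pi\<^sup>2 / 4) * (sin (pi * r))\<^sup>2" by (simp add: power2_eq_square)
    also have "\<dots> = pi\<^sup>2 * (real l * (wq r ^ (l - 1) * wq r)) * (1 - wq r)" unfolding sin2 by simp
    also have "real l * (wq r ^ (l - 1) * wq r) = real l * wq r ^ l" by (cases l) auto
    finally show ?thesis by simp
  qed
  have b: "bq (Suc l) * (real l + 1/2) = bq l * (real l + 1)"
    by (simp add: field_simps)
  have "bq (Suc l) * real (Suc l) * ((real l * wq r ^ (l - 1) * (pi / 2 * sin (pi * r))) * (pi / 2 * sin (pi * r))
        + (pi\<^sup>2 / 2 * cos (pi * r)) * wq r ^ l)
      = bq (Suc l) * real (Suc l) * pi\<^sup>2 * wq r ^ l * ((real l + 1/2) - (real l + 1) * wq r)"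
    unfolding 1 cosw by (simp add: algebra_simps add_divide_distrib diff_divide_distrib del: bq.simps)
  also have "\<dots> = real (Suc l) * pi\<^sup>2 * wq r ^ l * (bq (Suc l) * (real l + 1/2) - (real l + 1) * bq (Suc l) * wq r)"
    by (simp add: algebra_simps del: bq.simps)
  also have "\<dots> = real (Suc l) * pi\<^sup>2 * wq r ^ l * (real (Suc l) * (bq l - bq (Suc l) * wq r))"
    unfolding b by (simp add: algebra_simps del: bq.simps)
  also have "\<dots> = 2 * (mu (Suc l) * (q l r - q (Suc l) r))"
    unfolding mu_def q_def by (simp add: power2_eq_square algebra_simps del: bq.simps of_nat_Suc)
  finally show ?thesis using D unfolding fe by simp
qed

text \<open>Differentiating the cosine expansion twice multiplies the k-th coefficient by -2
  \<open>mu k\<close>. This carries the differential identity for \<open>q m\<close> over to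
  coefficients, the form in which it applies to the modes of the particle system.\<close>

lemma q_coeffs:
  obtains a where "\<And>r. q (Suc l) r = (\<Sum>k\<le>Suc l. a k * cos (real k * pi * r))"
    and "\<And>r. (\<Sum>k\<le>Suc l. a k * (mu k * cos (real k * pi * r))) = mu (Suc l) * (q (Suc l) r - q l r)"
proof -
  obtain a where a: "\<And>r. q (Suc l) r = (\<Sum>k\<le>Suc l. a k * cos (real k * pi * r))"
    using cospoly_q[of "Suc l"] unfolding cospoly_def by blast
  have "(q (Suc l) has_real_derivative (\<Sum>k\<le>Suc l. a k * (- sin (real k * pi * r) * (real k * pi)))) (at r)" for r
  proof -
    have "q (Suc l) = (\<lambda>r. \<Sum>k\<le>Suc l. a k * cos (real k * pi * r))" using a by auto
    then show ?thesis
      by (simp only:) (rule DERIV_sum, auto intro!: derivative_eq_intros)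
  qed
  then have 1: "dq (Suc l) = (\<lambda>r. \<Sum>k\<le>Suc l. a k * (- sin (real k * pi * r) * (real k * pi)))"
    using DERIV_unique[OF q_deriv] by blast
  have "(dq (Suc l) has_real_derivative (\<Sum>k\<le>Suc l. a k * (- cos (real k * pi * r) * (real k * pi) * (real k * pi)))) (at r)" for r
    unfolding 1 by (rule DERIV_sum) (auto intro!: derivative_eq_intros)
  then have "2 * (mu (Suc l) * (q l r - q (Suc l) r)) = (\<Sum>k\<le>Suc l. a k * (- cos (real k * pi * r) * (real k * pi) * (real k * pi)))" for r
    using DERIV_unique[OF dq_deriv] by blast
  also have "(\<Sum>k\<le>Suc l. a k * (- cos (real k * pi * r) * (real k * pi) * (real k * pi)))
     = (\<Sum>k\<le>Suc l. (-2) * (a k * (mu k * cos (real k * pi * r))))" for r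
    by (rule sum.cong) (simp_all add: mu_def power2_eq_square)
  finally have "2 * (mu (Suc l) * (q l r - q (Suc l) r)) = -2 * (\<Sum>k\<le>Suc l. a k * (mu k * cos (real k * pi * r)))" for r
    unfolding sum_distrib_left .
  note eq2 = this
  have "(\<Sum>k\<le>Suc l. a k * (mu k * cos (real k * pi * r))) = mu (Suc l) * (q (Suc l) r - q l r)" for r
  proof -
    have X: "2 * (M * (x - y)) = - 2 * S \<Longrightarrow> S = M * (y - x)" for M x y S :: real
      by (simp add: right_diff_distrib)
    show ?thesis by (rule X) (rule eq2)
  qed
  with a that show ?thesis by blast
qed

lemma continuous_on_q: "continuous_on S (q m)"
  by (rule continuous_at_imp_continuous_on) (use q_deriv DERIV_isCont in blast)

lemma set_integrable_q: "set_integrable lborel {0..1} (q m)"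
  by (rule borel_integrable_atLeastAtMost') (rule continuous_on_q)

text \<open>Integrating the second derivative of \<open>q (Suc m)\<close> over [0,1] gives 0,
  because \<open>dq\<close> contains the factor sin (pi r), which vanishes at both ends; hence
  consecutive integrals agree.\<close>

lemma integral_q: "(LINT r:{0..1}|lborel. q m r) = 1"
proof (induction m)
  case 0
  have "(LINT r:{0..1::real}|lborel. q 0 r) = (LINT r:{0..1::real}|lborel. (1::real))" by (simp add: q_def)
  also have "\<dots> = 1" by (simp add: set_lebesgue_integral_def)
  finally show ?case .
next
  case (Suc m)
  have "((\<lambda>r. 2 * (mu (Suc m) * (q m r - q (Suc m) r))) has_integral (dq (Suc m) 1 - dq (Suc m) 0)) {0..1}"
    by (rule fundamental_theorem_of_calculus)
       (auto intro!: DERIV_subset[OF dq_deriv] simp: has_real_derivative_iff_has_vector_derivative[symmetric]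
         simp del: of_nat_Suc)
  moreover have "dq (Suc m) 1 - dq (Suc m) 0 = 0" by (simp add: dq_def)
  ultimately have I0: "((\<lambda>r. 2 * (mu (Suc m) * (q m r - q (Suc m) r))) has_integral 0) {0..1}" by simp
  have mu0: "mu (Suc m) \<noteq> 0" by (simp add: mu_def)
  have X: "inverse (2 * mu (Suc m)) * (2 * (mu (Suc m) * x)) = x" for x
    using mu0 by simp
  have I1: "((\<lambda>r. q m r - q (Suc m) r) has_integral 0) {0..1}"
    using has_integral_mult_right[OF I0, of "inverse (2 * mu (Suc m))"] unfolding X mult_zero_right .
  have "(LINT r:{0..1}|lborel. q m r) - (LINT r:{0..1}|lborel. q (Suc m) r) = (LINT r:{0..1}|lborel. q m r - q (Suc m) r)"
    by (rule set_integral_diff(2)[symmetric]) (rule set_integrable_q)+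
  also have "\<dots> = integral {0..1} (\<lambda>r. q m r - q (Suc m) r)"
    by (rule set_borel_integral_eq_integral) (intro set_integral_diff(1) set_integrable_q)
  also have "\<dots> = 0" using I1 by (rule integral_unique)
  finally show ?case using Suc by simp
qed

text \<open>The induction step is 4 m (m + 1) \<le> (2 m + 1)^2.\<close>

lemma bq_square_le: "1 \<le> m \<Longrightarrow> (bq m)\<^sup>2 \<le> 4 * real m"
proof (induction m rule: dec_induct)
  case base
  have "bq 1 = 2" by simp
  then show ?case by simp
next
  case (step m)
  have "(bq (Suc m))\<^sup>2 = (bq m)\<^sup>2 * (2 * (real m + 1) / (2 * real m + 1))\<^sup>2"
    by (simp only: bq.simps power_mult_distrib)
  also have "\<dots> \<le> 4 * real m * (2 * (real m + 1) / (2 * real m + 1))\<^sup>2"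
    using step by (intro mult_right_mono) auto
  also have "\<dots> \<le> 4 * real (Suc m)"
  proof -
    have "4 * real m * (2 * (real m + 1))\<^sup>2 \<le> 4 * real (Suc m) * (2 * real m + 1)\<^sup>2"
      by (simp add: power2_eq_square algebra_simps)
    moreover have "0 < (2 * real m + 1)\<^sup>2" by simp
    ultimately show ?thesis unfolding power_divide by (simp only: times_divide_eq_right pos_divide_le_eq)
  qed
  finally show ?case .
qed

lemma bq_le: "1 \<le> m \<Longrightarrow> bq m \<le> 2 * sqrt (real m)"
  using real_le_rsqrt[OF bq_square_le[of m]] by (simp add: real_sqrt_mult)

lemma bq_mu_summable: "summable (\<lambda>i. bq i * (1 / mu i))"
proof (rule summable_comparison_test'[where N = 1])
  show "summable (\<lambda>i. 4 * real i powr (- 3 / 2))"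
    by (intro summable_mult) (simp add: summable_real_powr_iff)
  fix i :: nat assume i: "1 \<le> i"
  have pi2: "1 \<le> pi\<^sup>2" using pi_ge_two by (simp add: power2_eq_square mult_ge1_I)
  have m: "real i ^ 2 / 2 \<le> mu i"
    unfolding mu_def power_mult_distrib using pi2 by (simp add: mult_le_cancel_left1)
  have m0: "0 < real i ^ 2 / 2" using i by simp
  have "norm (bq i * (1 / mu i)) = bq i * (1 / mu i)"
    using bq_pos[of i] m m0 by (simp add: mu_def)
  also have "\<dots> \<le> 2 * sqrt (real i) * (1 / (real i ^ 2 / 2))"
  proof (rule mult_mono)
    show "1 / mu i \<le> 1 / (real i ^ 2 / 2)" using frac_le[of 1 1 "real i ^ 2 / 2" "mu i"] m m0 by simp
  qed (use bq_le[OF i] m m0 in \<open>simp_all add: mu_def\<close>)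
  also have "\<dots> = 4 * (real i powr (1/2) / real i powr 2)"
    using i by (simp add: powr_half_sqrt)
  also have "\<dots> = 4 * real i powr (1/2 - 2)"
    by (simp only: powr_diff)
  also have "\<dots> = 4 * real i powr (- 3 / 2)"
    by simp
  finally show "norm (bq i * (1 / mu i)) \<le> 4 * real i powr (- 3 / 2)" .
qed

text \<open>The tail beyond M is small for every T, being dominated by the convergent sum of b_i /
  mu_i; the finite head is at most T times a constant.\<close>

lemma bq_min_sum_small:
  assumes c: "0 < c"
  shows "\<exists>T>0. \<forall>m. (\<Sum>i=1..m. bq i * min T (1 / mu i)) \<le> c"
proof -
  let ?f = "\<lambda>i. bq i * (1 / mu i)"
  have f0: "0 \<le> ?f i" for i using bq_pos[of i] by (simp add: mu_def)
  obtain M where M: "\<And>m n. M \<le> m \<Longrightarrow> norm (\<Sum>i=m..<n. ?f i) < c / 2"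
    using bq_mu_summable c unfolding summable_Cauchy by (meson half_gt_zero)
  let ?S = "\<Sum>i<M. bq i"
  have S: "0 \<le> ?S" by (intro sum_nonneg less_imp_le bq_pos)
  define T where "T = c / (2 * (?S + 1))"
  have T: "0 < T" unfolding T_def using c S by simp
  have "(\<Sum>i=1..m. bq i * min T (1 / mu i)) \<le> c" for m
  proof -
    have g0: "0 \<le> bq i * min T (1 / mu i)" for i
      using bq_pos[of i] T by (simp add: mu_def)
    have "(\<Sum>i=1..m. bq i * min T (1 / mu i)) \<le> (\<Sum>i\<in>{..<M} \<union> {M..<Suc m + M}. bq i * min T (1 / mu i))"
      by (rule sum_mono2) (use g0 in auto)
    also have "\<dots> = (\<Sum>i<M. bq i * min T (1 / mu i)) + (\<Sum>i=M..<Suc m + M. bq i * min T (1 / mu i))"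
      by (rule sum.union_disjoint) auto
    also have "(\<Sum>i<M. bq i * min T (1 / mu i)) \<le> (\<Sum>i<M. bq i * T)"
      by (intro sum_mono mult_left_mono less_imp_le[OF bq_pos]) simp
    also have "(\<Sum>i<M. bq i * T) = ?S * T" by (simp add: sum_distrib_right)
    also have "?S * T \<le> c / 2"
      unfolding T_def using S c by (simp add: divide_simps)
    also have "(\<Sum>i=M..<Suc m + M. bq i * min T (1 / mu i)) \<le> (\<Sum>i=M..<Suc m + M. ?f i)"
      by (intro sum_mono mult_left_mono less_imp_le[OF bq_pos]) simp
    also have "\<dots> \<le> c / 2" using M[of M "Suc m + M"] by (simp add: abs_le_iff del: sum.op_ivl_Suc)
    finally show ?thesis by simp
  qed
  with T show ?thesis by blast
qed

section \<open>Continuous functions tested against \<open>q m\<close> and against cosines\<close>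

lemma set_integrable_cont_mult:
  fixes f u :: "real \<Rightarrow> real"
  assumes "continuous_on {0..1} u" "continuous_on {0..1} f"
  shows "set_integrable lborel {0..1} (\<lambda>r. u r * f r)"
  by (rule borel_integrable_atLeastAtMost') (intro continuous_on_mult assms)

text \<open>The integral of \<open>q m\<close> is 1, while on [0, r0] with r0 < 1 it is at most
  q_m(r0) \<le> 2 m w(r0)^m, which tends to 0. If u(1) were below c, a level c' strictly between
  them would bound u near 1 and contradict the lower bound.\<close>

lemma q_concentrates_at_1:
  fixes u :: "real \<Rightarrow> real"
  assumes u: "continuous_on {0..1} u" and ge: "\<And>m. c \<le> (LINT r:{0..1}|lborel. u r * q m r)"
  shows "c \<le> u 1"
proof (rule ccontr)
  assume "\<not> c \<le> u 1"
  then have lt: "u 1 < (u 1 + c) / 2" "(u 1 + c) / 2 < c" by auto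
  define c' where "c' = (u 1 + c) / 2"
  have "\<exists>d>0. \<forall>r\<in>{0..1}. dist r 1 < d \<longrightarrow> dist (u r) (u 1) < c' - u 1"
    using u lt unfolding continuous_on_iff c'_def by (metis atLeastAtMost_iff diff_gt_0_iff_gt order_refl zero_le_one)
  then obtain d where d: "0 < d" "\<And>r. r \<in> {0..1} \<Longrightarrow> dist r 1 < d \<Longrightarrow> dist (u r) (u 1) < c' - u 1" by blast
  define r0 where "r0 = max 0 (1 - d/2)"
  have r0: "0 \<le> r0" "r0 < 1" using d(1) by (auto simp: r0_def)
  have near: "u r \<le> c'" if "r \<in> {0..1}" "r0 \<le> r" for r
  proof -
    have "dist r 1 < d" using that d(1) by (auto simp: r0_def dist_real_def)
    from d(2)[OF that(1) this] show ?thesis by (auto simp: dist_real_def)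
  qed
  have "bounded (u ` {0..1})" using u by (intro compact_imp_bounded compact_continuous_image) auto
  then obtain U where "\<forall>r\<in>{0..1}. \<bar>u r\<bar> \<le> U" unfolding bounded_iff by auto
  then have U: "\<And>r. r \<in> {0..1} \<Longrightarrow> \<bar>u r\<bar> \<le> U" by blast
  have U0: "0 \<le> U" using U[of 1] by simp
  let ?K = "U + \<bar>c'\<bar>"
  \<comment> \<open>Right of \<open>r0\<close> the function is at most \<open>c'\<close>. Left of
    it, monotonicity bounds \<open>q m r\<close> by \<open>q m r0\<close>, which pays for the excess
    of u over \<open>c'\<close>.\<close>
  have pt: "u r * q m r \<le> c' * q m r + ?K * q m r0" if r: "r \<in> {0..1}" for r m
  proof (cases "r0 \<le> r")
    case True
    have "u r * q m r \<le> c' * q m r" using near[OF r True] q_nonneg by (rule mult_right_mono)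
    moreover have "0 \<le> ?K * q m r0" using U0 q_nonneg by (intro mult_nonneg_nonneg) auto
    ultimately show ?thesis by linarith
  next
    case False
    have "(u r - c') * q m r \<le> ?K * q m r"
      using U[OF r] by (intro mult_right_mono q_nonneg) linarith
    also have "\<dots> \<le> ?K * q m r0"
      using False r r0 U0 by (intro mult_left_mono q_mono) auto
    finally show ?thesis by (simp add: left_diff_distrib)
  qed
  have le: "c \<le> c' + ?K * q m r0" for m
  proof -
    have "c \<le> (LINT r:{0..1}|lborel. u r * q m r)" by (rule ge)
    also have "\<dots> \<le> (LINT r:{0..1}|lborel. c' * q m r + ?K * q m r0)"
    proof (rule set_integral_mono)
      show "set_integrable lborel {0..1} (\<lambda>r. u r * q m r)"
        by (intro set_integrable_cont_mult u continuous_on_q)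
      show "set_integrable lborel {0..1} (\<lambda>r. c' * q m r + ?K * q m r0)"
        by (rule borel_integrable_atLeastAtMost') (intro continuous_intros continuous_on_q)
    qed (use pt in auto)
    also have "\<dots> = (LINT r:{0..1}|lborel. c' * q m r) + (LINT r:{0..1::real}|lborel. ?K * q m r0)"
      by (rule set_integral_add(2))
         (auto intro!: borel_integrable_atLeastAtMost' continuous_intros continuous_on_q)
    also have "(LINT r:{0..1}|lborel. c' * q m r) = c' * 1"
      by (simp only: set_integral_mult_right integral_q)
    also have "(LINT r:{0..1::real}|lborel. ?K * q m r0) = ?K * q m r0"
      by (simp add: set_lebesgue_integral_def)
    finally show ?thesis by simp
  qed
  have w1: "wq r0 < 1"
  proof -
    have "cos pi < cos (pi * r0)"
      by (rule cos_monotone_0_pi) (use r0(1) mult_strict_left_mono[OF r0(2) pi_gt_zero] in auto)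
    then show ?thesis unfolding wq_def by simp
  qed
  have "(\<lambda>m. real m * wq r0 ^ m) \<longlonglongrightarrow> 0"
    by (rule powser_times_n_limit_0) (use w1 wq_bounds(1)[of r0] in auto)
  then have lim: "(\<lambda>m. c' + ?K * (2 * (real m * wq r0 ^ m))) \<longlonglongrightarrow> c' + ?K * (2 * 0)"
    by (intro tendsto_intros)
  have "c \<le> c' + ?K * (2 * (real m * wq r0 ^ m))" if m: "1 \<le> m" for m
  proof -
    have "sqrt (real m) \<le> real m" using m by (simp add: real_sqrt_le_iff sqrt_le_D real_le_lsqrt power2_eq_square)
    then have "bq m \<le> 2 * real m" using bq_le[OF m] by linarith
    then have "q m r0 \<le> 2 * real m * wq r0 ^ m"
      unfolding q_def using wq_bounds(1)[of r0] by (intro mult_right_mono) auto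
    then have "?K * q m r0 \<le> ?K * (2 * real m * wq r0 ^ m)" using U0 by (intro mult_left_mono) auto
    then show ?thesis using le[of m] by (simp add: mult.assoc)
  qed
  then have "c \<le> c' + ?K * (2 * 0)"
    by (intro LIMSEQ_le_const[OF lim]) blast
  then show False using lt unfolding c'_def by simp
qed

text \<open>Cosine polynomials form an algebra that separates points of [0,1], as cos is injective
  on [0, pi]. By Stone-Weierstrass the difference w of the two functions is a uniform limit of
  functions orthogonal to it, so the integral of w^2 is 0.\<close>

lemma cos_coeffs_unique:
  fixes u v :: "real \<Rightarrow> real"
  assumes u: "continuous_on {0..1} u" and v: "continuous_on {0..1} v"
    and eq: "\<And>k. (LINT r:{0..1}|lborel. u r * cos (real k * pi * r)) = (LINT r:{0..1}|lborel. v r * cos (real k * pi * r))"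
    and r: "r \<in> {0..1}"
  shows "u r = v r"
proof -
  let ?w = "\<lambda>r. u r - v r"
  have w: "continuous_on {0..1} ?w" by (intro continuous_intros u v)
  have cc: "continuous_on S (\<lambda>r. cos (real k * pi * r))" for k S by (intro continuous_intros)
  have ccp: "continuous_on S g" if "cospoly m g" for g m and S :: "real set"
  proof -
    obtain a where "\<And>r. g r = (\<Sum>k\<le>m. a k * cos (real k * pi * r))" using \<open>cospoly m g\<close> unfolding cospoly_def by blast
    then have "g = (\<lambda>r. \<Sum>k\<le>m. a k * cos (real k * pi * r))" by auto
    then show ?thesis by (simp only:) (intro continuous_intros)
  qed
  have wk: "(LINT r:{0..1}|lborel. ?w r * cos (real k * pi * r)) = 0" for k
    unfolding left_diff_distrib using eq[of k]
    by (subst set_integral_diff(2)) (auto intro!: set_integrable_cont_mult u v cc)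
  have wp: "(LINT r:{0..1}|lborel. ?w r * g r) = 0" if g: "cospoly m g" for m g
  proof -
    obtain a where a: "\<And>r. g r = (\<Sum>k\<le>m. a k * cos (real k * pi * r))" using g unfolding cospoly_def by blast
    have "(LINT r:{0..1}|lborel. ?w r * g r) = (LINT r:{0..1}|lborel. \<Sum>k\<le>m. a k * (?w r * cos (real k * pi * r)))"
      unfolding a sum_distrib_left by (simp only: mult.left_commute)
    also have "\<dots> = (\<Sum>k\<le>m. LINT r:{0..1}|lborel. a k * (?w r * cos (real k * pi * r)))"
      unfolding set_lebesgue_integral_def scaleR_sum_right
    proof (rule Bochner_Integration.integral_sum)
      fix k
      show "integrable lborel (\<lambda>r. indicator {0..1} r *\<^sub>R (a k * (?w r * cos (real k * pi * r))))"
        using set_integrable_mult_right[OF set_integrable_cont_mult[OF w cc], of "a k" k] unfolding set_integrable_def .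
    qed
    also have "\<dots> = (\<Sum>k\<le>m. a k * (LINT r:{0..1}|lborel. ?w r * cos (real k * pi * r)))"
      by (simp only: set_integral_mult_right)
    also have "\<dots> = 0" using wk by simp
    finally show ?thesis .
  qed
  interpret function_ring_on "{g. \<exists>m. cospoly m g}" "{0..1::real}"
  proof
    show "compact {0..1::real}" by simp
    show "continuous_on {0..1} f" if "f \<in> {g. \<exists>m. cospoly m g}" for f using that ccp by auto
    show "(\<lambda>x. f x + g x) \<in> {g. \<exists>m. cospoly m g}" if "f \<in> {g. \<exists>m. cospoly m g}" "g \<in> {g. \<exists>m. cospoly m g}" for f g
    proof -
      note fg = that
      obtain m where "cospoly m f" using fg(1) by blast
      moreover obtain l where "cospoly l g" using fg(2) by blast
      ultimately have "cospoly (m + l) (\<lambda>r. f r * 1)" "cospoly (m + l) (\<lambda>r. 1 * g r)"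
        by (intro cospoly_mult cospoly_const; simp)+
      then have "cospoly (m + l) (\<lambda>x. f x + g x)" using cospoly_add by fastforce
      then show ?thesis by blast
    qed
    show "(\<lambda>x. f x * g x) \<in> {g. \<exists>m. cospoly m g}" if "f \<in> {g. \<exists>m. cospoly m g}" "g \<in> {g. \<exists>m. cospoly m g}" for f g
      using that cospoly_mult by blast
    show "(\<lambda>_. c) \<in> {g. \<exists>m. cospoly m g}" for c using cospoly_const by blast
    show "\<exists>f\<in>{g. \<exists>m. cospoly m g}. f x \<noteq> f y" if "x \<in> {0..1}" "y \<in> {0..1}" "x \<noteq> y" for x y :: real
    proof (rule bexI)
      have "cos (pi * x) \<noteq> cos (pi * y)"
        using cos_inj_pi[of "pi * x" "pi * y"] that by (auto simp: mult_le_cancel_left1)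
      then show "cos (real 1 * pi * x) \<noteq> cos (real 1 * pi * y)" by simp
      show "(\<lambda>x. cos (real 1 * pi * x)) \<in> {g. \<exists>m. cospoly m g}" using cospoly_cos[of 1 1] by auto
    qed
  qed
  have wint: "set_integrable lborel {0..1} ?w" by (rule borel_integrable_atLeastAtMost'[OF w])
  \<comment> \<open>Replace one factor w by w - g for a cosine polynomial g within e of w; the term
    with g integrates to 0.\<close>
  have "(LINT r:{0..1}|lborel. ?w r * ?w r) \<le> e * (LINT r:{0..1}|lborel. \<bar>?w r\<bar>)" if e: "0 < e" for e
  proof -
    from Stone_Weierstrass_basic[OF w e] obtain g where g: "g \<in> {g. \<exists>m. cospoly m g}"
      and "\<forall>r\<in>{0..1}. \<bar>?w r - g r\<bar> < e" by blast
    then have close: "\<And>r. r \<in> {0..1} \<Longrightarrow> \<bar>?w r - g r\<bar> < e" by blast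
    obtain m where m: "cospoly m g" using g by blast
    have "(LINT r:{0..1}|lborel. ?w r * ?w r) = (LINT r:{0..1}|lborel. ?w r * (?w r - g r) + ?w r * g r)"
      by (simp only: distrib_left[symmetric] diff_add_cancel)
    also have "\<dots> = (LINT r:{0..1}|lborel. ?w r * (?w r - g r)) + (LINT r:{0..1}|lborel. ?w r * g r)"
      by (rule set_integral_add(2)) (intro set_integrable_cont_mult w continuous_on_diff ccp[OF m])+
    also have "(LINT r:{0..1}|lborel. ?w r * g r) = 0" by (rule wp[OF m])
    also have "(LINT r:{0..1}|lborel. ?w r * (?w r - g r)) \<le> (LINT r:{0..1}|lborel. e * \<bar>?w r\<bar>)"
    proof (rule set_integral_mono)
      show "set_integrable lborel {0..1} (\<lambda>r. ?w r * (?w r - g r))"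
        by (intro set_integrable_cont_mult w continuous_on_diff ccp[OF m])
      show "set_integrable lborel {0..1} (\<lambda>r. e * \<bar>?w r\<bar>)"
        by (intro set_integrable_mult_right set_integrable_abs wint)
      fix r :: real assume "r \<in> {0..1}"
      then have "\<bar>?w r\<bar> * \<bar>?w r - g r\<bar> \<le> \<bar>?w r\<bar> * e" using close by (intro mult_left_mono) (auto intro: less_imp_le)
      then show "?w r * (?w r - g r) \<le> e * \<bar>?w r\<bar>"
        unfolding abs_mult[symmetric] by (simp add: mult.commute)
    qed
    finally show ?thesis by (simp add: set_integral_mult_right)
  qed
  note small = this
  let ?I = "LINT r:{0..1}|lborel. \<bar>?w r\<bar>"
  have I0: "0 \<le> ?I" by (simp add: set_lebesgue_integral_def)
  have "(LINT r:{0..1}|lborel. ?w r * ?w r) \<le> 0"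
  proof (rule field_le_epsilon)
    fix e :: real assume e: "0 < e"
    have "(LINT r:{0..1}|lborel. ?w r * ?w r) \<le> e / (?I + 1) * ?I" by (rule small) (use e I0 in simp)
    also have "\<dots> \<le> e" using e I0 by (simp add: divide_simps)
    finally show "(LINT r:{0..1}|lborel. ?w r * ?w r) \<le> 0 + e" by simp
  qed
  moreover have "0 \<le> (LINT r:{0..1}|lborel. ?w r * ?w r)" by (simp add: set_lebesgue_integral_def)
  ultimately have z: "(LINT r:{0..1}|lborel. ?w r * ?w r) = 0" by simp
  have wwint: "set_integrable lborel {0..1} (\<lambda>r. ?w r * ?w r)" by (intro set_integrable_cont_mult w)
  have "((\<lambda>r. ?w r * ?w r) has_integral 0) (cbox 0 1)"
    using has_integral_set_lebesgue[of "{0..1}" "\<lambda>r. ?w r * ?w r"] set_borel_integral_eq_integral[OF wwint] z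
    by (metis cbox_interval has_integral_integral)
  then have "?w r * ?w r = 0"
    by (rule has_integral_0_cbox_imp_0[rotated 2]) (use r in \<open>auto intro!: continuous_intros u v simp: cbox_interval\<close>)
  then show ?thesis by simp
qed

section \<open>The Neumann heat kernel\<close>

definition gpair :: "real \<Rightarrow> real \<Rightarrow> real \<Rightarrow> int \<Rightarrow> real" where
  "gpair t r r' m = gauss t r (2 * real_of_int m + r') + gauss t r (2 * real_of_int m - r')"

text \<open>The images indexed by m and -m are grouped, so that the sum over the integers becomes a
  series over the naturals.\<close>

definition gterm :: "real \<Rightarrow> real \<Rightarrow> real \<Rightarrow> nat \<Rightarrow> real" where
  "gterm t r r' i = (if i = 0 then gpair t r r' 0 else gpair t r r' (int i) + gpair t r r' (- int i))"

text \<open>A majorant uniform over r and r' in [0,1] and over t \<le> T. For i < 2 an image may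
  coincide with r, so only the trivial bound 1 is available; from i = 2 on it is geometric.\<close>

definition gdom :: "real \<Rightarrow> nat \<Rightarrow> real" where
  "gdom T i = (if i < 2 then 1 else exp (- (1 / (2 * T))) ^ i)"

definition gconst :: "real \<Rightarrow> real" where
  "gconst T = 4 * (\<Sum>i. gdom T i)"

lemma gauss_nonneg: "0 \<le> t \<Longrightarrow> 0 \<le> gauss t r r'"
  unfolding gauss_def by simp

lemma gdom_pos: "0 < gdom T i"
  unfolding gdom_def by simp

lemma gdom_summable:
  assumes "0 < T" shows "summable (gdom T)"
proof -
  have "summable (\<lambda>i. exp (- (1 / (2 * T))) ^ i)"
    by (rule summable_geometric) (use assms in auto)
  then show ?thesis
    by (rule summable_cong[THEN iffD1, rotated])
       (use eventually_ge_at_top[of 2] in \<open>eventually_elim, auto simp: gdom_def\<close>)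
qed

text \<open>For i \<ge> 2 the distance 2 i - 2 is at least i, and i^2 \<ge> i, so the Gaussian
  factor is at most exp (- i / (2 T)).\<close>

lemma gauss_le_gdom:
  assumes t: "0 < t" "t \<le> T" and i: "\<bar>r - c\<bar> \<ge> 2 * real i - 2"
  shows "gauss t r c \<le> gdom T i / sqrt (2 * pi * t)"
proof -
  have "exp (- ((r - c)^2) / (2 * t)) \<le> gdom T i"
  proof (cases "i < 2")
    case True
    then show ?thesis using t by (simp add: gdom_def)
  next
    case False
    then have i2: "2 \<le> real i" by simp
    have "real i \<le> \<bar>r - c\<bar>" using i i2 by linarith
    then have "real i * real i \<le> \<bar>r - c\<bar> * \<bar>r - c\<bar>" by (intro mult_mono) auto
    moreover have "real i * 1 \<le> real i * real i" using i2 by (intro mult_left_mono) auto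
    ultimately have "real i \<le> (r - c)\<^sup>2" by (simp add: power2_eq_square)
    then have "real i / (2 * T) \<le> (r - c)\<^sup>2 / (2 * t)"
      using t by (intro frac_le) auto
    then have "exp (- ((r - c)^2) / (2 * t)) \<le> exp (real i * (- (1 / (2 * T))))" by simp
    also have "\<dots> = gdom T i" using False unfolding exp_of_nat_mult gdom_def by simp
    finally show ?thesis .
  qed
  then show ?thesis unfolding gauss_def using t by (intro divide_right_mono) auto
qed

lemma gpair_le:
  assumes t: "0 < t" "t \<le> T" and r: "r \<in> {0..1}" "r' \<in> {0..1}" and m: "\<bar>m\<bar> = int i"
  shows "gpair t r r' m \<le> 2 * gdom T i / sqrt (2 * pi * t)"
proof -
  have m': "\<bar>real_of_int m\<bar> = real i" using m by (metis of_int_abs of_int_of_nat_eq)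
  have "\<bar>r - (2 * real_of_int m + r')\<bar> \<ge> 2 * real i - 2" "\<bar>r - (2 * real_of_int m - r')\<bar> \<ge> 2 * real i - 2"
    using m' r by auto
  then have "gauss t r (2 * real_of_int m + r') \<le> gdom T i / sqrt (2 * pi * t)"
    "gauss t r (2 * real_of_int m - r') \<le> gdom T i / sqrt (2 * pi * t)"
    by (auto intro: gauss_le_gdom t)
  then show ?thesis unfolding gpair_def by simp
qed

lemma gpair_nonneg: "0 \<le> t \<Longrightarrow> 0 \<le> gpair t r r' m"
  unfolding gpair_def by (simp add: gauss_nonneg)

lemma gterm_nonneg: "0 \<le> t \<Longrightarrow> 0 \<le> gterm t r r' i"
  unfolding gterm_def by (simp add: gpair_nonneg)

lemma gterm_le:
  assumes t: "0 < t" "t \<le> T" and r: "r \<in> {0..1}" "r' \<in> {0..1}"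
  shows "gterm t r r' i \<le> 4 * gdom T i / sqrt (2 * pi * t)"
proof -
  have "0 < gdom T i / sqrt (2 * pi * t)" using gdom_pos t by simp
  then show ?thesis
    unfolding gterm_def using gpair_le[OF t r, of 0 i] gpair_le[OF t r, of "int i" i] gpair_le[OF t r, of "- int i" i]
    by (cases "i = 0") auto
qed

lemma gterm_summable:
  assumes t: "0 < t" and r: "r \<in> {0..1}" "r' \<in> {0..1}"
  shows "summable (gterm t r r')"
proof (rule summable_comparison_test'[where N = 0])
  show "summable (\<lambda>i. 4 * gdom t i / sqrt (2 * pi * t))"
    by (intro summable_divide summable_mult gdom_summable t)
  show "norm (gterm t r r' i) \<le> 4 * gdom t i / sqrt (2 * pi * t)" for i
    using gterm_le[OF t order_refl r, of i] gterm_nonneg[of t r r' i] t by simp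
qed

lemma sum_int_symmetric:
  fixes f :: "int \<Rightarrow> real"
  shows "(\<Sum>m\<in>{- int M..int M}. f m) = (\<Sum>i\<le>M. if i = 0 then f 0 else f (int i) + f (- int i))"
proof (induction M)
  case (Suc M)
  have "{- int (Suc M)..int (Suc M)} = insert (int (Suc M)) (insert (- int (Suc M)) {- int M..int M})" by auto
  then have "(\<Sum>m\<in>{- int (Suc M)..int (Suc M)}. f m) = f (int (Suc M)) + (f (- int (Suc M)) + (\<Sum>m\<in>{- int M..int M}. f m))"
    by (simp only:) (subst sum.insert, auto)+
  then show ?case using Suc by simp
qed simp

text \<open>All terms are nonnegative with bounded partial sums, so the unordered sum exists and may
  be evaluated along the symmetric intervals from -M to M.\<close>

lemma Gneum_eq_suminf:
  assumes t: "0 < t" and r: "r \<in> {0..1}" "r' \<in> {0..1}"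
  shows "Gneum t r r' = (\<Sum>i. gterm t r r' i)"
proof -
  let ?f = "gpair t r r'"
  have f0: "0 \<le> ?f m" for m using t by (simp add: gpair_nonneg)
  have part: "sum ?f {- int M..int M} = (\<Sum>i\<le>M. gterm t r r' i)" for M
    unfolding sum_int_symmetric gterm_def ..
  have sg: "summable (gterm t r r')" by (rule gterm_summable[OF t r])
  have sub: "\<exists>M. X \<subseteq> {- int M..int M}" if X: "finite X" for X :: "int set"
  proof -
    have "X \<subseteq> {- int (nat (Max (insert 0 (abs ` X))))..int (nat (Max (insert 0 (abs ` X))))}"
    proof
      fix x assume "x \<in> X"
      then have "\<bar>x\<bar> \<le> Max (insert 0 (abs ` X))" using X by (intro Max_ge) auto
      then show "x \<in> {- int (nat (Max (insert 0 (abs ` X))))..int (nat (Max (insert 0 (abs ` X))))}" by auto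
    qed
    then show ?thesis by blast
  qed
  have "?f summable_on UNIV"
  proof (rule nonneg_bdd_above_summable_on)
    show "bdd_above (sum ?f ` {F. F \<subseteq> UNIV \<and> finite F})"
    proof (rule bdd_aboveI2)
      fix X :: "int set" assume "X \<in> {F. F \<subseteq> UNIV \<and> finite F}"
      then obtain M where M: "X \<subseteq> {- int M..int M}" using sub by auto
      have "sum ?f X \<le> sum ?f {- int M..int M}" by (rule sum_mono2) (use M f0 in auto)
      also have "\<dots> \<le> (\<Sum>i. gterm t r r' i)"
        unfolding part using gterm_nonneg t sg by (intro sum_le_suminf) auto
      finally show "sum ?f X \<le> (\<Sum>i. gterm t r r' i)" .
    qed
  qed (use f0 in auto)
  then have "(?f has_sum Gneum t r r') UNIV"
    unfolding Gneum_def gpair_def[symmetric] by (rule has_sum_infsum)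
  then have "(sum ?f \<longlongrightarrow> Gneum t r r') (finite_subsets_at_top UNIV)"
    unfolding has_sum_def .
  moreover have "filterlim (\<lambda>M. {- int M..int M}) (finite_subsets_at_top UNIV) sequentially"
    unfolding filterlim_finite_subsets_at_top
  proof (intro allI impI)
    fix X :: "int set" assume "finite X \<and> X \<subseteq> UNIV"
    then obtain M where M: "X \<subseteq> {- int M..int M}" using sub by auto
    show "\<forall>\<^sub>F y in sequentially. finite {- int y..int y} \<and> X \<subseteq> {- int y..int y} \<and> {- int y..int y} \<subseteq> UNIV"
      using eventually_ge_at_top[of M] by eventually_elim (use M in auto)
  qed
  ultimately have "(\<lambda>M. sum ?f {- int M..int M}) \<longlonglongrightarrow> Gneum t r r'"
    by (rule filterlim_compose)
  then have "(\<lambda>M. \<Sum>i\<le>M. gterm t r r' i) \<longlonglongrightarrow> Gneum t r r'" unfolding part .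
  moreover have "(\<lambda>M. \<Sum>i\<le>M. gterm t r r' i) \<longlonglongrightarrow> (\<Sum>i. gterm t r r' i)"
    by (rule summable_LIMSEQ'[OF sg])
  ultimately show ?thesis by (rule LIMSEQ_unique)
qed

text \<open>The factor t^(-1/2) is integrable at 0, which makes the boundary integral of the formula
  finite and dominated uniformly in r.\<close>

lemma Gneum_bounds:
  assumes t: "0 < t" "t \<le> T" and r: "r \<in> {0..1}" "r' \<in> {0..1}"
  shows "0 \<le> Gneum t r r'" "Gneum t r r' \<le> gconst T / sqrt (2 * pi * t)"
proof -
  have T: "0 < T" using t by simp
  have sg: "summable (gterm t r r')" by (rule gterm_summable[OF t(1) r])
  show "0 \<le> Gneum t r r'" unfolding Gneum_eq_suminf[OF t(1) r]
    by (rule suminf_nonneg[OF sg]) (use t in \<open>simp add: gterm_nonneg\<close>)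
  have "(\<Sum>i. gterm t r r' i) \<le> (\<Sum>i. 4 * gdom T i / sqrt (2 * pi * t))"
    by (intro suminf_le gterm_le t r sg summable_divide summable_mult gdom_summable T)
  also have "\<dots> = gconst T / sqrt (2 * pi * t)"
    unfolding gconst_def
    by (simp only: suminf_divide[OF summable_mult[OF gdom_summable[OF T]]] suminf_mult[OF gdom_summable[OF T]])
  finally show "Gneum t r r' \<le> gconst T / sqrt (2 * pi * t)" unfolding Gneum_eq_suminf[OF t(1) r] .
qed

lemma Gneum_uniform_limit:
  assumes t: "0 < t" and r': "r' \<in> {0..1}"
  shows "uniform_limit {0..1} (\<lambda>M r. \<Sum>i<M. gterm t r r' i) (\<lambda>r. Gneum t r r') sequentially"
proof -
  have "uniform_limit {0..1} (\<lambda>M r. \<Sum>i<M. gterm t r r' i) (\<lambda>r. \<Sum>i. gterm t r r' i) sequentially"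
  proof (rule Weierstrass_m_test)
    show "summable (\<lambda>i. 4 * gdom t i / sqrt (2 * pi * t))"
      by (intro summable_divide summable_mult gdom_summable t)
    show "norm (gterm t r r' i) \<le> 4 * gdom t i / sqrt (2 * pi * t)" if "r \<in> {0..1}" for i r
      using gterm_le[OF t order_refl that r', of i] gterm_nonneg[of t r r' i] t by simp
  qed
  then show ?thesis
    by (rule uniform_limit_cong'[THEN iffD1, rotated 2]) (use Gneum_eq_suminf[OF t _ r'] in auto)
qed

lemma continuous_on_gterm: "0 < t \<Longrightarrow> continuous_on S (\<lambda>r. gterm t r r' i)"
  unfolding gterm_def gpair_def gauss_def by (cases "i = 0") (auto intro!: continuous_intros)

lemma continuous_on_Gneum:
  assumes t: "0 < t" and r': "r' \<in> {0..1}"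
  shows "continuous_on {0..1} (\<lambda>r. Gneum t r r')"
  by (rule uniform_limit_theorem[OF _ Gneum_uniform_limit[OF assms]])
     (auto intro!: always_eventually continuous_on_sum continuous_on_gterm t)

text \<open>After the substitution x = c + sqrt t y, this is the real part of the characteristic
  function of the standard normal law; its imaginary part, the sine integral, vanishes.\<close>

lemma gauss_cos_integral:
  assumes t: "0 < t"
  shows "integrable lborel (\<lambda>x. gauss t x c * cos (\<omega> * x))"
    and "(LINT x|lborel. gauss t x c * cos (\<omega> * x)) = exp (- (\<omega>\<^sup>2 * t / 2)) * cos (\<omega> * c)"
proof -
  have gn: "gauss t x c = normal_density c (sqrt t) x" for x
    unfolding gauss_def normal_density_def using t by simp
  have s: "0 < sqrt t" using t by simp
  have int1: "integrable lborel (\<lambda>x. normal_density c (sqrt t) x * g x)"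
    if g: "g \<in> borel_measurable borel" "\<And>x. \<bar>g x\<bar> \<le> 1" and t: "0 < t" for c t and g :: "real \<Rightarrow> real"
  proof -
    have "integrable lborel (normal_density c (sqrt t))" using t by (intro integrable_normal_density) simp
    then show ?thesis
    proof (rule Bochner_Integration.integrable_bound)
      show "(\<lambda>x. normal_density c (sqrt t) x * g x) \<in> borel_measurable lborel" using g by measurable
      show "AE x in lborel. norm (normal_density c (sqrt t) x * g x) \<le> norm (normal_density c (sqrt t) x)"
        using g(2) by (auto simp: abs_mult mult_left_le)
    qed
  qed
  show "integrable lborel (\<lambda>x. gauss t x c * cos (\<omega> * x))"
    unfolding gn by (rule int1) (use t in auto)
  let ?\<phi> = "\<lambda>x. std_normal_density x"
  let ?w = "\<omega> * sqrt t"
  interpret std: prob_space std_normal_distribution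
    by (rule prob_space_normal_density) simp
  have ie: "integrable std_normal_distribution (\<lambda>x. iexp (?w * x))"
    by (rule std.integrable_const_bound[where B = 1]) auto
  have "char std_normal_distribution ?w = complex_of_real (exp (- ?w\<^sup>2 / 2))"
    using char_std_normal_distribution by (rule fun_cong)
  then have C: "(CLINT x|std_normal_distribution. iexp (?w * x)) = complex_of_real (exp (- ?w\<^sup>2 / 2))"
    unfolding char_def .
  have "(LINT x|std_normal_distribution. Re (iexp (?w * x))) = exp (- ?w\<^sup>2 / 2)"
    unfolding integral_Re[OF ie] C by simp
  then have c1: "(LINT x|lborel. ?\<phi> x * cos (?w * x)) = exp (- ?w\<^sup>2 / 2)"
    by (simp add: integral_density Re_exp)
  have "(LINT x|std_normal_distribution. Im (iexp (?w * x))) = 0"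
    unfolding integral_Im[OF ie] C by simp
  then have s1: "(LINT x|lborel. ?\<phi> x * sin (?w * x)) = 0"
    by (simp add: integral_density Im_exp)
  have ic: "integrable lborel (\<lambda>x. ?\<phi> x * cos (?w * x))" "integrable lborel (\<lambda>x. ?\<phi> x * sin (?w * x))"
    using int1[where g = "\<lambda>x. cos (?w * x)" and c = 0 and t = 1]
      int1[where g = "\<lambda>x. sin (?w * x)" and c = 0 and t = 1] by simp_all
  have pt: "sqrt t * (gauss t (c + sqrt t * x) c * cos (\<omega> * (c + sqrt t * x)))
     = cos (\<omega> * c) * (?\<phi> x * cos (?w * x)) - sin (\<omega> * c) * (?\<phi> x * sin (?w * x))" for x
  proof -
    have "sqrt t * gauss t (c + sqrt t * x) c = ?\<phi> x"
      unfolding gauss_def std_normal_density_def using t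
      by (simp add: power_mult_distrib real_sqrt_mult)
    moreover have "cos (\<omega> * (c + sqrt t * x)) = cos (\<omega> * c) * cos (?w * x) - sin (\<omega> * c) * sin (?w * x)"
      by (simp add: cos_add[symmetric] distrib_left mult_ac)
    ultimately show ?thesis by (simp only: mult.assoc[symmetric]) (simp add: right_diff_distrib)
  qed
  have "(LINT x|lborel. gauss t x c * cos (\<omega> * x))
     = \<bar>sqrt t\<bar> *\<^sub>R (LINT x|lborel. gauss t (c + sqrt t * x) c * cos (\<omega> * (c + sqrt t * x)))"
    by (rule lborel_integral_real_affine) (use s in simp)
  also have "\<dots> = (LINT x|lborel. sqrt t * (gauss t (c + sqrt t * x) c * cos (\<omega> * (c + sqrt t * x))))"
    using t by simp
  also have "\<dots> = (LINT x|lborel. cos (\<omega> * c) * (?\<phi> x * cos (?w * x)) - sin (\<omega> * c) * (?\<phi> x * sin (?w * x)))"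
    unfolding pt ..
  also have "\<dots> = cos (\<omega> * c) * exp (- ?w\<^sup>2 / 2) - sin (\<omega> * c) * 0"
    using ic by (simp add: c1 s1)
  finally show "(LINT x|lborel. gauss t x c * cos (\<omega> * x)) = exp (- (\<omega>\<^sup>2 * t / 2)) * cos (\<omega> * c)"
    using t by (simp add: power_mult_distrib)
qed

text \<open>Unfolding: cos (k pi r) is even and 2-periodic, so the contribution of each image over
  [0,1] is the integral of one fixed Gaussian times the cosine over a shifted or reflected unit
  interval. These intervals tile the line, which leaves a full Gaussian Fourier integral.\<close>

lemma Gneum_cos_integral:
  assumes t: "0 < t" and r': "r' \<in> {0..1}"
  shows "(LINT r:{0..1}|lborel. Gneum t r r' * cos (real k * pi * r)) = exp (- mu k * t) * cos (real k * pi * r')"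
proof -
  let ?\<omega> = "real k * pi"
  let ?\<phi> = "\<lambda>x. gauss t x r' * cos (?\<omega> * x)"
  have cont: "isCont ?\<phi> x" for x
    unfolding gauss_def using t by (intro continuous_intros) auto
  obtain \<Phi> where \<Phi>: "\<And>x. (\<Phi> has_real_derivative ?\<phi> x) (at x)"
    using einterval_antiderivative[of "-\<infinity>" "\<infinity>" ?\<phi>] cont
    by (auto simp: has_real_derivative_iff_has_vector_derivative)
  have per: "cos (?\<omega> * (x - 2 * real_of_int m)) = cos (?\<omega> * x)" for x m
  proof -
    have "?\<omega> * (x - 2 * real_of_int m) = ?\<omega> * x - 2 * pi * real_of_int (int k * m)" by (simp add: algebra_simps)
    moreover have "sin (2 * pi * real_of_int (int k * m)) = 0" "cos (2 * pi * real_of_int (int k * m)) = 1"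
      by (metis Ints_of_int sin_integer_2pi mult.assoc mult.commute, metis Ints_of_int cos_integer_2pi mult.assoc mult.commute)
    ultimately show ?thesis by (simp only: cos_diff mult_1_right mult_zero_right add_0_right)
  qed
  have I: "((\<lambda>r. gpair t r r' m * cos (?\<omega> * r)) has_integral
     (\<Phi> (1 - 2 * real_of_int m) - \<Phi> (- 2 * real_of_int m) + (\<Phi> (2 * real_of_int m) - \<Phi> (2 * real_of_int m - 1)))) {0..1}" for m
  proof -
    let ?m = "real_of_int m"
    have 1: "gauss t r (2 * ?m + r') * cos (?\<omega> * r) = ?\<phi> (r - 2 * ?m)" for r
      unfolding per gauss_def by (simp add: algebra_simps)
    have 2: "gauss t r (2 * ?m - r') * cos (?\<omega> * r) = ?\<phi> (2 * ?m - r)" for r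
    proof -
      have "cos (?\<omega> * (2 * ?m - r)) = cos (?\<omega> * (r - 2 * ?m))"
        by (subst cos_minus[symmetric]) (simp add: algebra_simps)
      moreover have "(r - (2 * ?m - r'))\<^sup>2 = (2 * ?m - r - r')\<^sup>2" by (simp add: power2_eq_square algebra_simps)
      ultimately show ?thesis unfolding per gauss_def by simp
    qed
    have "((\<lambda>r. ?\<phi> (r - 2 * ?m)) has_integral (\<Phi> (1 - 2 * ?m) - \<Phi> (0 - 2 * ?m))) {0..1}"
    proof (rule fundamental_theorem_of_calculus)
      fix x :: real
      have "((\<lambda>r. \<Phi> (r - 2 * ?m)) has_real_derivative ?\<phi> (x - 2 * ?m) * 1) (at x)"
        by (rule DERIV_chain2[OF \<Phi>]) (auto intro!: derivative_eq_intros)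
      then show "((\<lambda>r. \<Phi> (r - 2 * ?m)) has_vector_derivative ?\<phi> (x - 2 * ?m)) (at x within {0..1})"
        by (simp add: has_real_derivative_iff_has_vector_derivative has_vector_derivative_at_within)
    qed simp
    moreover have "((\<lambda>r. ?\<phi> (2 * ?m - r)) has_integral (- \<Phi> (2 * ?m - 1) - (- \<Phi> (2 * ?m - 0)))) {0..1}"
    proof (rule fundamental_theorem_of_calculus)
      fix x :: real
      have "((\<lambda>r. - \<Phi> (2 * ?m - r)) has_real_derivative - (?\<phi> (2 * ?m - x) * (- 1))) (at x)"
        by (rule DERIV_minus, rule DERIV_chain2[OF \<Phi>]) (auto intro!: derivative_eq_intros)
      then show "((\<lambda>r. - \<Phi> (2 * ?m - r)) has_vector_derivative ?\<phi> (2 * ?m - x)) (at x within {0..1})"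
        by (simp add: has_real_derivative_iff_has_vector_derivative has_vector_derivative_at_within)
    qed simp
    ultimately have "((\<lambda>r. ?\<phi> (r - 2 * ?m) + ?\<phi> (2 * ?m - r)) has_integral
      ((\<Phi> (1 - 2 * ?m) - \<Phi> (0 - 2 * ?m)) + (- \<Phi> (2 * ?m - 1) - (- \<Phi> (2 * ?m - 0))))) {0..1}"
      by (rule has_integral_add)
    then show ?thesis unfolding gpair_def distrib_right 1 2 by (simp add: algebra_simps)
  qed
  \<comment> \<open>The intervals belonging to i and -i are [2i-1, 2i+1] and its mirror image, so in
    terms of the antiderivative the partial sums telescope to an integral over
    [-(2M-1), 2M-1].\<close>
  have I2: "((\<lambda>r. (\<Sum>i<M. gterm t r r' i) * cos (?\<omega> * r)) has_integral
     (if M = 0 then 0 else \<Phi> (2 * real M - 1) - \<Phi> (- (2 * real M - 1)))) {0..1}" for M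
  proof (induction M)
    case 0
    show ?case by simp
  next
    case (Suc M)
    have "((\<lambda>r. gterm t r r' M * cos (?\<omega> * r)) has_integral (if M = 0 then \<Phi> 1 - \<Phi> (-1)
       else \<Phi> (1 - 2 * real M) - \<Phi> (- 2 * real M) + (\<Phi> (2 * real M) - \<Phi> (2 * real M - 1))
         + (\<Phi> (1 + 2 * real M) - \<Phi> (2 * real M) + (\<Phi> (- 2 * real M) - \<Phi> (- 2 * real M - 1))))) {0..1}"
    proof (cases "M = 0")
      case True
      then show ?thesis using I[of 0] by (simp add: gterm_def)
    next
      case False
      then show ?thesis
        using has_integral_add[OF I[of "int M"] I[of "- int M"]] by (simp add: gterm_def distrib_right)
    qed
    note H = has_integral_add[OF Suc this]
    have e: "- 2 * real M - 1 = - (2 * real (Suc M) - 1)" "1 + 2 * real M = 2 * real (Suc M) - 1"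
      "1 - 2 * real M = - (2 * real M - 1)"
      by simp_all
    have "(if M = 0 then 0 else \<Phi> (2 * real M - 1) - \<Phi> (- (2 * real M - 1)))
      + (if M = 0 then \<Phi> 1 - \<Phi> (-1)
       else \<Phi> (1 - 2 * real M) - \<Phi> (- 2 * real M) + (\<Phi> (2 * real M) - \<Phi> (2 * real M - 1))
         + (\<Phi> (1 + 2 * real M) - \<Phi> (2 * real M) + (\<Phi> (- 2 * real M) - \<Phi> (- 2 * real M - 1))))
      = \<Phi> (2 * real (Suc M) - 1) - \<Phi> (- (2 * real (Suc M) - 1))"
      unfolding e by (cases "M = 0") simp_all
    with H show ?case by (simp only: sum.lessThan_Suc distrib_right nat.distinct if_False)
  qed
  have ul: "uniform_limit {0..1} (\<lambda>M r. (\<Sum>i<M. gterm t r r' i) * cos (?\<omega> * r)) (\<lambda>r. Gneum t r r' * cos (?\<omega> * r)) sequentially"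
  proof (rule uniform_lim_mult)
    show "uniform_limit {0..1} (\<lambda>M r. \<Sum>i<M. gterm t r r' i) (\<lambda>r. Gneum t r r') sequentially"
      by (rule Gneum_uniform_limit[OF t r'])
    show "uniform_limit {0..1} (\<lambda>M r. cos (?\<omega> * r)) (\<lambda>r. cos (?\<omega> * r)) sequentially"
      by (rule uniform_limit_const)
    show "bounded ((\<lambda>r. Gneum t r r') ` {0..1})"
      by (intro compact_imp_bounded compact_continuous_image continuous_on_Gneum t r') simp
    show "bounded ((\<lambda>r. cos (?\<omega> * r)) ` {0..1})"
      by (intro compact_imp_bounded compact_continuous_image continuous_intros) simp
  qed
  obtain I' J where I': "\<And>M. ((\<lambda>r. (\<Sum>i<M. gterm t r r' i) * cos (?\<omega> * r)) has_integral I' M) {0..1}"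
    and J: "((\<lambda>r. Gneum t r r' * cos (?\<omega> * r)) has_integral J) {0..1}" and lim: "I' \<longlonglongrightarrow> J"
    by (rule uniform_limit_integral[OF ul]) (auto intro!: continuous_intros continuous_on_gterm t)
  have I'eq: "I' M = (if M = 0 then 0 else \<Phi> (2 * real M - 1) - \<Phi> (- (2 * real M - 1)))" for M
    using has_integral_unique[OF I' I2] .
  \<comment> \<open>The odd half-widths 2 i + 1 are those reached by the partial sums with M = i +
    1.\<close>
  have "(\<lambda>i. LINT x:{- real (2 * i + 1)..real (2 * i + 1)}|lborel. ?\<phi> x) \<longlonglongrightarrow> (LINT x:(\<Union>i. {- real (2 * i + 1)..real (2 * i + 1)})|lborel. ?\<phi> x)"
  proof (rule set_integral_cont_up)
    show "incseq (\<lambda>i. {- real (2 * i + 1)..real (2 * i + 1)})" by (auto simp: incseq_def)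
    show "set_integrable lborel (\<Union>i. {- real (2 * i + 1)..real (2 * i + 1)}) ?\<phi>"
      unfolding set_integrable_def
      by (rule integrable_mult_indicator[OF _ gauss_cos_integral(1)[OF t]]) auto
  qed auto
  moreover have "(\<Union>i. {- real (2 * i + 1)..real (2 * i + 1)}) = (UNIV :: real set)"
  proof -
    have "\<exists>i. x \<in> {- real (2 * i + 1)..real (2 * i + 1)}" for x :: real
    proof -
      obtain i where "\<bar>x\<bar> \<le> real i" using real_nat_ceiling_ge by blast
      then have "x \<in> {- real (2 * i + 1)..real (2 * i + 1)}" by auto
      then show ?thesis ..
    qed
    then show ?thesis by blast
  qed
  moreover have "(LINT x:{- real (2 * i + 1)..real (2 * i + 1)}|lborel. ?\<phi> x) = \<Phi> (real (2 * i + 1)) - \<Phi> (- real (2 * i + 1))" for i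
  proof -
    have "(LBINT x. ?\<phi> x * indicator {- real (2 * i + 1)..real (2 * i + 1)} x) = \<Phi> (real (2 * i + 1)) - \<Phi> (- real (2 * i + 1))"
      by (rule integral_FTC_Icc_real) (use \<Phi> cont in auto)
    then show ?thesis by (simp add: set_lebesgue_integral_def mult.commute)
  qed
  ultimately have "(\<lambda>i. \<Phi> (real (2 * i + 1)) - \<Phi> (- real (2 * i + 1))) \<longlonglongrightarrow> (LINT x|lborel. ?\<phi> x)"
    by (simp add: set_lebesgue_integral_def)
  moreover have "\<Phi> (real (2 * i + 1)) - \<Phi> (- real (2 * i + 1)) = I' (Suc i)" for i
    unfolding I'eq by (simp add: algebra_simps)
  ultimately have "(\<lambda>i. I' (Suc i)) \<longlonglongrightarrow> (LINT x|lborel. ?\<phi> x)" by simp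
  moreover have "(\<lambda>i. I' (Suc i)) \<longlonglongrightarrow> J" using lim by (rule LIMSEQ_Suc)
  ultimately have Jeq: "J = (LINT x|lborel. ?\<phi> x)" by (metis LIMSEQ_unique)
  have "set_integrable lborel {0..1} (\<lambda>r. Gneum t r r' * cos (?\<omega> * r))"
    by (intro set_integrable_cont_mult continuous_on_Gneum t r' continuous_intros)
  then have "(LINT r:{0..1}|lborel. Gneum t r r' * cos (?\<omega> * r)) = J"
    using set_borel_integral_eq_integral(2) integral_unique[OF J] by metis
  then show ?thesis unfolding Jeq gauss_cos_integral(2)[OF t] by (simp add: mu_def mult_ac)
qed

section \<open>The explicit solution\<close>

text \<open>The kernel as an ordinary series: jointly measurable in all arguments without
  restriction, and equal to \<open>Gneum\<close> for r and r' in [0,1] and nonnegative t.\<close>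

definition Gser :: "real \<Rightarrow> real \<Rightarrow> real \<Rightarrow> real" where
  "Gser t r r' = (\<Sum>i. gterm t r r' i)"

lemma gauss_measurable [measurable]:
  assumes [measurable]: "f \<in> borel_measurable M" "g \<in> borel_measurable M" "h \<in> borel_measurable M"
  shows "(\<lambda>x. gauss (f x) (g x) (h x)) \<in> borel_measurable M"
  unfolding gauss_def by measurable

lemma Gser_measurable [measurable]:
  assumes [measurable]: "f \<in> borel_measurable M" "g \<in> borel_measurable M" "h \<in> borel_measurable M"
  shows "(\<lambda>x. Gser (f x) (g x) (h x)) \<in> borel_measurable M"
proof -
  have "(\<lambda>x. gterm (f x) (g x) (h x) i) \<in> borel_measurable M" for i
    unfolding gterm_def gpair_def by (cases "i = 0") simp_all
  then show ?thesis unfolding Gser_def by (rule borel_measurable_suminf)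
qed

lemma Gneum_eq_Gser: "0 < t \<Longrightarrow> r \<in> {0..1} \<Longrightarrow> r' \<in> {0..1} \<Longrightarrow> Gneum t r r' = Gser t r r'"
  unfolding Gser_def by (rule Gneum_eq_suminf)

text \<open>At time 0 division by \<open>sqrt 0\<close> yields the default 0, for
  \<open>Gneum\<close> as well, so the two kernels agree up to the endpoint of the time
  integral.\<close>

lemma Gser_0: "Gser 0 r r' = 0"
proof -
  have "gterm 0 r r' i = 0" for i
    unfolding gterm_def gpair_def gauss_def by (cases "i = 0") simp_all
  then have "gterm 0 r r' = (\<lambda>_. 0)" by auto
  then show ?thesis unfolding Gser_def by simp
qed

lemma Gneum_0: "Gneum 0 r r' = 0"
  unfolding Gneum_def gauss_def by simp

lemma Gneum_eq_Gser': "0 \<le> t \<Longrightarrow> r \<in> {0..1} \<Longrightarrow> r' \<in> {0..1} \<Longrightarrow> Gneum t r r' = Gser t r r'"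
  by (cases "t = 0") (auto simp: Gser_0 Gneum_0 intro: Gneum_eq_Gser)

lemma continuous_on_integral_dominated:
  fixes K :: "real \<Rightarrow> real \<Rightarrow> real"
  assumes w: "integrable lborel w"
    and meas: "\<And>r. r \<in> S \<Longrightarrow> K r \<in> borel_measurable lborel"
    and bd: "\<And>r x. r \<in> S \<Longrightarrow> \<bar>K r x\<bar> \<le> w x"
    and cont: "\<And>x. continuous_on S (\<lambda>r. K r x)"
  shows "continuous_on S (\<lambda>r. LINT x|lborel. K r x)"
  unfolding continuous_on_sequentially
proof (intro allI ballI impI)
  fix u a assume a: "a \<in> S" and u: "(\<forall>n. u n \<in> S) \<and> u \<longlonglongrightarrow> a"
  show "((\<lambda>r. LINT x|lborel. K r x) \<circ> u) \<longlonglongrightarrow> (LINT x|lborel. K a x)"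
    unfolding o_def
  proof (rule integral_dominated_convergence[where w = w])
    show "AE x in lborel. (\<lambda>i. K (u i) x) \<longlonglongrightarrow> K a x"
    proof (rule AE_I2)
      fix x
      from cont[of x] a u have "((\<lambda>r. K r x) \<circ> u) \<longlonglongrightarrow> K a x"
        unfolding continuous_on_sequentially by blast
      then show "(\<lambda>i. K (u i) x) \<longlonglongrightarrow> K a x" by (simp add: o_def)
    qed
  qed (use a u meas bd w in auto)
qed

text \<open>A majorant in x alone, uniform over r in [0,1], makes the integrand integrable on the
  product.\<close>

lemma fubini_dominated:
  fixes K :: "real \<Rightarrow> real \<Rightarrow> real"
  assumes w: "integrable lborel w"
    and meas: "(\<lambda>(r, x). K r x) \<in> borel_measurable (lborel \<Otimes>\<^sub>M lborel)"
    and c: "c \<in> borel_measurable lborel" "\<And>r. \<bar>c r\<bar> \<le> 1"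
    and bd: "\<And>r x. r \<in> {0..1} \<Longrightarrow> \<bar>K r x\<bar> \<le> w x"
  shows "(LINT r:{0..1}|lborel. (LINT x|lborel. K r x) * c r) = (LINT x|lborel. (LINT r:{0..1}|lborel. K r x * c r))"
proof -
  let ?H = "\<lambda>r x. indicator {0..1} r * (K r x * c r)"
  note [measurable] = meas c(1)
  have Hm: "(\<lambda>(r, x). ?H r x) \<in> borel_measurable (lborel \<Otimes>\<^sub>M lborel)"
    by measurable
  \<comment> \<open>The majorant is nonnegative because it bounds an absolute value at r =
    0.\<close>
  have w0: "0 \<le> w x" for x using bd[of 0 x] by (meson abs_ge_zero atLeastAtMost_iff order_trans order_refl zero_le_one)
  define I :: "real \<Rightarrow> real \<Rightarrow> real" where "I r x = indicator {0..1} r * w x" for r x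
  have "integrable (lborel \<Otimes>\<^sub>M lborel) (\<lambda>(r, x). I r x)"
  proof (rule lborel_pair.Fubini_integrable)
    show "(\<lambda>(r, x). I r x) \<in> borel_measurable (lborel \<Otimes>\<^sub>M lborel)"
      using borel_measurable_integrable[OF w] unfolding I_def by measurable
    have "(LINT x|lborel. norm (I r x)) = indicator {0..1} r * (LINT x|lborel. \<bar>w x\<bar>)" for r
      by (simp add: abs_mult I_def)
    moreover have "integrable lborel (\<lambda>r::real. indicator {0..1} r * (LINT x|lborel. \<bar>w x\<bar>) :: real)"
      by simp
    ultimately show "integrable lborel (\<lambda>r. LINT x|lborel. norm (case (r, x) of (r, x) \<Rightarrow> I r x))"
      by simp
    show "AE r in lborel. integrable lborel (\<lambda>x. case (r, x) of (r, x) \<Rightarrow> I r x)"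
      using w by (simp add: I_def)
  qed
  then have "integrable (lborel \<Otimes>\<^sub>M lborel) (\<lambda>(r, x). ?H r x)"
  proof (rule Bochner_Integration.integrable_bound[OF _ Hm], intro AE_I2)
    fix z :: "real \<times> real"
    obtain r x where z: "z = (r, x)" by (cases z)
    have "\<bar>K r x * c r\<bar> \<le> w x * 1" if "r \<in> {0..1}"
      unfolding abs_mult using bd[OF that, of x] c(2)[of r] w0[of x] by (intro mult_mono) auto
    then show "norm (case z of (r, x) \<Rightarrow> ?H r x) \<le> norm (case z of (r, x) \<Rightarrow> I r x)"
      unfolding z I_def using w0[of x] by (auto simp: indicator_def)
  qed
  from lborel_pair.Fubini_integral[OF this]
  have "(LINT x|lborel. LINT r|lborel. ?H r x) = (LINT r|lborel. LINT x|lborel. ?H r x)" .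
  moreover have "(LINT x|lborel. ?H r x) = indicator {0..1} r * ((LINT x|lborel. K r x) * c r)" for r
    by simp
  ultimately show ?thesis by (simp add: set_lebesgue_integral_def)
qed

lemma inverse_sqrt_integrable:
  assumes t: "0 \<le> t"
  shows "set_integrable lborel {0..t} (\<lambda>s. 1 / sqrt s)"
proof -
  have "((\<lambda>x. x powr (- 1/2)) has_integral (t powr (- 1/2 + 1) / (- 1/2 + 1))) {0..t}"
    by (rule has_integral_powr_from_0) (use t in auto)
  then have "(\<lambda>x. x powr (- 1/2)) integrable_on {0..t}" by blast
  then have "(\<lambda>x. x powr (- 1/2)) absolutely_integrable_on {0..t}"
    by (rule nonnegative_absolutely_integrable_1) simp
  then have "integrable lebesgue (\<lambda>x. indicator {0..t} x *\<^sub>R x powr (- 1/2))"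
    unfolding set_integrable_def .
  then have "integrable lborel (\<lambda>x. indicator {0..t} x *\<^sub>R x powr (- 1/2))"
    by (subst (asm) integrable_completion) auto
  moreover have "indicator {0..t} x *\<^sub>R x powr (- 1/2) = indicator {0..t} x *\<^sub>R (1 / sqrt x)" for x :: real
    by (cases "x \<in> {0..t}") (auto simp: powr_minus_divide powr_half_sqrt)
  ultimately show ?thesis unfolding set_integrable_def by simp
qed

lemma bounded_density_integrable:
  assumes meas: "set_borel_measurable lborel {0..1} u"
    and bd: "AE r in lborel. r \<in> {0..1} \<longrightarrow> 0 \<le> u r \<and> u r \<le> B"
  shows "set_integrable lborel {0..1} (u :: real \<Rightarrow> real)"
  unfolding set_integrable_def
proof (rule Bochner_Integration.integrable_bound)
  show "integrable lborel (\<lambda>x. indicator {0..1::real} x * \<bar>B\<bar>)" by simp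
  show "(\<lambda>x. indicator {0..1} x *\<^sub>R u x) \<in> borel_measurable lborel"
    using meas unfolding set_borel_measurable_def .
  show "AE x in lborel. norm (indicator {0..1} x *\<^sub>R u x) \<le> norm (indicator {0..1} x * \<bar>B\<bar>)"
    using bd by eventually_elim (auto simp: indicator_def)
qed

section \<open>Continuity and cosine coefficients of the explicit solution\<close>

locale neumann_solution =
  fixes j t :: real and u :: "real \<Rightarrow> real"
  assumes t: "0 < t" and u: "set_integrable lborel {0..1} u"
begin

text \<open>\<open>K1\<close> and \<open>K2\<close> are the integrands of the two parts of the
  formula, extended by 0 to the whole line; \<open>w1\<close> and \<open>w2\<close> dominate them
  uniformly over r in [0,1].\<close>

definition K1 :: "real \<Rightarrow> real \<Rightarrow> real" where
  "K1 r x = Gser t r x * (indicator {0..1} x * u x)"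

definition w1 :: "real \<Rightarrow> real" where
  "w1 x = gconst t / sqrt (2 * pi * t) * \<bar>indicator {0..1} x * u x\<bar>"

definition K2 :: "real \<Rightarrow> real \<Rightarrow> real" where
  "K2 r s = indicator {0..t} s * (Gser s r 0 - Gser s r 1)"

definition w2 :: "real \<Rightarrow> real" where
  "w2 s = gconst t / sqrt (2 * pi) * (indicator {0..t} s * (1 / sqrt s))"

lemma u_int: "integrable lborel (\<lambda>x. indicator {0..1} x * u x)"
  using u unfolding set_integrable_def by simp

lemma w1_int: "integrable lborel w1"
  unfolding w1_def by (intro integrable_mult_right integrable_abs u_int)

lemma w2_int: "integrable lborel w2"
  unfolding w2_def
  using inverse_sqrt_integrable[OF less_imp_le[OF t]] unfolding set_integrable_def
  by (intro integrable_mult_right) simp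

lemma K1_bd: "r \<in> {0..1} \<Longrightarrow> \<bar>K1 r x\<bar> \<le> w1 x"
proof (cases "x \<in> {0..1}")
  case True
  assume r: "r \<in> {0..1}"
  have "\<bar>Gser t r x\<bar> \<le> gconst t / sqrt (2 * pi * t)"
    using Gneum_bounds[OF t order_refl r True] Gneum_eq_Gser[OF t r True] by simp
  then show ?thesis unfolding K1_def w1_def abs_mult by (intro mult_right_mono) auto
qed (simp add: K1_def w1_def)

lemma K2_bd: "r \<in> {0..1} \<Longrightarrow> \<bar>K2 r s\<bar> \<le> w2 s"
proof -
  assume r: "r \<in> {0..1}"
  consider "s \<notin> {0..t}" | "s = 0" | "0 < s" "s \<le> t" by fastforce
  then show ?thesis
  proof cases
    case 3
    have b: "0 \<le> Gser s r c" "Gser s r c \<le> gconst t / sqrt (2 * pi * s)" if "c \<in> {0..1}" for c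
      using Gneum_bounds[OF 3 r that] Gneum_eq_Gser[OF 3(1) r that] by simp_all
    have "\<bar>Gser s r 0 - Gser s r 1\<bar> \<le> gconst t / sqrt (2 * pi * s)"
      using b[of 0] b[of 1] by simp
    then show ?thesis unfolding K2_def w2_def using 3 by (simp add: real_sqrt_mult)
  qed (simp_all add: K2_def w2_def Gser_0)
qed

lemma K1_meas: "(\<lambda>(r, x). K1 r x) \<in> borel_measurable (lborel \<Otimes>\<^sub>M lborel)"
  using u_int[THEN borel_measurable_integrable] unfolding K1_def by measurable

lemma K2_meas: "(\<lambda>(r, x). K2 r x) \<in> borel_measurable (lborel \<Otimes>\<^sub>M lborel)"
  unfolding K2_def by measurable

lemma K1_meas': "K1 r \<in> borel_measurable lborel"
  using u_int[THEN borel_measurable_integrable] unfolding K1_def by measurable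

lemma K2_meas': "K2 r \<in> borel_measurable lborel"
  unfolding K2_def by measurable

lemma conv_eq: "r \<in> {0..1} \<Longrightarrow> Gneum_conv t u r = (LINT x|lborel. K1 r x)"
  unfolding Gneum_conv_def set_lebesgue_integral_def K1_def
  by (intro Bochner_Integration.integral_cong refl) (auto simp: indicator_def Gneum_eq_Gser[OF t])

lemma bdry_eq: "r \<in> {0..1} \<Longrightarrow> (LINT s:{0..t}|lborel. Gneum s r 0 - Gneum s r 1) = (LINT s|lborel. K2 r s)"
  unfolding set_lebesgue_integral_def K2_def
  by (intro Bochner_Integration.integral_cong refl) (auto simp: indicator_def Gneum_eq_Gser')

lemma K1_cont: "continuous_on {0..1} (\<lambda>r. K1 r x)"
proof (cases "x \<in> {0..1}")
  case True
  have "continuous_on {0..1} (\<lambda>r. Gneum t r x * (indicator {0..1} x * u x))"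
    by (intro continuous_intros continuous_on_Gneum t True)
  then show ?thesis
    by (rule continuous_on_cong[THEN iffD1, rotated 2]) (auto simp: K1_def Gneum_eq_Gser[OF t _ True])
qed (simp add: K1_def)

lemma K2_cont: "continuous_on {0..1} (\<lambda>r. K2 r s)"
proof -
  consider "s \<notin> {0..t}" | "s = 0" | "0 < s" "s \<le> t" by fastforce
  then show ?thesis
  proof cases
    case 3
    have "continuous_on {0..1} (\<lambda>r. indicator {0..t} s * (Gneum s r 0 - Gneum s r 1))"
      by (intro continuous_intros continuous_on_Gneum 3) auto
    then show ?thesis
      by (rule continuous_on_cong[THEN iffD1, rotated 2]) (auto simp: K2_def Gneum_eq_Gser[OF 3(1)])
  qed (simp_all add: K2_def Gser_0)
qed

definition sol :: "real \<Rightarrow> real" where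
  "sol r = Gneum_conv t u r + j * (LINT s:{0..t}|lborel. Gneum s r 0 - Gneum s r 1)"

lemma conv_cont: "continuous_on {0..1} (Gneum_conv t u)"
  by (rule continuous_on_cong[THEN iffD1, OF refl _
      continuous_on_integral_dominated[OF w1_int K1_meas' K1_bd K1_cont]]) (simp_all add: conv_eq)

lemma bdry_cont: "continuous_on {0..1} (\<lambda>r. LINT s:{0..t}|lborel. Gneum s r 0 - Gneum s r 1)"
  by (rule continuous_on_cong[THEN iffD1, OF refl _
      continuous_on_integral_dominated[OF w2_int K2_meas' K2_bd K2_cont]]) (simp_all add: bdry_eq)

lemma sol_cont: "continuous_on {0..1} sol"
  unfolding sol_def by (intro continuous_intros conv_cont bdry_cont)

text \<open>Integrating in r first replaces the kernel by exp (- mu_k t) cos (k pi x), so the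
  convolution acts diagonally on cosine coefficients.\<close>

lemma conv_cos: "(LINT r:{0..1}|lborel. Gneum_conv t u r * cos (real k * pi * r))
   = exp (- mu k * t) * (LINT x:{0..1}|lborel. u x * cos (real k * pi * x))"
proof -
  let ?c = "\<lambda>r. cos (real k * pi * r)"
  have "(LINT r:{0..1}|lborel. Gneum_conv t u r * ?c r) = (LINT r:{0..1}|lborel. (LINT x|lborel. K1 r x) * ?c r)"
    by (rule set_lebesgue_integral_cong) (auto simp: conv_eq)
  also have "\<dots> = (LINT x|lborel. (LINT r:{0..1}|lborel. K1 r x * ?c r))"
    by (rule fubini_dominated[OF w1_int K1_meas _ _ K1_bd]) auto
  also have "\<dots> = (LINT x|lborel. exp (- mu k * t) * (indicator {0..1} x * (u x * ?c x)))"
  proof (rule Bochner_Integration.integral_cong[OF refl])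
    fix x
    show "(LINT r:{0..1}|lborel. K1 r x * ?c r) = exp (- mu k * t) * (indicator {0..1} x * (u x * ?c x))"
    proof (cases "x \<in> {0..1}")
      case True
      have "(LINT r:{0..1}|lborel. K1 r x * ?c r) = (LINT r:{0..1}|lborel. u x * (Gneum t r x * ?c r))"
        by (rule set_lebesgue_integral_cong) (use True in \<open>auto simp: K1_def Gneum_eq_Gser[OF t]\<close>)
      also have "\<dots> = u x * (exp (- mu k * t) * ?c x)"
        by (simp only: set_integral_mult_right Gneum_cos_integral[OF t True])
      finally show ?thesis using True by simp
    qed (simp add: K1_def)
  qed
  finally show ?thesis by (simp add: set_lebesgue_integral_def)
qed

lemma bdry_cos: "(LINT r:{0..1}|lborel. (LINT s:{0..t}|lborel. Gneum s r 0 - Gneum s r 1) * cos (real k * pi * r))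
   = (LINT s:{0..t}|lborel. exp (- mu k * s) * (1 - cos (real k * pi)))"
proof -
  let ?c = "\<lambda>r. cos (real k * pi * r)"
  have "(LINT r:{0..1}|lborel. (LINT s:{0..t}|lborel. Gneum s r 0 - Gneum s r 1) * ?c r)
     = (LINT r:{0..1}|lborel. (LINT x|lborel. K2 r x) * ?c r)"
    by (rule set_lebesgue_integral_cong) (auto simp: bdry_eq)
  also have "\<dots> = (LINT x|lborel. (LINT r:{0..1}|lborel. K2 r x * ?c r))"
    by (rule fubini_dominated[OF w2_int K2_meas _ _ K2_bd]) auto
  also have "\<dots> = (LINT s|lborel. indicator {0..t} s * (exp (- mu k * s) * (1 - cos (real k * pi))))"
  proof (rule integral_cong_AE)
    \<comment> \<open>At s = 0 the kernel has its default value 0 and the cosine formula fails, so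
      equality is claimed only off a null set.\<close>
    show "AE s in lborel. (LINT r:{0..1}|lborel. K2 r s * ?c r) = indicator {0..t} s * (exp (- mu k * s) * (1 - cos (real k * pi)))"
      using AE_lborel_singleton[of 0]
    proof eventually_elim
      fix s :: real assume s0: "s \<noteq> 0"
      show "(LINT r:{0..1}|lborel. K2 r s * ?c r) = indicator {0..t} s * (exp (- mu k * s) * (1 - cos (real k * pi)))"
      proof (cases "s \<in> {0..t}")
        case True
        then have s: "0 < s" using s0 by auto
        have int: "set_integrable lborel {0..1} (\<lambda>r. Gneum s r c * ?c r)" if "c \<in> {0..1}" for c
          by (intro set_integrable_cont_mult continuous_on_Gneum s that continuous_intros)
        have "(LINT r:{0..1}|lborel. K2 r s * ?c r) = (LINT r:{0..1}|lborel. Gneum s r 0 * ?c r - Gneum s r 1 * ?c r)"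
          by (rule set_lebesgue_integral_cong) (use True in \<open>auto simp: K2_def Gneum_eq_Gser[OF s] left_diff_distrib\<close>)
        also have "\<dots> = (LINT r:{0..1}|lborel. Gneum s r 0 * ?c r) - (LINT r:{0..1}|lborel. Gneum s r 1 * ?c r)"
          by (rule set_integral_diff(2)) (auto intro: int)
        also have "\<dots> = exp (- mu k * s) * cos (real k * pi * 0) - exp (- mu k * s) * cos (real k * pi * 1)"
          by (subst (1 2) Gneum_cos_integral[OF s]) auto
        finally show ?thesis using True by (simp add: right_diff_distrib)
      qed (simp add: K2_def)
    qed
    have "(\<lambda>s. LINT r|lborel. indicator {0..1} r *\<^sub>R (K2 r s * ?c r)) \<in> borel_measurable lborel"
      by (rule lborel.borel_measurable_lebesgue_integral) (unfold K2_def, measurable)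
    then show "(\<lambda>s. LINT r:{0..1}|lborel. K2 r s * ?c r) \<in> borel_measurable lborel"
      unfolding set_lebesgue_integral_def .
  qed measurable
  finally show ?thesis unfolding set_lebesgue_integral_def by (simp only: real_scaleR_def)
qed

lemma sol_cos: "(LINT r:{0..1}|lborel. sol r * cos (real k * pi * r))
   = exp (- mu k * t) * (LINT x:{0..1}|lborel. u x * cos (real k * pi * x))
     + j * (LINT s:{0..t}|lborel. exp (- mu k * s) * (1 - cos (real k * pi)))"
proof -
  let ?c = "\<lambda>r. cos (real k * pi * r)"
  let ?b = "\<lambda>r. LINT s:{0..t}|lborel. Gneum s r 0 - Gneum s r 1"
  have cc: "continuous_on {0..1} ?c" by (intro continuous_intros)
  have "(LINT r:{0..1}|lborel. sol r * ?c r) = (LINT r:{0..1}|lborel. Gneum_conv t u r * ?c r + j * (?b r * ?c r))"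
    unfolding sol_def by (simp only: distrib_right mult.assoc)
  also have "\<dots> = (LINT r:{0..1}|lborel. Gneum_conv t u r * ?c r) + (LINT r:{0..1}|lborel. j * (?b r * ?c r))"
    by (rule set_integral_add(2)) (intro set_integrable_mult_right set_integrable_cont_mult conv_cont bdry_cont cc)+
  finally show ?thesis by (simp only: set_integral_mult_right conv_cos bdry_cos)
qed

end

section \<open>From configurations to densities\<close>

definition gridf :: "nat \<Rightarrow> (real \<Rightarrow> real) \<Rightarrow> nat \<Rightarrow> real" where
  "gridf n \<phi> x = \<phi> ((real x + 1/2) / (real n + 1))"

lemma cosg_eq_gridf: "cosg n k = gridf n (\<lambda>r. cos (real k * pi * r))"
  unfolding cosg_def gridf_def ..

lemma cos_lipschitz: "\<bar>cos a - cos b\<bar> \<le> \<bar>a - b :: real\<bar>"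
proof -
  have "\<bar>cos a - cos b\<bar> = 2 * (\<bar>sin ((a + b) / 2)\<bar> * \<bar>sin ((b - a) / 2)\<bar>)"
    unfolding cos_diff_cos by (simp add: abs_mult)
  also have "\<dots> \<le> 2 * (1 * \<bar>(b - a) / 2\<bar>)"
    by (intro mult_left_mono mult_mono abs_sin_x_le_abs_x) auto
  finally show ?thesis by simp
qed

lemma cospoly_bounds:
  assumes "cospoly m \<phi>"
  obtains K L where "0 \<le> K" "0 \<le> L" "\<And>x. \<bar>\<phi> x\<bar> \<le> K" "\<And>x y. \<bar>\<phi> x - \<phi> y\<bar> \<le> L * \<bar>x - y\<bar>"
proof -
  obtain a where a: "\<And>r. \<phi> r = (\<Sum>k\<le>m. a k * cos (real k * pi * r))"
    using assms unfolding cospoly_def by blast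
  show ?thesis
  proof (rule that)
    show "0 \<le> (\<Sum>k\<le>m. \<bar>a k\<bar>)" "0 \<le> (\<Sum>k\<le>m. \<bar>a k\<bar> * (real k * pi))" by (auto intro!: sum_nonneg)
    show "\<bar>\<phi> x\<bar> \<le> (\<Sum>k\<le>m. \<bar>a k\<bar>)" for x
      unfolding a by (rule order_trans[OF sum_abs sum_mono]) (simp add: abs_mult mult_left_le)
    show "\<bar>\<phi> x - \<phi> y\<bar> \<le> (\<Sum>k\<le>m. \<bar>a k\<bar> * (real k * pi)) * \<bar>x - y\<bar>" for x y
    proof -
      have "\<phi> x - \<phi> y = (\<Sum>k\<le>m. a k * (cos (real k * pi * x) - cos (real k * pi * y)))"
        unfolding a by (simp only: right_diff_distrib sum_subtractf)
      also have "\<bar>\<dots>\<bar> \<le> (\<Sum>k\<le>m. \<bar>a k\<bar> * (real k * pi) * \<bar>x - y\<bar>)"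
      proof (rule order_trans[OF sum_abs sum_mono])
        fix k
        have "\<bar>cos (real k * pi * x) - cos (real k * pi * y)\<bar> \<le> \<bar>real k * pi * x - real k * pi * y\<bar>"
          by (rule cos_lipschitz)
        also have "\<dots> = real k * pi * \<bar>x - y\<bar>"
          by (simp add: right_diff_distrib[symmetric] abs_mult)
        finally show "\<bar>a k * (cos (real k * pi * x) - cos (real k * pi * y))\<bar> \<le> \<bar>a k\<bar> * (real k * pi) * \<bar>x - y\<bar>"
          unfolding abs_mult mult.assoc by (intro mult_left_mono) (auto simp: mult.assoc)
      qed
      finally show ?thesis by (simp only: sum_distrib_right)
    qed
  qed
qed

lemma cospoly_measurable:
  assumes "cospoly m \<phi>"
  shows "\<phi> \<in> borel_measurable borel"
proof -
  obtain a where "\<And>r. \<phi> r = (\<Sum>k\<le>m. a k * cos (real k * pi * r))" using assms unfolding cospoly_def by blast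
  then have "\<phi> = (\<lambda>r. \<Sum>k\<le>m. a k * cos (real k * pi * r))" by auto
  then show ?thesis by (simp only:) measurable
qed

lemma abel_summation:
  fixes a F :: "nat \<Rightarrow> real"
  shows "(\<Sum>x\<le>n. a x * (F x - F (Suc x))) = a 0 * F 0 + (\<Sum>x<n. (a (Suc x) - a x) * F (Suc x)) - a n * F (Suc n)"
  by (induction n) (simp_all add: algebra_simps)

lemma lin_abel:
  "lin n a \<eta> = (\<Sum>x\<le>n. a x * (Feps n x \<eta> - Feps n (Suc x) \<eta>))"
proof -
  have "Feps n x \<eta> - Feps n (Suc x) \<eta> = real (\<eta> x)" if "x \<le> n" for x
    using that unfolding Feps_def by (simp add: sum.atLeast_Suc_atMost)
  then show ?thesis unfolding lin_def by (intro sum.cong) auto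
qed

lemma Feps_beyond: "Feps n (Suc n) \<eta> = 0"
  unfolding Feps_def by simp

lemma Fmac_beyond: "1 < r \<Longrightarrow> Fmac r u = 0"
  unfolding Fmac_def by (simp add: set_lebesgue_integral_def)

text \<open>Summation by parts moves the difference onto the test function. Its n increments are at
  most L / (n + 1) each, so uniformly close tail functions give close sums, with a constant free of
  n.\<close>

lemma abel_close:
  fixes a F H :: "nat \<Rightarrow> real"
  assumes cl: "\<And>x. x \<le> n \<Longrightarrow> \<bar>F x - H x\<bar> \<le> \<zeta>" and z: "F (Suc n) = 0" "H (Suc n) = 0"
    and K: "\<bar>a 0\<bar> \<le> K" and L: "\<And>x. x < n \<Longrightarrow> \<bar>a (Suc x) - a x\<bar> \<le> L / (real n + 1)" and L0: "0 \<le> L"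
  shows "\<bar>(\<Sum>x\<le>n. a x * (F x - F (Suc x))) - (\<Sum>x\<le>n. a x * (H x - H (Suc x)))\<bar> \<le> (K + L) * \<zeta>"
proof -
  have \<zeta>: "0 \<le> \<zeta>" using cl[of 0] by simp
  have "(\<Sum>x\<le>n. a x * (F x - F (Suc x))) - (\<Sum>x\<le>n. a x * (H x - H (Suc x)))
     = a 0 * (F 0 - H 0) + (\<Sum>x<n. (a (Suc x) - a x) * (F (Suc x) - H (Suc x)))"
    unfolding abel_summation z by (simp add: right_diff_distrib sum_subtractf)
  also have "\<bar>\<dots>\<bar> \<le> \<bar>a 0 * (F 0 - H 0)\<bar> + \<bar>\<Sum>x<n. (a (Suc x) - a x) * (F (Suc x) - H (Suc x))\<bar>"
    by (rule abs_triangle_ineq)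
  also have "\<bar>a 0 * (F 0 - H 0)\<bar> \<le> K * \<zeta>"
    unfolding abs_mult using K cl[of 0] by (intro mult_mono) auto
  also have "\<bar>\<Sum>x<n. (a (Suc x) - a x) * (F (Suc x) - H (Suc x))\<bar> \<le> (\<Sum>x<n. L / (real n + 1) * \<zeta>)"
  proof (rule order_trans[OF sum_abs sum_mono])
    fix x assume "x \<in> {..<n}"
    then show "\<bar>(a (Suc x) - a x) * (F (Suc x) - H (Suc x))\<bar> \<le> L / (real n + 1) * \<zeta>"
      unfolding abs_mult using L[of x] cl[of "Suc x"] L0 by (intro mult_mono) auto
  qed
  also have "(\<Sum>x<n. L / (real n + 1) * \<zeta>) = (real n / (real n + 1)) * (L * \<zeta>)" by simp
  also have "\<dots> \<le> 1 * (L * \<zeta>)"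
    using L0 \<zeta> by (intro mult_right_mono mult_nonneg_nonneg) auto
  finally show ?thesis by (simp add: distrib_right)
qed

lemma gridf_step:
  assumes L: "\<And>x y. \<bar>\<phi> x - \<phi> y\<bar> \<le> L * \<bar>x - y\<bar>"
  shows "\<bar>gridf n \<phi> (Suc x) - gridf n \<phi> x\<bar> \<le> L / (real n + 1)"
proof -
  have "\<bar>gridf n \<phi> (Suc x) - gridf n \<phi> x\<bar> \<le> L * \<bar>(real (Suc x) + 1/2) / (real n + 1) - (real x + 1/2) / (real n + 1)\<bar>"
    unfolding gridf_def by (rule L)
  also have "(real (Suc x) + 1/2) / (real n + 1) - (real x + 1/2) / (real n + 1) = 1 / (real n + 1)"
    by (simp add: diff_divide_distrib[symmetric])
  finally show ?thesis by simp
qed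

text \<open>Half-open cells put each point of [0,1] into exactly one cell. The cell with x = n meets
  [0,1] only in the point 1.\<close>

lemma Fmac_diff:
  assumes n: "1 \<le> n" and u: "set_integrable lborel {0..1} u"
  shows "Fmac (real x / real n) u - Fmac (real (Suc x) / real n) u
    = (LINT s|lborel. indicator {real x / real n..<real (Suc x) / real n} s * (indicator {0..1} s * u s))"
proof -
  have ui: "integrable lborel (\<lambda>s. indicator {0..1} s * u s)" using u unfolding set_integrable_def by simp
  have F: "Fmac r u = (LINT s|lborel. indicator {r..} s * (indicator {0..1} s * u s))"
    and Fi: "integrable lborel (\<lambda>s. indicator {r..} s * (indicator {0..1} s * u s))" if "0 \<le> r" for r
  proof -
    show "Fmac r u = (LINT s|lborel. indicator {r..} s * (indicator {0..1} s * u s))"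
      unfolding Fmac_def set_lebesgue_integral_def
      by (rule Bochner_Integration.integral_cong) (use that in \<open>auto simp: indicator_def\<close>)
    show "integrable lborel (\<lambda>s. indicator {r..} s * (indicator {0..1} s * u s))"
      using integrable_mult_indicator[OF _ ui, of "{r..}"] by simp
  qed
  have le: "real x / real n \<le> real (Suc x) / real n" by (intro divide_right_mono) auto
  have "Fmac (real x / real n) u - Fmac (real (Suc x) / real n) u
    = (LINT s|lborel. indicator {real x / real n..} s * (indicator {0..1} s * u s)
        - indicator {real (Suc x) / real n..} s * (indicator {0..1} s * u s))"
    by (subst Bochner_Integration.integral_diff[OF Fi Fi]) (simp_all add: F)
  also have "\<dots> = (LINT s|lborel. indicator {real x / real n..<real (Suc x) / real n} s * (indicator {0..1} s * u s))"
    by (rule Bochner_Integration.integral_cong) (use le in \<open>auto simp: indicator_def\<close>)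
  finally show ?thesis .
qed

text \<open>Tail functions are sampled at x / n but test functions at (x + 1/2) / (n + 1). For a
  point s of cell x the latter differs from s by at most 2 / n, so the Lipschitz constant controls
  the mismatch.\<close>

lemma riemann_close:
  assumes n: "1 \<le> n" and u: "set_integrable lborel {0..1} u"
    and K: "\<And>x. \<bar>\<phi> x\<bar> \<le> K" and L: "\<And>x y. \<bar>\<phi> x - \<phi> y\<bar> \<le> L * \<bar>x - y\<bar>" and L0: "0 \<le> L"
    and \<phi>: "\<phi> \<in> borel_measurable borel"
  shows "\<bar>(\<Sum>x\<le>n. gridf n \<phi> x * (Fmac (real x / real n) u - Fmac (real (Suc x) / real n) u))
     - (LINT s:{0..1}|lborel. u s * \<phi> s)\<bar> \<le> 2 * L / real n * (LINT s:{0..1}|lborel. \<bar>u s\<bar>)"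
proof -
  let ?U = "\<lambda>s. indicator {0..1} s * u s"
  let ?A = "\<lambda>x. {real x / real n..<real (Suc x) / real n}"
  let ?\<psi> = "\<lambda>s. \<Sum>x\<le>n. gridf n \<phi> x * indicator (?A x) s"
  have n0: "0 < real n" using n by simp
  have ui: "integrable lborel ?U" using u unfolding set_integrable_def by simp
  have Ai: "integrable lborel (\<lambda>s. indicator (?A x) s * ?U s)" for x
    using integrable_mult_indicator[OF _ ui, of "?A x"] by simp
  have \<phi>i: "integrable lborel (\<lambda>s. ?U s * \<phi> s)"
  proof (rule Bochner_Integration.integrable_bound)
    show "integrable lborel (\<lambda>s. K * ?U s)" using ui by simp
    show "(\<lambda>s. ?U s * \<phi> s) \<in> borel_measurable lborel"
      using borel_measurable_integrable[OF ui] \<phi> by measurable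
    have "0 \<le> K" using K[of 0] by linarith
    then show "AE s in lborel. norm (?U s * \<phi> s) \<le> norm (K * ?U s)"
      using K by (intro AE_I2) (auto simp: abs_mult mult.commute intro!: mult_mono)
  qed
  have \<psi>i: "integrable lborel (\<lambda>s. \<Sum>x\<le>n. gridf n \<phi> x * (indicator (?A x) s * ?U s))"
    using Ai by simp
  have pt: "\<bar>(\<Sum>x\<le>n. gridf n \<phi> x * (indicator (?A x) s * ?U s)) - ?U s * \<phi> s\<bar> \<le> 2 * L / real n * \<bar>?U s\<bar>" for s
  proof (cases "s \<in> {0..1}")
    case True
    \<comment> \<open>The index of the one cell containing s.\<close>
    define x0 where "x0 = nat \<lfloor>real n * s\<rfloor>"
    have x0: "real x0 \<le> real n * s" "real n * s < real x0 + 1"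
      unfolding x0_def using True n0 by (auto simp: floor_correct)
    have "real x0 \<le> real n * 1" using x0(1) True n0 by (meson atLeastAtMost_iff less_imp_le mult_left_mono order_trans)
    then have x0n: "x0 \<le> n" by simp
    have iff: "s \<in> ?A x \<longleftrightarrow> x = x0" for x
    proof -
      have "s \<in> ?A x \<longleftrightarrow> real x \<le> real n * s \<and> real n * s < real x + 1"
        using n0 by (simp add: field_simps)
      also have "\<dots> \<longleftrightarrow> x = x0"
      proof
        assume "real x \<le> real n * s \<and> real n * s < real x + 1"
        then have "real x < real x0 + 1" "real x0 < real x + 1" using x0 by linarith+
        then show "x = x0" by linarith
      qed (use x0 in auto)
      finally show ?thesis .
    qed
    have "(\<Sum>x\<le>n. gridf n \<phi> x * (indicator (?A x) s * ?U s)) = (\<Sum>x\<in>{x0}. gridf n \<phi> x * (indicator (?A x) s * ?U s))"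
      by (rule sum.mono_neutral_right) (use x0n iff in \<open>auto simp: indicator_def\<close>)
    also have "\<dots> = gridf n \<phi> x0 * ?U s" using iff[of x0] by simp
    finally have "(\<Sum>x\<le>n. gridf n \<phi> x * (indicator (?A x) s * ?U s)) - ?U s * \<phi> s = (gridf n \<phi> x0 - \<phi> s) * ?U s"
      by (simp add: left_diff_distrib)
    moreover have "\<bar>gridf n \<phi> x0 - \<phi> s\<bar> \<le> 2 * L / real n"
    proof -
      have "\<bar>(real x0 + 1/2) / (real n + 1) - s\<bar> = \<bar>real x0 + 1/2 - s * (real n + 1)\<bar> / (real n + 1)"
      proof -
        have "(real x0 + 1/2) / (real n + 1) - s = (real x0 + 1/2 - s * (real n + 1)) / (real n + 1)"
          using n0 by (simp add: diff_divide_distrib)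
        then show ?thesis using n0 by simp
      qed
      also have "\<dots> \<le> 2 / real n"
      proof (rule frac_le)
        have "s * (real n + 1) = real n * s + s" by (simp add: algebra_simps)
        then show "\<bar>real x0 + 1/2 - s * (real n + 1)\<bar> \<le> 2" using x0 True by auto
      qed (use n0 in auto)
      finally have "L * \<bar>(real x0 + 1/2) / (real n + 1) - s\<bar> \<le> L * (2 / real n)" using L0 by (rule mult_left_mono)
      moreover have "L * (2 / real n) = 2 * L / real n" by simp
      ultimately show ?thesis unfolding gridf_def using L[of "(real x0 + 1/2) / (real n + 1)" s] by linarith
    qed
    ultimately show ?thesis by (simp only: abs_mult) (rule mult_right_mono, auto)
  qed simp
  have "(\<Sum>x\<le>n. gridf n \<phi> x * (Fmac (real x / real n) u - Fmac (real (Suc x) / real n) u))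
     = (LINT s|lborel. (\<Sum>x\<le>n. gridf n \<phi> x * (indicator (?A x) s * ?U s)))"
    unfolding Fmac_diff[OF n u] using Ai by (subst Bochner_Integration.integral_sum) auto
  moreover have "(LINT s:{0..1}|lborel. u s * \<phi> s) = (LINT s|lborel. ?U s * \<phi> s)"
    by (simp add: set_lebesgue_integral_def mult.assoc)
  ultimately have eq: "(\<Sum>x\<le>n. gridf n \<phi> x * (Fmac (real x / real n) u - Fmac (real (Suc x) / real n) u)) - (LINT s:{0..1}|lborel. u s * \<phi> s)
     = (LINT s|lborel. (\<Sum>x\<le>n. gridf n \<phi> x * (indicator (?A x) s * ?U s)) - ?U s * \<phi> s)"
    by (simp only: Bochner_Integration.integral_diff[OF \<psi>i \<phi>i])
  have le: "\<bar>LINT s|lborel. (\<Sum>x\<le>n. gridf n \<phi> x * (indicator (?A x) s * ?U s)) - ?U s * \<phi> s\<bar>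
      \<le> (LINT s|lborel. 2 * L / real n * \<bar>?U s\<bar>)"
  proof -
    have "norm (LINT s|lborel. (\<Sum>x\<le>n. gridf n \<phi> x * (indicator (?A x) s * ?U s)) - ?U s * \<phi> s) \<le> (LINT s|lborel. 2 * L / real n * \<bar>?U s\<bar>)"
    proof (rule Bochner_Integration.integral_norm_bound_integral)
      show "integrable lborel (\<lambda>s. (\<Sum>x\<le>n. gridf n \<phi> x * (indicator (?A x) s * ?U s)) - ?U s * \<phi> s)"
        by (rule Bochner_Integration.integrable_diff[OF \<psi>i \<phi>i])
      show "integrable lborel (\<lambda>s. 2 * L / real n * \<bar>?U s\<bar>)" using ui by simp
    qed (use pt in auto)
    then show ?thesis by simp
  qed
  have c1: "(LINT s|lborel. 2 * L / real n * \<bar>?U s\<bar>) = 2 * L / real n * (LINT s|lborel. \<bar>?U s\<bar>)"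
    by (rule integral_mult_right_zero)
  have c2: "(LINT s|lborel. \<bar>?U s\<bar>) = (LINT s:{0..1}|lborel. \<bar>u s\<bar>)"
    unfolding set_lebesgue_integral_def
    by (rule Bochner_Integration.integral_cong) (auto simp: indicator_def)
  show ?thesis unfolding eq using le unfolding c1 c2 .
qed

lemma lin_close:
  assumes n: "1 \<le> n" and u: "set_integrable lborel {0..1} u"
    and K: "\<And>x. \<bar>\<phi> x\<bar> \<le> K" and L: "\<And>x y. \<bar>\<phi> x - \<phi> y\<bar> \<le> L * \<bar>x - y\<bar>" and L0: "0 \<le> L"
    and \<phi>: "\<phi> \<in> borel_measurable borel"
    and cl: "\<And>x. x \<le> n \<Longrightarrow> \<bar>(1 / real n) * Feps n x \<eta> - Fmac (real x / real n) u\<bar> \<le> \<zeta>"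
  shows "\<bar>lin n (gridf n \<phi>) \<eta> / real n - (LINT s:{0..1}|lborel. u s * \<phi> s)\<bar>
     \<le> (K + L) * \<zeta> + 2 * L / real n * (LINT s:{0..1}|lborel. \<bar>u s\<bar>)"
proof -
  let ?a = "gridf n \<phi>"
  have n0: "0 < real n" using n by simp
  have 1: "lin n ?a \<eta> / real n = (\<Sum>x\<le>n. ?a x * ((1 / real n) * Feps n x \<eta> - (1 / real n) * Feps n (Suc x) \<eta>))"
    unfolding lin_abel sum_divide_distrib by (rule sum.cong) (auto simp: diff_divide_distrib right_diff_distrib)
  have "\<bar>(\<Sum>x\<le>n. ?a x * ((1 / real n) * Feps n x \<eta> - (1 / real n) * Feps n (Suc x) \<eta>))
      - (\<Sum>x\<le>n. ?a x * (Fmac (real x / real n) u - Fmac (real (Suc x) / real n) u))\<bar> \<le> (K + L) * \<zeta>"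
  proof (rule abel_close[where F = "\<lambda>x. (1 / real n) * Feps n x \<eta>" and H = "\<lambda>x. Fmac (real x / real n) u"])
    show "Fmac (real (Suc n) / real n) u = 0" by (rule Fmac_beyond) (use n0 in simp)
    show "\<bar>?a 0\<bar> \<le> K" unfolding gridf_def by (rule K)
  qed (use cl L0 in \<open>auto simp: Feps_beyond intro: gridf_step[OF L]\<close>)
  with riemann_close[OF n u K L L0 \<phi>] show ?thesis unfolding 1 by linarith
qed

lemma Fmac_one: "0 \<le> r \<Longrightarrow> r \<le> 1 \<Longrightarrow> Fmac r (\<lambda>_. 1) = 1 - r"
  unfolding Fmac_def by (simp add: set_lebesgue_integral_def)

text \<open>By summation by parts, the integral against a nonnegative increasing function is
  monotone in the tail function. The constant density \<alpha> has tail \<alpha> (1 - r), and its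
  integral against \<open>q m\<close> is \<alpha>. The comparison is made on the grid of mesh 1 / n,
  and n then tends to infinity.\<close>

lemma integral_q_lower_bound:
  assumes u: "set_integrable lborel {0..1} u" and F: "\<forall>r\<in>{0..1}. Fmac r u \<ge> \<alpha> * (1 - r)"
  shows "\<alpha> \<le> (LINT r:{0..1}|lborel. u r * q m r)"
proof -
  obtain K L where K: "0 \<le> K" "\<And>x. \<bar>q m x\<bar> \<le> K" and L: "0 \<le> L" "\<And>x y. \<bar>q m x - q m y\<bar> \<le> L * \<bar>x - y\<bar>"
    using cospoly_bounds[OF cospoly_q] by metis
  have qm: "q m \<in> borel_measurable borel"
    by (rule borel_measurable_continuous_onI) (rule continuous_on_q)
  have one: "set_integrable lborel {0..1::real} (\<lambda>_. 1 :: real)"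
    by (rule borel_integrable_atLeastAtMost'[OF continuous_on_const])
  have onei: "(LINT s:{0..1::real}|lborel. \<bar>1 :: real\<bar>) = 1" by (simp add: set_lebesgue_integral_def)
  let ?I = "LINT s:{0..1}|lborel. \<bar>u s\<bar>"
  have main: "\<alpha> - 2 * L / real n * (?I + \<bar>\<alpha>\<bar>) \<le> (LINT r:{0..1}|lborel. u r * q m r)" if n: "1 \<le> n" for n
  proof -
    let ?a = "gridf n (q m)"
    \<comment> \<open>Excess of the given tail over that of the constant density, nonnegative at the
      grid points by hypothesis.\<close>
    let ?D = "\<lambda>x. Fmac (real x / real n) u - \<alpha> * Fmac (real x / real n) (\<lambda>_. 1)"
    have n0: "0 < real n" using n by simp
    have D0: "0 \<le> ?D x" if "x \<le> n" for x
    proof -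
      have "real x / real n \<in> {0..1}" using that n0 by simp
      then show ?thesis using F by (simp add: Fmac_one)
    qed
    have Dn: "?D (Suc n) = 0" using n0 by (simp add: Fmac_beyond)
    have amono: "?a x \<le> ?a (Suc x)" if "x < n" for x
    proof -
      have "(real x + 1/2) / (real n + 1) \<le> (real (Suc x) + 1/2) / (real n + 1)" by (intro divide_right_mono) auto
      moreover have "(real (Suc x) + 1/2) / (real n + 1) \<le> 1" using that by simp
      ultimately show ?thesis unfolding gridf_def by (intro q_mono) auto
    qed
    have "0 \<le> ?a 0 * ?D 0 + (\<Sum>x<n. (?a (Suc x) - ?a x) * ?D (Suc x))"
    proof (intro add_nonneg_nonneg sum_nonneg mult_nonneg_nonneg)
      show "0 \<le> ?a 0" unfolding gridf_def by (rule q_nonneg)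
      show "0 \<le> ?D 0" by (rule D0) simp
      show "0 \<le> ?a (Suc x) - ?a x" "0 \<le> ?D (Suc x)" if "x \<in> {..<n}" for x
        using amono[of x] D0[of "Suc x"] that by auto
    qed
    then have "0 \<le> (\<Sum>x\<le>n. ?a x * (?D x - ?D (Suc x)))"
      unfolding abel_summation[of ?a ?D n] Dn by simp
    also have "\<dots> = (\<Sum>x\<le>n. ?a x * (Fmac (real x / real n) u - Fmac (real (Suc x) / real n) u))
        - \<alpha> * (\<Sum>x\<le>n. ?a x * (Fmac (real x / real n) (\<lambda>_. 1) - Fmac (real (Suc x) / real n) (\<lambda>_. 1)))"
      unfolding sum_distrib_left sum_subtractf[symmetric]
      by (rule sum.cong) (auto simp: algebra_simps)
    finally have 1: "\<alpha> * (\<Sum>x\<le>n. ?a x * (Fmac (real x / real n) (\<lambda>_. 1) - Fmac (real (Suc x) / real n) (\<lambda>_. 1)))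
      \<le> (\<Sum>x\<le>n. ?a x * (Fmac (real x / real n) u - Fmac (real (Suc x) / real n) u))" by simp
    have 2: "\<bar>(\<Sum>x\<le>n. ?a x * (Fmac (real x / real n) u - Fmac (real (Suc x) / real n) u))
       - (LINT r:{0..1}|lborel. u r * q m r)\<bar> \<le> 2 * L / real n * ?I"
      by (rule riemann_close[OF n u K(2) L(2,1) qm])
    have "\<bar>(\<Sum>x\<le>n. ?a x * (Fmac (real x / real n) (\<lambda>_. 1) - Fmac (real (Suc x) / real n) (\<lambda>_. 1)))
       - (LINT r:{0..1}|lborel. 1 * q m r)\<bar> \<le> 2 * L / real n * (LINT s:{0..1::real}|lborel. \<bar>1 :: real\<bar>)"
      by (rule riemann_close[OF n one K(2) L(2,1) qm])
    then have "\<bar>(\<Sum>x\<le>n. ?a x * (Fmac (real x / real n) (\<lambda>_. 1) - Fmac (real (Suc x) / real n) (\<lambda>_. 1))) - 1\<bar> \<le> 2 * L / real n"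
      unfolding onei mult_1 integral_q by simp
    then have "\<bar>\<alpha>\<bar> * \<bar>(\<Sum>x\<le>n. ?a x * (Fmac (real x / real n) (\<lambda>_. 1) - Fmac (real (Suc x) / real n) (\<lambda>_. 1))) - 1\<bar> \<le> \<bar>\<alpha>\<bar> * (2 * L / real n)"
      by (intro mult_left_mono) auto
    then have "\<alpha> - \<bar>\<alpha>\<bar> * (2 * L / real n) \<le> \<alpha> * (\<Sum>x\<le>n. ?a x * (Fmac (real x / real n) (\<lambda>_. 1) - Fmac (real (Suc x) / real n) (\<lambda>_. 1)))"
      unfolding abs_mult[symmetric] right_diff_distrib mult_1_right by linarith
    moreover have "2 * L / real n * (?I + \<bar>\<alpha>\<bar>) = 2 * L / real n * ?I + \<bar>\<alpha>\<bar> * (2 * L / real n)"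
      by (simp only: distrib_left mult.commute)
    ultimately show ?thesis using 1 2 by linarith
  qed
  have "(\<lambda>n. 2 * L / real n) \<longlonglongrightarrow> 0" by (rule lim_const_over_n)
  then have "(\<lambda>n. \<alpha> - 2 * L / real n * (?I + \<bar>\<alpha>\<bar>)) \<longlonglongrightarrow> \<alpha> - 0 * (?I + \<bar>\<alpha>\<bar>)"
    by (intro tendsto_intros)
  then have "(\<lambda>n. \<alpha> - 2 * L / real n * (?I + \<bar>\<alpha>\<bar>)) \<longlonglongrightarrow> \<alpha>" by simp
  then show ?thesis by (rule LIMSEQ_le_const2) (use main in blast)
qed

lemma Fmac_density_bounds:
  assumes meas: "set_borel_measurable lborel {0..1} u"
    and bd: "AE r in lborel. r \<in> {0..1} \<longrightarrow> 0 \<le> u r \<and> u r \<le> B" and r: "0 \<le> r" "r \<le> 1"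
  shows "0 \<le> Fmac r u" "Fmac r u \<le> \<bar>B\<bar> * (1 - r)"
proof -
  have ui: "integrable lborel (\<lambda>s. indicator {r..1} s *\<^sub>R u s)"
    using set_integrable_subset[OF bounded_density_integrable[OF meas bd], of "{r..1}"] r
    unfolding set_integrable_def by auto
  show "0 \<le> Fmac r u"
    unfolding Fmac_def set_lebesgue_integral_def
    by (rule integral_nonneg_AE) (use bd in eventually_elim, use r in \<open>auto simp: indicator_def\<close>)
  have "Fmac r u \<le> (LINT s|lborel. indicator {r..1} s *\<^sub>R \<bar>B\<bar>)"
    unfolding Fmac_def set_lebesgue_integral_def
  proof (rule integral_mono_AE[OF ui])
    show "AE s in lborel. indicator {r..1} s *\<^sub>R u s \<le> indicator {r..1} s *\<^sub>R \<bar>B\<bar>"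
      using bd by eventually_elim (use r in \<open>auto simp: indicator_def\<close>)
    show "integrable lborel (\<lambda>s. indicator {r..1} s *\<^sub>R \<bar>B\<bar>)"
      using borel_integrable_atLeastAtMost'[OF continuous_on_const] unfolding set_integrable_def .
  qed
  also have "\<dots> = \<bar>B\<bar> * (1 - r)" using r by simp
  finally show "Fmac r u \<le> \<bar>B\<bar> * (1 - r)" .
qed

text \<open>Starting at x, blocks of length l telescope: at most (n + 1 - x) / l of them, each with
  error (l / n) d. The remainder of fewer than l sites has mass at most (l / n) (|B| + d) in either
  tail and is simply estimated.\<close>

lemma block_closeness_imp_Feps_close:
  fixes \<xi> :: config
  assumes meas: "set_borel_measurable lborel {0..1} u"
    and bd: "AE r in lborel. r \<in> {0..1} \<longrightarrow> 0 \<le> u r \<and> u r \<le> B"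
    and n: "1 \<le> n" and l: "1 \<le> l" "l \<le> n" and d: "0 \<le> d"
    and cl: "\<forall>x\<in>{0..n - l + 1}. \<bar>avg l x \<xi> - avg' n l x u\<bar> \<le> d"
    and x: "x \<le> n + 1"
  shows "\<bar>(1 / real n) * Feps n x \<xi> - Fmac (real x / real n) u\<bar>
     \<le> (real n + 1 - real x) / real n * d + real l / real n * (\<bar>B\<bar> + d)"
proof -
  let ?G = "\<lambda>x. (1 / real n) * Feps n x \<xi>"
  let ?F = "\<lambda>x. Fmac (real x / real n) u"
  have n0: "0 < real n" and l0: "0 < real l" using n l by auto
  have Fb: "0 \<le> ?F x \<and> ?F x \<le> \<bar>B\<bar> * (real n - real x) / real n" if "x \<le> n" for x
    using Fmac_density_bounds[OF meas bd, of "real x / real n"] that n0 by (simp add: field_simps)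
  have F1: "?F (n + 1) = 0" using n0 by (simp add: Fmac_beyond)
  have G1: "?G (n + 1) = 0" using Feps_beyond[of n \<xi>] by simp
  have Gm: "0 \<le> ?G x \<and> ?G x \<le> ?G y" if "y \<le> x" for x y
  proof -
    have "0 \<le> Feps n x \<xi>" "Feps n x \<xi> \<le> Feps n y \<xi>"
      unfolding Feps_def using that by (auto intro!: sum_nonneg sum_mono2)
    then show ?thesis using n0 by (simp add: divide_right_mono)
  qed
  have block: "\<bar>(?G x - ?G (x + l)) - (?F x - ?F (x + l))\<bar> \<le> real l / real n * d" if "x \<le> n - l + 1" for x
  proof -
    have xl: "x + l \<le> n + 1" using that l by simp
    have "{x..n} = {x..x+l-1} \<union> {x+l..n}" using xl l(1) by auto
    then have "Feps n x \<xi> = (\<Sum>y\<in>{x..x+l-1}. real (\<xi> y)) + Feps n (x + l) \<xi>"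
      unfolding Feps_def by (simp only:) (rule sum.union_disjoint, use l(1) in auto)
    then have av: "avg l x \<xi> = (1 / real l) * (Feps n x \<xi> - Feps n (x + l) \<xi>)" unfolding avg_def by simp
    have "x \<in> {0..n - l + 1}" using that by simp
    then have c: "\<bar>avg l x \<xi> - avg' n l x u\<bar> \<le> d" using cl by blast
    have "(?G x - ?G (x + l)) - (?F x - ?F (x + l)) = real l / real n * (avg l x \<xi> - avg' n l x u)"
      unfolding av avg'_def using n0 l0 by (simp add: field_simps)
    then have "\<bar>(?G x - ?G (x + l)) - (?F x - ?F (x + l))\<bar> = real l / real n * \<bar>avg l x \<xi> - avg' n l x u\<bar>"
      by (simp add: abs_mult)
    also have "\<dots> \<le> real l / real n * d" by (rule mult_left_mono[OF c]) simp
    finally show ?thesis .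
  qed
  let ?r = "real l / real n * (\<bar>B\<bar> + d)"
  have r0: "0 \<le> ?r" using d by simp
  show ?thesis using x
  proof (induction "n + 1 - x" arbitrary: x rule: less_induct)
    case less
    show ?case
    proof (cases "x \<le> n - l + 1")
      case True
      have xl: "x + l \<le> n + 1" using True l by simp
      have "\<bar>?G (x + l) - ?F (x + l)\<bar> \<le> (real n + 1 - real (x + l)) / real n * d + ?r"
        by (rule less.hyps) (use xl l less.prems in auto)
      moreover have "\<bar>?G x - ?F x\<bar> \<le> \<bar>?G (x + l) - ?F (x + l)\<bar> + real l / real n * d"
        using block[OF True] by linarith
      moreover have "(real n + 1 - real (x + l)) / real n * d + real l / real n * d = (real n + 1 - real x) / real n * d"
        by (simp add: distrib_right[symmetric] add_divide_distrib[symmetric])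
      ultimately show ?thesis by linarith
    next
      case False
      \<comment> \<open>The last full block starts here and ends at site n. The tail from x is at
        most the tail from \<open>?y\<close>, hence at most the mass of that block.\<close>
      let ?y = "n - l + 1"
      have y: "?y \<le> x" using False by simp
      have yl: "?y + l = n + 1" using l by simp
      have ry: "real n - real ?y \<le> real l" using l by (simp add: of_nat_diff)
      have lim: "\<bar>B\<bar> * (real n - real z) / real n \<le> real l / real n * \<bar>B\<bar>" if "?y \<le> z" for z
      proof -
        have "real n - real z \<le> real l" using ry that by linarith
        then have "\<bar>B\<bar> * (real n - real z) / real n \<le> \<bar>B\<bar> * real l / real n"
          using n0 by (intro divide_right_mono mult_left_mono) auto
        then show ?thesis by (simp add: mult.commute)
      qed
      have Gy: "?G ?y \<le> ?F ?y + real l / real n * d"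
        using block[of ?y] unfolding yl F1 G1 by linarith
      have Fy: "?F ?y \<le> real l / real n * \<bar>B\<bar>"
      proof -
        have "?y \<le> n" using l by simp
        from Fb[OF this] show ?thesis using lim[OF order_refl] by linarith
      qed
      have Fx: "0 \<le> ?F x \<and> ?F x \<le> real l / real n * \<bar>B\<bar>"
      proof (cases "x \<le> n")
        case True
        then show ?thesis using Fb[OF True] lim[OF y] by simp
      next
        case False
        then have "x = n + 1" using less.prems by simp
        then show ?thesis using F1 by simp
      qed
      have "0 \<le> (real n + 1 - real x) / real n * d" using less.prems d by simp
      moreover have "?r = real l / real n * \<bar>B\<bar> + real l / real n * d" by (simp only: distrib_left)
      moreover have "0 \<le> real l / real n * d" using d by simp
      ultimately show ?thesis using Gm[OF y] Gy Fy Fx by linarith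
    qed
  qed
qed

text \<open>The block error is d = n^(-1/20), and l / n \<le> n^(-1/10), so both parts of the
  estimate vanish; the factor 2 bounds (n + 1) / n.\<close>

lemma initial_Feps_close:
  assumes meas: "set_borel_measurable lborel {0..1} u"
    and bd: "AE r in lborel. r \<in> {0..1} \<longrightarrow> 0 \<le> u r \<and> u r \<le> B"
    and cl: "\<forall>n\<ge>1. let l = nat \<lfloor>real n powr (9/10)\<rfloor> in
         (\<forall>x\<in>{0..n - l + 1}. \<bar>avg l x (\<xi>0 n) - avg' n l x u\<bar> \<le> (1 / real n) powr (1/20))"
  obtains \<zeta> where "\<zeta> \<longlonglongrightarrow> 0" and "\<And>n x. 1 \<le> n \<Longrightarrow> x \<le> n \<Longrightarrow>
      \<bar>(1 / real n) * Feps n x (\<xi>0 n) - Fmac (real x / real n) u\<bar> \<le> \<zeta> n"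
proof
  let ?d = "\<lambda>n. (1 / real n) powr (1/20)"
  let ?z = "\<lambda>n. 2 * (1 / real n) powr (1/20) + (1 / real n) powr (1/10) * (\<bar>B\<bar> + (1 / real n) powr (1/20))"
  show "?z \<longlonglongrightarrow> 0"
  proof -
    have i: "(\<lambda>n. 1 / real n) \<longlonglongrightarrow> 0" by (rule lim_const_over_n)
    have p: "(\<lambda>n. (1 / real n) powr c) \<longlonglongrightarrow> 0" if "0 < c" for c
      by (rule tendsto_zero_powrI[OF i tendsto_const]) (use that in auto)
    have "?z \<longlonglongrightarrow> 2 * 0 + 0 * (\<bar>B\<bar> + 0)"
      by (intro tendsto_intros p) auto
    then show ?thesis by simp
  qed
  fix n x :: nat assume n: "1 \<le> n" and x: "x \<le> n"
  define l where "l = nat \<lfloor>real n powr (9/10)\<rfloor>"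
  have n0: "1 \<le> real n" using n by simp
  have p1: "1 \<le> real n powr (9/10)" using n0 by (simp add: ge_one_powr_ge_zero)
  have lp: "real l \<le> real n powr (9/10)" unfolding l_def using p1 by (simp add: floor_correct)
  have l1: "1 \<le> l" unfolding l_def using p1 by (simp add: le_nat_iff le_floor_iff)
  have "real n powr (9/10) \<le> real n powr 1" using n0 by (intro powr_mono) auto
  then have ln: "l \<le> n" using lp n0 by simp
  have clx: "\<forall>x\<in>{0..n - l + 1}. \<bar>avg l x (\<xi>0 n) - avg' n l x u\<bar> \<le> ?d n"
    using cl n unfolding l_def Let_def by blast
  have "\<bar>(1 / real n) * Feps n x (\<xi>0 n) - Fmac (real x / real n) u\<bar>
     \<le> (real n + 1 - real x) / real n * ?d n + real l / real n * (\<bar>B\<bar> + ?d n)"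
    by (rule block_closeness_imp_Feps_close[OF meas bd n l1 ln _ clx]) (use x in auto)
  also have "\<dots> \<le> ?z n"
  proof (intro add_mono mult_right_mono)
    have "(real n + 1 - real x) \<le> 2 * real n" using n0 by simp
    then show "(real n + 1 - real x) / real n \<le> 2" using n0 by (simp add: divide_le_eq)
    have "real l / real n \<le> real n powr (9/10) / real n powr 1" using lp n0 by (simp add: divide_right_mono)
    also have "\<dots> = real n powr (9/10 - 1)" by (rule powr_diff[symmetric])
    also have "\<dots> = (1 / real n) powr (1/10)" using n0 by (simp add: powr_minus_divide powr_divide)
    finally show "real l / real n \<le> (1 / real n) powr (1/10)" .
  qed auto
  finally show "\<bar>(1 / real n) * Feps n x (\<xi>0 n) - Fmac (real x / real n) u\<bar> \<le> ?z n" .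
qed

text \<open>High probability of \<open>A\<close> alone does not control the expectation, since the
  functional is unbounded. Truncating mass / n at level L leaves a second moment divided by L, small
  for large L uniformly in n.\<close>

lemma kexp_lin_close:
  assumes j: "0 < j" and n: "1 \<le> n" and t: "0 \<le> t" and \<xi>: "\<xi> \<in> box n N"
    and K: "\<And>x. x \<le> n \<Longrightarrow> \<bar>a x\<bar> \<le> K" and L: "0 < L"
    and cl: "\<And>\<eta>. \<eta> \<in> A \<Longrightarrow> \<bar>lin n a \<eta> / real n - I\<bar> \<le> e"
    and e: "0 \<le> e"
  shows "\<bar>kexp n j N ((real n)\<^sup>2 * t) (lin n a) \<xi> / real n - I\<bar>
     \<le> e + K / L * (((mass n \<xi> / real n)\<^sup>2 + 2) * exp (j * t))
        + (K * L + 2 * \<bar>I\<bar>) * (1 - kexp n j N ((real n)\<^sup>2 * t) (ind A) \<xi>)"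
proof -
  have j0: "0 \<le> j" using j by simp
  let ?\<tau> = "(real n)\<^sup>2 * t"
  have \<tau>: "0 \<le> ?\<tau>" using t by simp
  let ?E = "\<lambda>f. kexp n j N ?\<tau> f \<xi>"
  have n0: "0 < real n" using n by simp
  have K0: "0 \<le> K" using K[of 0] by simp
  have one: "?E (\<lambda>_. 1) \<le> 1" by (rule kexp_one_le[OF j0 \<tau> \<xi>])
  have inde: "?E (ind A) \<le> ?E (\<lambda>_. 1)" by (rule kexp_mono[OF j0 \<tau> \<xi>]) (simp add: ind_def)
  have pt: "\<bar>(1 / real n) * lin n a \<eta> - I * 1\<bar> \<le> e * 1 + K / L * (mass n \<eta> / real n)\<^sup>2 + (K * L + \<bar>I\<bar>) * (1 - ind A \<eta>)" for \<eta>
  proof (cases "\<eta> \<in> A")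
    case True
    have "0 \<le> K / L * (mass n \<eta> / real n)\<^sup>2" using K0 L by simp
    then show ?thesis using cl[OF True] True by (simp add: ind_def)
  next
    case False
    let ?m = "mass n \<eta> / real n"
    have m0: "0 \<le> ?m" using mass_nonneg n0 by simp
    have "\<bar>lin n a \<eta>\<bar> \<le> K * mass n \<eta>" by (rule abs_lin_le) (rule K)
    then have "\<bar>lin n a \<eta> / real n\<bar> \<le> K * ?m" using n0 by (simp add: divide_right_mono)
    also have "\<dots> \<le> K * (?m\<^sup>2 / L + L)"
    proof (rule mult_left_mono[OF _ K0])
      \<comment> \<open>Below the level, m \<le> L; above it, m \<le> m^2 / L.\<close>
      have "m \<le> m\<^sup>2 / L + L" if "0 \<le> m" for m
      proof (cases "m \<le> L")
        case True
        moreover have "0 \<le> m\<^sup>2 / L" using L by simp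
        ultimately show ?thesis by linarith
      next
        case False
        then have "m * L \<le> m * m" using that by (intro mult_left_mono) auto
        then have "m \<le> m\<^sup>2 / L" using L by (simp add: power2_eq_square pos_le_divide_eq)
        then show ?thesis using L by linarith
      qed
      then show "?m \<le> ?m\<^sup>2 / L + L" using m0 .
    qed
    also have "\<dots> = K / L * ?m\<^sup>2 + K * L" by (simp add: distrib_left)
    finally have "\<bar>lin n a \<eta> / real n\<bar> \<le> K / L * ?m\<^sup>2 + K * L" .
    moreover have i0: "ind A \<eta> = 0" using False by (simp add: ind_def)
    moreover have l: "(1 / real n) * lin n a \<eta> - I * 1 = lin n a \<eta> / real n - I" by simp
    ultimately show ?thesis unfolding l i0 diff_zero mult_1_right
      using e abs_triangle_ineq4[of "lin n a \<eta> / real n" I] by linarith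
  qed
  have lin: "?E (\<lambda>\<eta>. (1 / real n) * lin n a \<eta> - I * 1) = ?E (lin n a) / real n - I * ?E (\<lambda>_. 1)"
    by (simp only: kexp_diff[OF j0 \<xi>] kexp_cmult[OF j0 \<xi>]) simp
  have "\<bar>?E (\<lambda>\<eta>. (1 / real n) * lin n a \<eta> - I * 1)\<bar>
      \<le> ?E (\<lambda>\<eta>. e * 1 + K / L * (mass n \<eta> / real n)\<^sup>2 + (K * L + \<bar>I\<bar>) * (1 - ind A \<eta>))"
    by (rule kexp_abs_le[OF j0 \<tau> \<xi> pt])
  also have "\<dots> = e * ?E (\<lambda>_. 1) + K / L * ?E (\<lambda>\<eta>. (mass n \<eta> / real n)\<^sup>2) + (K * L + \<bar>I\<bar>) * (?E (\<lambda>_. 1) - ?E (ind A))"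
    by (simp only: kexp_add[OF j0 \<xi>] kexp_diff[OF j0 \<xi>] kexp_cmult[OF j0 \<xi>])
  also have "\<dots> \<le> e * 1 + K / L * (((mass n \<xi> / real n)\<^sup>2 + 2) * exp (j * t)) + (K * L + \<bar>I\<bar>) * (1 - ?E (ind A))"
    using one e K0 L by (intro add_mono mult_left_mono kexp_second_moment[OF j n t \<xi>]) auto
  finally have 1: "\<bar>?E (lin n a) / real n - I * ?E (\<lambda>_. 1)\<bar> \<le> e * 1 + K / L * (((mass n \<xi> / real n)\<^sup>2 + 2) * exp (j * t))
     + (K * L + \<bar>I\<bar>) * (1 - ?E (ind A))" unfolding lin .
  \<comment> \<open>Killing loses probability, so I must be compared with I times the surviving
    probability. This accounts for the second |I| in the bound.\<close>
  have "\<bar>I * ?E (\<lambda>_. 1) - I\<bar> = \<bar>I\<bar> * (1 - ?E (\<lambda>_. 1))"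
  proof -
    have "I * ?E (\<lambda>_. 1) - I = - (I * (1 - ?E (\<lambda>_. 1)))" by (simp add: right_diff_distrib)
    then show ?thesis using one by (simp only: abs_minus_cancel abs_mult)
  qed
  also have "\<dots> \<le> \<bar>I\<bar> * (1 - ?E (ind A))" using inde by (intro mult_left_mono) auto
  finally have 2: "\<bar>I * ?E (\<lambda>_. 1) - I\<bar> \<le> \<bar>I\<bar> * (1 - ?E (ind A))" .
  have "(K * L + 2 * \<bar>I\<bar>) * (1 - ?E (ind A)) = (K * L + \<bar>I\<bar>) * (1 - ?E (ind A)) + \<bar>I\<bar> * (1 - ?E (ind A))"
    by (simp add: algebra_simps)
  then show ?thesis using 1 2 by linarith
qed

section \<open>Positivity at the right end\<close>

lemma lam_tendsto: "(\<lambda>n. lam n k) \<longlonglongrightarrow> mu k"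
proof -
  have "((\<lambda>n::nat. (real n)\<^sup>2 * (1 - cos (c / (real n + 1)))) \<longlongrightarrow> c * c / 2) sequentially" if "c > 0" for c :: real
    using that by real_asymp
  from this[of "real k * pi"] show ?thesis
    unfolding lam_def mu_def by (cases "k = 0") (simp_all add: power2_eq_square)
qed

lemma lam_nonneg: "0 \<le> lam n k"
  unfolding lam_def by simp

text \<open>Relaxation towards Z at rate m costs nothing once y(0) \<ge> Z. The sink b contributes b
  (1 - exp (- m s)) / m, which is at most b t and at most b / m.\<close>

lemma ode_lower_bound:
  fixes y y' :: "real \<Rightarrow> real"
  assumes d: "\<And>s. 0 \<le> s \<Longrightarrow> s \<le> t \<Longrightarrow> (y has_real_derivative y' s) (at s)"
    and ge: "\<And>s. 0 \<le> s \<Longrightarrow> s \<le> t \<Longrightarrow> m * (Z - y s) - b \<le> y' s"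
    and y0: "Z \<le> y 0" and m: "0 < m" and b: "0 \<le> b" and s: "0 \<le> s" "s \<le> t"
  shows "Z - b * min t (1 / m) \<le> y s"
proof -
  let ?g = "\<lambda>s. exp (m * s) * (y s - Z) + b * ((exp (m * s) - 1) / m)"
  have "?g 0 \<le> ?g s"
  proof (rule DERIV_nonneg_imp_nondecreasing[OF s(1)])
    fix x assume x: "0 \<le> x" "x \<le> s"
    have D: "(?g has_real_derivative (exp (m * x) * y' x + exp (m * x) * m * (y x - Z) + b * (exp (m * x) * m / m))) (at x)"
      using d[of x] x s m by (auto intro!: derivative_eq_intros)
    have e: "exp (m * x) * y' x + exp (m * x) * m * (y x - Z) + b * (exp (m * x) * m / m)
      = exp (m * x) * (y' x - (m * (Z - y x) - b))"
      using m by (simp add: algebra_simps)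
    have "0 \<le> exp (m * x) * (y' x - (m * (Z - y x) - b))"
      using ge[of x] x s by (intro mult_nonneg_nonneg) auto
    then show "\<exists>z. (?g has_real_derivative z) (at x) \<and> 0 \<le> z" using D unfolding e by blast
  qed
  then have "0 \<le> exp (m * s) * (y s - Z) + b * ((exp (m * s) - 1) / m)" using y0 by simp
  then have "0 \<le> exp (- (m * s)) * (exp (m * s) * (y s - Z) + b * ((exp (m * s) - 1) / m))" by simp
  also have "\<dots> = (exp (- (m * s)) * exp (m * s)) * (y s - Z) + b * ((exp (- (m * s)) * exp (m * s) - exp (- (m * s))) / m)"
    by (simp add: algebra_simps diff_divide_distrib)
  also have "exp (- (m * s)) * exp (m * s) = 1" by (simp add: exp_minus)
  finally have 1: "0 \<le> (y s - Z) + b * ((1 - exp (- (m * s))) / m)" by simp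
  have "(1 - exp (- (m * s))) / m \<le> min t (1 / m)"
  proof (rule min.boundedI)
    have "1 - exp (- (m * s)) \<le> m * s" using exp_ge_add_one_self[of "- (m * s)"] by simp
    also have "\<dots> \<le> m * t" using s m by simp
    finally show "(1 - exp (- (m * s))) / m \<le> t" using m by (simp add: divide_le_eq mult.commute)
    show "(1 - exp (- (m * s))) / m \<le> 1 / m" using m by (intro divide_right_mono) auto
  qed
  then have "b * ((1 - exp (- (m * s))) / m) \<le> b * min t (1 / m)" using b by (rule mult_left_mono)
  then show ?thesis using 1 by linarith
qed

text \<open>Duhamel's formula with initial value 0: decay at rate l \<ge> 0 cannot amplify the
  forcing.\<close>

lemma ode_error_bound:
  fixes W h H :: "real \<Rightarrow> real"
  assumes d: "\<And>s. (W has_real_derivative - l * W s + h s) (at s)"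
    and W0: "W 0 = 0" and l: "0 \<le> l" and t: "0 \<le> t"
    and h: "continuous_on {0..t} h" and H: "continuous_on {0..t} H" and hH: "\<And>s. 0 \<le> s \<Longrightarrow> s \<le> t \<Longrightarrow> \<bar>h s\<bar> \<le> H s"
  shows "\<bar>W t\<bar> \<le> integral {0..t} H"
proof -
  have "((\<lambda>s. exp (l * s) * h s) has_integral (exp (l * t) * W t - exp (l * 0) * W 0)) {0..t}"
  proof (rule fundamental_theorem_of_calculus[OF t])
    fix x
    have "((\<lambda>s. exp (l * s) * W s) has_real_derivative (exp (l * x) * (- l * W x + h x) + exp (l * x) * l * W x)) (at x)"
      using d[of x] by (auto intro!: derivative_eq_intros)
    also have "exp (l * x) * (- l * W x + h x) + exp (l * x) * l * W x = exp (l * x) * h x" by (simp add: algebra_simps)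
    finally show "((\<lambda>s. exp (l * s) * W s) has_vector_derivative exp (l * x) * h x) (at x within {0..t})"
      by (simp add: has_real_derivative_iff_has_vector_derivative has_vector_derivative_at_within)
  qed
  then have I: "((\<lambda>s. exp (l * s) * h s) has_integral exp (l * t) * W t) {0..t}" using W0 by simp
  have "norm (integral {0..t} (\<lambda>s. exp (l * s) * h s)) \<le> integral {0..t} (\<lambda>s. exp (l * t) * H s)"
  proof (rule integral_norm_bound_integral)
    show "(\<lambda>s. exp (l * s) * h s) integrable_on {0..t}" using I by blast
    show "(\<lambda>s. exp (l * t) * H s) integrable_on {0..t}"
      by (intro integrable_continuous_real continuous_intros H)
    fix s assume s: "s \<in> {0..t}"
    have "exp (l * s) \<le> exp (l * t)" using s l by (simp add: mult_left_mono)
    then show "norm (exp (l * s) * h s) \<le> exp (l * t) * H s"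
      using hH[of s] s by (simp add: abs_mult mult_mono)
  qed
  then have "\<bar>exp (l * t) * W t\<bar> \<le> exp (l * t) * integral {0..t} H"
    using integral_unique[OF I] by simp
  then have "exp (l * t) * \<bar>W t\<bar> \<le> exp (l * t) * integral {0..t} H" by (simp add: abs_mult)
  then show ?thesis by simp
qed

text \<open>The alternative b = 0 is for the mode k = 0, where the rate is 0 and the quotient takes
  its default value, but the source 1 - cos (k pi) vanishes.\<close>

lemma exp_integral:
  fixes t b m :: real
  assumes "0 \<le> t" "b = 0 \<or> m \<noteq> 0"
  shows "(LINT s:{0..t}|lborel. exp (- m * s) * b) = b * ((1 - exp (- m * t)) / m)"
proof (cases "b = 0")
  case False
  then have m: "m \<noteq> 0" using assms by simp
  have "((\<lambda>s. exp (- m * s) * b) has_integral (- (b * (exp (- m * t) / m)) - (- (b * (exp (- m * 0) / m))))) {0..t}"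
  proof (rule fundamental_theorem_of_calculus[OF assms(1)])
    fix x
    have "((\<lambda>s. - (b * (exp (- m * s) / m))) has_real_derivative exp (- m * x) * b) (at x)"
      using m by (auto intro!: derivative_eq_intros)
    then show "((\<lambda>s. - (b * (exp (- m * s) / m))) has_vector_derivative exp (- m * x) * b) (at x within {0..t})"
      by (simp add: has_real_derivative_iff_has_vector_derivative has_vector_derivative_at_within)
  qed
  moreover have "set_integrable lborel {0..t} (\<lambda>s. exp (- m * s) * b)"
    by (rule borel_integrable_atLeastAtMost') (intro continuous_intros)
  ultimately have "(LINT s:{0..t}|lborel. exp (- m * s) * b) = - (b * (exp (- m * t) / m)) - (- (b * (exp (- m * 0) / m)))"
    using set_borel_integral_eq_integral(2) integral_unique by metis
  then show ?thesis by (simp add: diff_divide_distrib right_diff_distrib)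
qed simp

section \<open>Expected functionals of the particle system and their limits\<close>

locale hydrodynamic_limit =
  fixes j \<alpha> B :: real and rho0 :: "real \<Rightarrow> real"
    and \<xi>0 :: "nat \<Rightarrow> config" and \<rho> :: "real \<Rightarrow> real \<Rightarrow> real"
  assumes j_pos: "0 < j"
    and rho0_meas: "set_borel_measurable lborel {0..1} rho0"
    and rho0_Linf: "AE r in lborel. r \<in> {0..1} \<longrightarrow> 0 \<le> rho0 r \<and> rho0 r \<le> B"
    and alpha_pos: "0 < \<alpha>"
    and F_lower: "\<forall>r\<in>{0..1}. Fmac r rho0 \<ge> \<alpha> * (1 - r)"
    and \<xi>0_supp: "\<forall>n\<ge>1. \<forall>y>n. \<xi>0 n y = 0"
    and \<xi>0_close: "\<forall>n\<ge>1. let l = nat \<lfloor>real n powr (9/10)\<rfloor> in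
         (\<forall>x\<in>{0..n - l + 1}. \<bar>avg l x (\<xi>0 n) - avg' n l x rho0\<bar> \<le> (1 / real n) powr (1/20))"
    and \<rho>_nonneg: "\<forall>r\<in>{0..1}. \<forall>t>0. 0 \<le> \<rho> r t"
    and \<rho>_cont: "continuous_on ({0..1} \<times> {0<..}) (\<lambda>(r, t). \<rho> r t)"
    and \<rho>_hydro: "\<forall>t>0. \<forall>\<zeta>>0.
         (\<lambda>n. prob_at n j (\<xi>0 n) (real n ^ 2 * t)
            {\<eta>. (\<forall>x\<in>{0..n}. \<bar>(1 / real n) * Feps n x \<eta> - Fmac (real x / real n) (\<lambda>s. \<rho> s t)\<bar> \<le> \<zeta>)})
         \<longlonglongrightarrow> 1"
begin

abbreviation EE :: "nat \<Rightarrow> nat \<Rightarrow> real \<Rightarrow> (config \<Rightarrow> real) \<Rightarrow> real" where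
  "EE n N t f \<equiv> kexp n j N ((real n)\<^sup>2 * t) f (\<xi>0 n)"

abbreviation YY :: "nat \<Rightarrow> nat \<Rightarrow> (real \<Rightarrow> real) \<Rightarrow> real \<Rightarrow> real" where
  "YY n N \<phi> t \<equiv> EE n N t (lin n (gridf n \<phi>)) / real n"

lemma j0: "0 \<le> j" using j_pos by simp

lemma u0: "set_integrable lborel {0..1} rho0"
  by (rule bounded_density_integrable[OF rho0_meas rho0_Linf])

lemma \<rho>_cont_t: "0 < t \<Longrightarrow> continuous_on {0..1} (\<lambda>r. \<rho> r t)"
proof -
  assume t: "0 < t"
  have "continuous_on {0..1} (\<lambda>r. case (r, t) of (r, t) \<Rightarrow> \<rho> r t)"
    by (rule continuous_on_compose2[OF \<rho>_cont]) (use t in \<open>auto intro!: continuous_on_Pair continuous_on_id continuous_on_const\<close>)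
  then show ?thesis by simp
qed

lemma \<rho>_int: "0 < t \<Longrightarrow> set_integrable lborel {0..1} (\<lambda>r. \<rho> r t)"
  by (rule borel_integrable_atLeastAtMost') (rule \<rho>_cont_t)

lemma in_box_eventually:
  assumes "1 \<le> n"
  shows "\<forall>\<^sub>F N in sequentially. 1 \<le> N \<and> \<xi>0 n \<in> box n N"
  using eventually_ge_at_top[of "1 + (\<Sum>y\<le>n. \<xi>0 n y)"]
proof eventually_elim
  case (elim N)
  have "\<xi>0 n y \<le> N" if "y \<le> n" for y
  proof -
    have "\<xi>0 n y \<le> (\<Sum>y\<le>n. \<xi>0 n y)" by (rule member_le_sum) (use that in auto)
    then show ?thesis using elim by simp
  qed
  then show ?case using elim \<xi>0_supp assms by (auto simp: box_def)
qed

lemma in_some_box: "1 \<le> n \<Longrightarrow> \<exists>N. \<xi>0 n \<in> box n N"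
  using eventually_happens[OF in_box_eventually[of n]] by auto

lemma mass_bounded: "\<exists>C\<ge>0. \<forall>n\<ge>1. mass n (\<xi>0 n) / real n \<le> C"
proof -
  obtain \<zeta> where \<zeta>: "\<zeta> \<longlonglongrightarrow> 0" and cl: "\<And>n x. 1 \<le> n \<Longrightarrow> x \<le> n \<Longrightarrow>
      \<bar>(1 / real n) * Feps n x (\<xi>0 n) - Fmac (real x / real n) rho0\<bar> \<le> \<zeta> n"
    using initial_Feps_close[OF rho0_meas rho0_Linf \<xi>0_close] by blast
  have "Bseq \<zeta>" using \<zeta> convergent_def convergent_imp_Bseq by blast
  then obtain D where D: "\<And>n. \<bar>\<zeta> n\<bar> \<le> D" unfolding Bseq_def by auto
  have "mass n (\<xi>0 n) / real n \<le> \<bar>Fmac 0 rho0\<bar> + D" if "1 \<le> n" for n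
  proof -
    have "mass n (\<xi>0 n) = Feps n 0 (\<xi>0 n)" unfolding lin_def Feps_def by (simp add: atMost_atLeast0)
    then have "\<bar>mass n (\<xi>0 n) / real n - Fmac 0 rho0\<bar> \<le> \<zeta> n" using cl[OF that, of 0] by simp
    then show ?thesis using D[of n] by linarith
  qed
  moreover have "0 \<le> \<bar>Fmac 0 rho0\<bar> + D" using D[of 0] by linarith
  ultimately show ?thesis by blast
qed

text \<open>Fixes the order of the limits used throughout: first n is taken large, then N, depending
  on n.\<close>

lemma EE_eventually:
  assumes t: "0 \<le> t" and lim: "(\<lambda>n. prob_at n j (\<xi>0 n) ((real n)\<^sup>2 * t) (A n)) \<longlonglongrightarrow> 1" and \<kappa>: "0 < \<kappa>"
  shows "\<forall>\<^sub>F n in sequentially. \<forall>\<^sub>F N in sequentially. 1 - EE n N t (ind (A n)) \<le> \<kappa>"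
proof -
  have "\<forall>\<^sub>F n in sequentially. 1 - \<kappa> < prob_at n j (\<xi>0 n) ((real n)\<^sup>2 * t) (A n)"
    by (rule order_tendstoD(1)[OF lim]) (use \<kappa> in simp)
  then show ?thesis using eventually_ge_at_top[of 1]
  proof eventually_elim
    case (elim n)
    obtain N0 where N0: "\<xi>0 n \<in> box n N0" using in_some_box[OF elim(2)] by blast
    have "(\<lambda>N. EE n N t (ind (A n))) \<longlonglongrightarrow> prob_at n j (\<xi>0 n) ((real n)\<^sup>2 * t) (A n)"
      by (rule prob_at_tendsto(1)[OF j0 _ N0]) (use t in simp)
    from order_tendstoD(1)[OF this elim(1)] show ?case by eventually_elim simp
  qed
qed

text \<open>The hydrodynamic hypothesis, a convergence in probability of tail functions, becomes
  convergence of expected linear functionals, thanks to the second moment.\<close>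

lemma YY_limit:
  assumes t: "0 < t" and \<phi>: "cospoly m \<phi>" and \<delta>: "0 < \<delta>"
  shows "\<forall>\<^sub>F n in sequentially. \<forall>\<^sub>F N in sequentially.
     \<bar>YY n N \<phi> t - (LINT r:{0..1}|lborel. \<rho> r t * \<phi> r)\<bar> \<le> \<delta>"
proof -
  obtain K L where K: "0 \<le> K" "\<And>x. \<bar>\<phi> x\<bar> \<le> K" and L: "0 \<le> L" "\<And>x y. \<bar>\<phi> x - \<phi> y\<bar> \<le> L * \<bar>x - y\<bar>"
    using cospoly_bounds[OF \<phi>] by metis
  have \<phi>m: "\<phi> \<in> borel_measurable borel" by (rule cospoly_measurable[OF \<phi>])
  obtain C where C: "0 \<le> C" "\<And>n. 1 \<le> n \<Longrightarrow> mass n (\<xi>0 n) / real n \<le> C" using mass_bounded by blast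
  let ?I = "LINT r:{0..1}|lborel. \<rho> r t * \<phi> r"
  let ?J = "LINT s:{0..1}|lborel. \<bar>\<rho> s t\<bar>"
  define P where "P = (C\<^sup>2 + 2) * exp (j * t)"
  have P: "0 < P" unfolding P_def by (intro mult_pos_pos add_nonneg_pos) auto
  \<comment> \<open>The truncation level \<open>M\<close>, the tolerance \<open>\<zeta>\<close> and
    the factor \<open>Q\<close> on the bad event each keep one error term below \<delta> / 4; the
    Riemann error takes the fourth quarter. The summands 1 keep these constants away from 0.\<close>
  define M where "M = 4 * K * P / \<delta> + 1"
  have M: "0 < M" unfolding M_def using K P \<delta> by (simp add: add_nonneg_pos)
  have KM: "K / M * P \<le> \<delta> / 4"
  proof -
    have "4 * K * P \<le> M * \<delta>" unfolding M_def using \<delta> by (simp add: distrib_right)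
    then show ?thesis using M by (simp add: divide_le_eq mult.commute mult.left_commute)
  qed
  define \<zeta> where "\<zeta> = \<delta> / (4 * (K + L + 1))"
  have KL: "0 < K + L + 1" using K L by simp
  have \<zeta>: "0 < \<zeta>" unfolding \<zeta>_def using \<delta> KL by simp
  have KL\<zeta>: "(K + L) * \<zeta> \<le> \<delta> / 4"
    unfolding \<zeta>_def using \<delta> KL by (simp add: divide_simps)
  define Q where "Q = K * M + 2 * \<bar>?I\<bar> + 1"
  have Q: "0 < Q" unfolding Q_def using K M by (simp add: add_nonneg_pos)
  define A where "A n = {\<eta>. (\<forall>x\<in>{0..n}. \<bar>(1 / real n) * Feps n x \<eta> - Fmac (real x / real n) (\<lambda>s. \<rho> s t)\<bar> \<le> \<zeta>)}" for n
  have "(\<lambda>n. prob_at n j (\<xi>0 n) ((real n)\<^sup>2 * t) (A n)) \<longlonglongrightarrow> 1"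
    unfolding A_def using \<rho>_hydro t \<zeta> by blast
  from EE_eventually[OF less_imp_le[OF t] this, of "\<delta> / (4 * Q)"]
  have ev1: "\<forall>\<^sub>F n in sequentially. \<forall>\<^sub>F N in sequentially. 1 - EE n N t (ind (A n)) \<le> \<delta> / (4 * Q)"
    using \<delta> Q by simp
  have "(\<lambda>n. 2 * L / real n * ?J) \<longlonglongrightarrow> 0 * ?J"
    by (intro tendsto_mult lim_const_over_n tendsto_const)
  then have "\<forall>\<^sub>F n in sequentially. 2 * L / real n * ?J < \<delta> / 4"
    by (rule order_tendstoD(2)) (use \<delta> in simp)
  then show ?thesis using ev1 eventually_ge_at_top[of 1]
  proof eventually_elim
    case (elim n)
    note n = elim(3)
    from elim(2) in_box_eventually[OF n] show ?case
    proof eventually_elim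
      case (elim N)
      have "\<bar>YY n N \<phi> t - ?I\<bar> \<le> \<delta> / 2 + K / M * (((mass n (\<xi>0 n) / real n)\<^sup>2 + 2) * exp (j * t))
        + (K * M + 2 * \<bar>?I\<bar>) * (1 - EE n N t (ind (A n)))"
      proof (rule kexp_lin_close[OF j_pos n less_imp_le[OF t] conjunct2[OF elim(2)] _ M])
        show "\<bar>gridf n \<phi> x\<bar> \<le> K" for x unfolding gridf_def by (rule K)
        fix \<eta> assume \<eta>: "\<eta> \<in> A n"
        have "\<bar>lin n (gridf n \<phi>) \<eta> / real n - ?I\<bar> \<le> (K + L) * \<zeta> + 2 * L / real n * ?J"
          by (rule lin_close[OF n \<rho>_int[OF t] K(2) L(2,1) \<phi>m]) (use \<eta> in \<open>auto simp: A_def\<close>)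
        then show "\<bar>lin n (gridf n \<phi>) \<eta> / real n - ?I\<bar> \<le> \<delta> / 2"
          using KL\<zeta> \<open>2 * L / real n * ?J < \<delta> / 4\<close> by linarith
      qed (use \<delta> in simp)
      moreover have "K / M * (((mass n (\<xi>0 n) / real n)\<^sup>2 + 2) * exp (j * t)) \<le> K / M * P"
        unfolding P_def using C(2)[OF n] K M mass_nonneg[of n "\<xi>0 n"]
        by (intro mult_left_mono mult_right_mono add_right_mono power_mono) auto
      moreover have "(K * M + 2 * \<bar>?I\<bar>) * (1 - EE n N t (ind (A n))) \<le> \<delta> / 4"
      proof -
        have "(K * M + 2 * \<bar>?I\<bar>) * (1 - EE n N t (ind (A n))) \<le> (K * M + 2 * \<bar>?I\<bar>) * (\<delta> / (4 * Q))"
          using elim(1) K M by (intro mult_left_mono) auto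
        also have "\<dots> \<le> Q * (\<delta> / (4 * Q))"
          using \<delta> Q by (intro mult_right_mono) (auto simp: Q_def)
        also have "\<dots> = \<delta> / 4" using Q by simp
        finally show ?thesis .
      qed
      ultimately show ?case using KM by linarith
    qed
  qed
qed

lemma initial_limit:
  assumes \<phi>: "cospoly m \<phi>"
  shows "(\<lambda>n. lin n (gridf n \<phi>) (\<xi>0 n) / real n) \<longlonglongrightarrow> (LINT r:{0..1}|lborel. rho0 r * \<phi> r)"
proof -
  obtain K L where K: "0 \<le> K" "\<And>x. \<bar>\<phi> x\<bar> \<le> K" and L: "0 \<le> L" "\<And>x y. \<bar>\<phi> x - \<phi> y\<bar> \<le> L * \<bar>x - y\<bar>"
    using cospoly_bounds[OF \<phi>] by metis
  have \<phi>m: "\<phi> \<in> borel_measurable borel" by (rule cospoly_measurable[OF \<phi>])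
  obtain \<zeta> where \<zeta>: "\<zeta> \<longlonglongrightarrow> 0" and cl: "\<And>n x. 1 \<le> n \<Longrightarrow> x \<le> n \<Longrightarrow>
      \<bar>(1 / real n) * Feps n x (\<xi>0 n) - Fmac (real x / real n) rho0\<bar> \<le> \<zeta> n"
    using initial_Feps_close[OF rho0_meas rho0_Linf \<xi>0_close] by blast
  let ?J = "LINT s:{0..1}|lborel. \<bar>rho0 s\<bar>"
  have "(\<lambda>n. (K + L) * \<zeta> n + 2 * L / real n * ?J) \<longlonglongrightarrow> (K + L) * 0 + 0 * ?J"
    by (intro tendsto_add tendsto_mult lim_const_over_n tendsto_const \<zeta>)
  then have e: "(\<lambda>n. (K + L) * \<zeta> n + 2 * L / real n * ?J) \<longlonglongrightarrow> 0" by simp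
  have "(\<lambda>n. lin n (gridf n \<phi>) (\<xi>0 n) / real n - (LINT r:{0..1}|lborel. rho0 r * \<phi> r)) \<longlonglongrightarrow> 0"
  proof (rule Lim_null_comparison[OF _ e])
    show "\<forall>\<^sub>F n in sequentially. norm (lin n (gridf n \<phi>) (\<xi>0 n) / real n - (LINT r:{0..1}|lborel. rho0 r * \<phi> r)) \<le> (K + L) * \<zeta> n + 2 * L / real n * ?J"
      using eventually_ge_at_top[of 1]
    proof eventually_elim
      case (elim n)
      show ?case unfolding real_norm_def
        by (rule lin_close[OF elim u0 K(2) L(2,1) \<phi>m cl[OF elim]])
    qed
  qed
  then show ?thesis by (simp add: LIM_zero_iff)
qed

lemma Uk_eq_YY: "Uk n j N (\<xi>0 n) k s = YY n N (\<lambda>r. cos (real k * pi * r)) s"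
  unfolding Uk_def cosg_eq_gridf ..

lemma YY_sum:
  assumes \<phi>: "\<And>r. \<phi> r = (\<Sum>k\<le>m. a k * cos (real k * pi * r))" and box: "\<xi>0 n \<in> box n N"
  shows "YY n N \<phi> s = (\<Sum>k\<le>m. a k * Uk n j N (\<xi>0 n) k s)"
    and "EE n N s (bdry n (gridf n \<phi>)) = (\<Sum>k\<le>m. a k * Bk n j N (\<xi>0 n) k s)"
proof -
  have g: "gridf n \<phi> x = (\<Sum>k\<le>m. a k * cosg n k x)" for x
    unfolding gridf_def cosg_def \<phi> ..
  have "lin n (gridf n \<phi>) = (\<lambda>\<eta>. \<Sum>k\<le>m. a k * lin n (cosg n k) \<eta>)"
  proof
    fix \<eta>
    have "lin n (gridf n \<phi>) \<eta> = (\<Sum>x\<le>n. \<Sum>k\<le>m. a k * (cosg n k x * real (\<eta> x)))"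
      unfolding lin_def g sum_distrib_right by (simp only: mult.assoc)
    also have "\<dots> = (\<Sum>k\<le>m. \<Sum>x\<le>n. a k * (cosg n k x * real (\<eta> x)))" by (rule sum.swap)
    finally show "lin n (gridf n \<phi>) \<eta> = (\<Sum>k\<le>m. a k * lin n (cosg n k) \<eta>)"
      unfolding lin_def sum_distrib_left .
  qed
  then show "YY n N \<phi> s = (\<Sum>k\<le>m. a k * Uk n j N (\<xi>0 n) k s)"
    unfolding Uk_def by (simp only: kexp_sum[OF j0 box finite_atMost] kexp_cmult[OF j0 box] sum_divide_distrib times_divide_eq_right)
  have "bdry n (gridf n \<phi>) = (\<lambda>\<eta>. \<Sum>k\<le>m. a k * bdry n (cosg n k) \<eta>)"
  proof
    fix \<eta>
    show "bdry n (gridf n \<phi>) \<eta> = (\<Sum>k\<le>m. a k * bdry n (cosg n k) \<eta>)"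
      unfolding bdry_def g
      by (cases "\<exists>y\<le>n. 0 < \<eta> y"; simp only: if_True if_False right_diff_distrib sum_subtractf) simp
  qed
  then show "EE n N s (bdry n (gridf n \<phi>)) = (\<Sum>k\<le>m. a k * Bk n j N (\<xi>0 n) k s)"
    unfolding Bk_def by (simp only: kexp_sum[OF j0 box finite_atMost] kexp_cmult[OF j0 box])
qed

text \<open>A bound uniform in n, N and k, needed to replace \<open>lam n k\<close> by
  \<open>mu k\<close> in the mode equations.\<close>

lemma Uk_bound:
  assumes n: "1 \<le> n" and box: "\<xi>0 n \<in> box n N" and C: "0 \<le> C" "mass n (\<xi>0 n) / real n \<le> C" and s: "0 \<le> s" "s \<le> t"
  shows "\<bar>Uk n j N (\<xi>0 n) k s\<bar> \<le> (C\<^sup>2 + 2) * exp (j * t) + 1"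
proof -
  let ?\<tau> = "(real n)\<^sup>2 * s"
  have \<tau>: "0 \<le> ?\<tau>" using s by simp
  have n0: "0 < real n" using n by simp
  have "\<bar>EE n N s (\<lambda>\<eta>. (1 / real n) * lin n (cosg n k) \<eta>)\<bar> \<le> EE n N s (\<lambda>\<eta>. (mass n \<eta> / real n)\<^sup>2 + 1)"
  proof (rule kexp_abs_le[OF j0 \<tau> box])
    fix \<eta>
    let ?m = "mass n \<eta> / real n"
    have "\<bar>lin n (cosg n k) \<eta>\<bar> \<le> 1 * mass n \<eta>" by (rule abs_lin_le) (rule abs_cosg_le)
    then have "\<bar>(1 / real n) * lin n (cosg n k) \<eta>\<bar> \<le> ?m" using n0 by (simp add: divide_right_mono)
    moreover have "m \<le> m\<^sup>2 + 1" for m :: real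
    proof -
      have "0 \<le> (m - 1)\<^sup>2" by simp
      then have "2 * m \<le> m\<^sup>2 + 1" by (simp add: power2_diff)
      moreover have "0 \<le> m\<^sup>2 + 1" by simp
      ultimately show ?thesis by linarith
    qed
    ultimately show "\<bar>(1 / real n) * lin n (cosg n k) \<eta>\<bar> \<le> ?m\<^sup>2 + 1" using order_trans by blast
  qed
  also have "\<dots> = EE n N s (\<lambda>\<eta>. (mass n \<eta> / real n)\<^sup>2) + EE n N s (\<lambda>_. 1)"
    by (rule kexp_add[OF j0 box])
  also have "\<dots> \<le> ((mass n (\<xi>0 n) / real n)\<^sup>2 + 2) * exp (j * s) + 1"
    by (intro add_mono kexp_second_moment[OF j_pos n s(1) box] kexp_one_le[OF j0 \<tau> box])
  also have "\<dots> \<le> (C\<^sup>2 + 2) * exp (j * t) + 1"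
    using C s j0 mass_nonneg[of n "\<xi>0 n"] n0
    by (intro add_right_mono mult_mono power_mono) (auto intro: mult_left_mono)
  finally show ?thesis unfolding Uk_def kexp_cmult[OF j0 box] by simp
qed

text \<open>The created particle contributes \<phi>(0) \<ge> 0 and the removed one at most b,
  wherever it sits. Nothing about the position of R enters, which is why positivity at 1 can be
  proved first.\<close>

lemma EE_bdry_ge:
  assumes box: "\<xi>0 n \<in> box n N" and s: "0 \<le> s" and \<phi>: "\<And>x. 0 \<le> \<phi> x" "\<And>x. \<phi> x \<le> b"
  shows "- b \<le> EE n N s (bdry n (gridf n \<phi>))"
proof -
  have \<tau>: "0 \<le> (real n)\<^sup>2 * s" using s by simp
  have b: "0 \<le> b" using \<phi>[of 0] by linarith
  have "- b * 1 \<le> - b * EE n N s (\<lambda>_. 1)"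
    using mult_left_mono[OF kexp_one_le[OF j0 \<tau> box] b] by simp
  also have "\<dots> = EE n N s (\<lambda>_. - b)" by (rule kexp_const[OF j0 box, symmetric])
  also have "\<dots> \<le> EE n N s (bdry n (gridf n \<phi>))"
  proof (rule kexp_mono[OF j0 \<tau> box])
    fix \<eta>
    show "- b \<le> bdry n (gridf n \<phi>) \<eta>"
      unfolding bdry_def gridf_def
      using \<phi>(1)[of "(real 0 + 1/2) / (real n + 1)"] \<phi>(2)[of "(real (rightmost n \<eta>) + 1/2) / (real n + 1)"] b
      by (cases "\<exists>y\<le>n. 0 < \<eta> y"; simp only: if_True if_False; linarith)
  qed
  finally show ?thesis by simp
qed

lemma eventually_div_le:
  fixes c :: real assumes "0 < e" shows "\<forall>\<^sub>F N in sequentially. c / real N \<le> e"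
  using order_tendstoD(2)[OF lim_const_over_n[of c] assms] by eventually_elim simp

text \<open>Induction along the chain of inequalities for y_m. It starts from q_0 = 1, the total
  mass, for which removal never exceeds creation. The bound is claimed for all s \<le> t because
  y_(m-1) drives the equation of y_m on the whole time interval.\<close>

lemma q_lower:
  assumes t: "0 < t" and e: "0 < e"
  shows "\<forall>\<^sub>F n in sequentially. \<forall>\<^sub>F N in sequentially. \<forall>s. 0 \<le> s \<and> s \<le> t \<longrightarrow>
     \<alpha> - j * (\<Sum>i=1..m. bq i * min t (1 / mu i)) - e \<le> YY n N (q m) s"
  using e
proof (induction m arbitrary: e)
  case 0
  have \<phi>0: "q 0 r = (\<Sum>k\<le>0. 1 * cos (real k * pi * r))" for r by (simp add: q_def)
  have "\<forall>\<^sub>F n in sequentially. \<alpha> - e / 2 < lin n (gridf n (q 0)) (\<xi>0 n) / real n"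
    by (rule order_tendstoD(1)[OF initial_limit[OF cospoly_q]])
       (use integral_q_lower_bound[OF u0 F_lower, of 0] \<open>0 < e\<close> in linarith)
  then show ?case using eventually_ge_at_top[of 1]
  proof eventually_elim
    case (elim n)
    note n = elim(2)
    let ?c = "real n * (1 + 2 * j) * (mass n (\<xi>0 n) + 1) ^ 3 * exp (7 * j * ((real n)\<^sup>2 * t))"
    have "0 < e / (2 * t)" using t \<open>0 < e\<close> by simp
    from eventually_div_le[OF this, of ?c] in_box_eventually[OF n] show ?case
    proof eventually_elim
      case (elim N)
      then have N: "1 \<le> N" and box: "\<xi>0 n \<in> box n N" by auto
      let ?y = "\<lambda>s. Uk n j N (\<xi>0 n) 0 s"
      have yeq: "YY n N (q 0) s = ?y s" for s using YY_sum(1)[OF \<phi>0 box, of s] by simp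
      have Beq: "EE n N s (bdry n (gridf n (q 0))) = Bk n j N (\<xi>0 n) 0 s" for s
        using YY_sum(2)[OF \<phi>0 box, of s] by simp
      have "\<alpha> - e \<le> ?y s" if s: "0 \<le> s" "s \<le> t" for s
      proof -
        \<comment> \<open>The small slope e / (2 t) absorbs the killing error, so the corrected mass
          is nondecreasing; over time t it costs e / 2.\<close>
        have "?y 0 + (e / (2 * t)) * 0 \<le> ?y s + (e / (2 * t)) * s"
        proof (rule DERIV_nonneg_imp_nondecreasing[OF s(1)])
          fix x assume x: "0 \<le> x" "x \<le> s"
          have "((\<lambda>s. ?y s + (e / (2 * t)) * s) has_real_derivative
              (- lam n 0 * ?y x + j * Bk n j N (\<xi>0 n) 0 x + Ek n j N (\<xi>0 n) 0 x) + (e / (2 * t)) * 1) (at x)"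
            by (intro DERIV_add Uk_has_derivative[OF j0 n box] DERIV_cmult DERIV_ident)
          moreover have "lam n 0 = 0" by (simp add: lam_def)
          moreover have "0 \<le> Bk n j N (\<xi>0 n) 0 x"
            unfolding Bk_def by (rule kexp_nonneg[OF j0 _ box]) (use x in \<open>auto simp: bdry_def cosg_def\<close>)
          then have "0 \<le> j * Bk n j N (\<xi>0 n) 0 x" using j0 by simp
          moreover have "\<bar>Ek n j N (\<xi>0 n) 0 x\<bar> \<le> ?c / real N"
            by (rule Ek_bound[OF j_pos n N box]) (use x s in auto)
          ultimately show "\<exists>z. ((\<lambda>s. ?y s + (e / (2 * t)) * s) has_real_derivative z) (at x) \<and> 0 \<le> z"
            using elim(1) by (intro exI conjI) (assumption, simp)
        qed
        moreover have "(e / (2 * t)) * s \<le> (e / (2 * t)) * t" using s \<open>0 < e / (2 * t)\<close> by (intro mult_left_mono) auto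
        moreover have "(e / (2 * t)) * t = e / 2" using t by simp
        moreover have "?y 0 = lin n (gridf n (q 0)) (\<xi>0 n) / real n"
          unfolding yeq[symmetric] by (simp add: kexp_0)
        ultimately show ?thesis using \<open>\<alpha> - e / 2 < lin n (gridf n (q 0)) (\<xi>0 n) / real n\<close> by simp
      qed
      then show ?case unfolding yeq by simp
    qed
  qed
next
  case (Suc l)
  let ?m = "Suc l"
  obtain a where a: "\<And>r. q ?m r = (\<Sum>k\<le>?m. a k * cos (real k * pi * r))"
    and amu: "\<And>r. (\<Sum>k\<le>?m. a k * (mu k * cos (real k * pi * r))) = mu ?m * (q ?m r - q l r)"
    using q_coeffs by blast
  obtain C where C: "0 \<le> C" "\<And>n. 1 \<le> n \<Longrightarrow> mass n (\<xi>0 n) / real n \<le> C" using mass_bounded by blast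
  define P where "P = (C\<^sup>2 + 2) * exp (j * t) + 1"
  have P: "0 < P" unfolding P_def by (intro add_nonneg_pos mult_nonneg_nonneg) auto
  define S where "S = (\<Sum>k\<le>?m. \<bar>a k\<bar>)"
  have S: "0 \<le> S" unfolding S_def by (intro sum_nonneg) auto
  let ?Z = "\<alpha> - j * (\<Sum>i=1..l. bq i * min t (1 / mu i)) - e / 3"
  \<comment> \<open>Two errors of size e1, from replacing \<open>lam\<close> by \<open>mu\<close>
    and from killing, accumulate over time t to at most e / 3. Another e / 3 is spent in the
    induction hypothesis, inside \<open>?Z\<close>.\<close>
  define e1 where "e1 = e / (6 * (t + 1))"
  have e1: "0 < e1" unfolding e1_def using \<open>0 < e\<close> t by simp
  have e1t: "2 * e1 * t \<le> e / 3" unfolding e1_def using \<open>0 < e\<close> t by (simp add: divide_simps)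
  have "(\<lambda>n. \<Sum>k\<le>?m. \<bar>a k\<bar> * (\<bar>mu k - lam n k\<bar> * P)) \<longlonglongrightarrow> (\<Sum>k\<le>?m. \<bar>a k\<bar> * (\<bar>mu k - mu k\<bar> * P))"
    by (intro tendsto_intros lam_tendsto)
  then have ev2: "\<forall>\<^sub>F n in sequentially. (\<Sum>k\<le>?m. \<bar>a k\<bar> * (\<bar>mu k - lam n k\<bar> * P)) < e1"
    by (rule order_tendstoD(2)) (use e1 in simp)
  have sum0: "0 \<le> (\<Sum>i=1..l. bq i * min t (1 / mu i))"
    using t by (intro sum_nonneg mult_nonneg_nonneg less_imp_le[OF bq_pos]) (auto simp: mu_def)
  have "?Z < (LINT r:{0..1}|lborel. rho0 r * q ?m r)"
    using integral_q_lower_bound[OF u0 F_lower, of ?m] \<open>0 < e\<close> mult_nonneg_nonneg[OF j0 sum0] by linarith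
  from order_tendstoD(1)[OF initial_limit[OF cospoly_q] this]
  have ev1: "\<forall>\<^sub>F n in sequentially. ?Z < lin n (gridf n (q ?m)) (\<xi>0 n) / real n" .
  have "0 < e / 3" using \<open>0 < e\<close> by simp
  from Suc.IH[OF this] ev1 ev2 eventually_ge_at_top[of 1] show ?case
  proof eventually_elim
    case (elim n)
    note n = elim(4) and init = elim(2) and lams = elim(3)
    let ?c = "real n * (1 + 2 * j) * (mass n (\<xi>0 n) + 1) ^ 3 * exp (7 * j * ((real n)\<^sup>2 * t))"
    have c0: "0 \<le> ?c" using j0 mass_nonneg[of n "\<xi>0 n"] by simp
    from elim(1) eventually_div_le[OF e1, of "S * ?c"] in_box_eventually[OF n] show ?case
    proof eventually_elim
      case (elim N)
      then have N: "1 \<le> N" and box: "\<xi>0 n \<in> box n N" and IH: "\<And>s. 0 \<le> s \<Longrightarrow> s \<le> t \<Longrightarrow> ?Z \<le> YY n N (q l) s"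
        and err: "S * ?c / real N \<le> e1" by auto
      let ?U = "\<lambda>k s. Uk n j N (\<xi>0 n) k s"
      let ?y = "YY n N (q ?m)"
      let ?y' = "\<lambda>s. \<Sum>k\<le>?m. a k * (- lam n k * ?U k s + j * Bk n j N (\<xi>0 n) k s + Ek n j N (\<xi>0 n) k s)"
      have yeq: "?y = (\<lambda>s. \<Sum>k\<le>?m. a k * ?U k s)" using YY_sum(1)[OF a box] by auto
      have d: "(?y has_real_derivative ?y' s) (at s)" for s
        unfolding yeq by (rule DERIV_sum) (intro DERIV_cmult Uk_has_derivative[OF j0 n box])
      have ge: "mu ?m * (?Z - ?y s) - (j * bq ?m + 2 * e1) \<le> ?y' s" if s: "0 \<le> s" "s \<le> t" for s
      proof -
        \<comment> \<open>Multiplying the coefficients by \<open>mu k\<close> amounts to applying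
          minus half the second derivative to the test function, which closes the equation in terms
          of \<open>q m\<close> and \<open>q l\<close>.\<close>
        have "(\<Sum>k\<le>?m. (a k * mu k) * ?U k s) = YY n N (\<lambda>r. mu ?m * (q ?m r - q l r)) s"
          by (rule YY_sum(1)[OF _ box, symmetric]) (simp only: amu[symmetric] mult.assoc)
        also have "\<dots> = mu ?m * (?y s - YY n N (q l) s)"
        proof -
          have "lin n (gridf n (\<lambda>r. mu ?m * (q ?m r - q l r))) = (\<lambda>\<eta>. mu ?m * (lin n (gridf n (q ?m)) \<eta> - lin n (gridf n (q l)) \<eta>))"
            unfolding lin_def gridf_def
            by (simp only: sum_subtractf[symmetric] sum_distrib_left left_diff_distrib right_diff_distrib mult.assoc)
          then show ?thesis
            by (simp only: kexp_cmult[OF j0 box] kexp_diff[OF j0 box] times_divide_eq_right)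
              (simp add: diff_divide_distrib right_diff_distrib)
        qed
        finally have 1: "(\<Sum>k\<le>?m. (a k * mu k) * ?U k s) = mu ?m * (?y s - YY n N (q l) s)" .
        have "?y' s = - (\<Sum>k\<le>?m. (a k * mu k) * ?U k s) + (\<Sum>k\<le>?m. a k * ((mu k - lam n k) * ?U k s))
            + j * (\<Sum>k\<le>?m. a k * Bk n j N (\<xi>0 n) k s) + (\<Sum>k\<le>?m. a k * Ek n j N (\<xi>0 n) k s)"
          unfolding sum_distrib_left sum_negf[symmetric] sum.distrib[symmetric]
          by (rule sum.cong) (auto simp: algebra_simps)
        moreover have "\<bar>\<Sum>k\<le>?m. a k * ((mu k - lam n k) * ?U k s)\<bar> \<le> e1"
        proof -
          have "\<bar>\<Sum>k\<le>?m. a k * ((mu k - lam n k) * ?U k s)\<bar> \<le> (\<Sum>k\<le>?m. \<bar>a k\<bar> * (\<bar>mu k - lam n k\<bar> * P))"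
          proof (rule order_trans[OF sum_abs sum_mono])
            fix k
            have "\<bar>?U k s\<bar> \<le> P" unfolding P_def by (rule Uk_bound[OF n box C(1) C(2)[OF n] s])
            then show "\<bar>a k * ((mu k - lam n k) * ?U k s)\<bar> \<le> \<bar>a k\<bar> * (\<bar>mu k - lam n k\<bar> * P)"
              unfolding abs_mult by (intro mult_left_mono) auto
          qed
          then show ?thesis using lams by linarith
        qed
        moreover have "- bq ?m \<le> (\<Sum>k\<le>?m. a k * Bk n j N (\<xi>0 n) k s)"
          unfolding YY_sum(2)[OF a box, symmetric] by (rule EE_bdry_ge[OF box s(1) q_nonneg q_le])
        then have "j * (- bq ?m) \<le> j * (\<Sum>k\<le>?m. a k * Bk n j N (\<xi>0 n) k s)" using j0 by (rule mult_left_mono)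
        moreover have "\<bar>\<Sum>k\<le>?m. a k * Ek n j N (\<xi>0 n) k s\<bar> \<le> e1"
        proof -
          have "\<bar>\<Sum>k\<le>?m. a k * Ek n j N (\<xi>0 n) k s\<bar> \<le> (\<Sum>k\<le>?m. \<bar>a k\<bar> * (?c / real N))"
          proof (rule order_trans[OF sum_abs sum_mono])
            fix k
            have "\<bar>Ek n j N (\<xi>0 n) k s\<bar> \<le> ?c / real N" by (rule Ek_bound[OF j_pos n N box s])
            then show "\<bar>a k * Ek n j N (\<xi>0 n) k s\<bar> \<le> \<bar>a k\<bar> * (?c / real N)"
              unfolding abs_mult by (intro mult_left_mono) auto
          qed
          also have "\<dots> = S * ?c / real N" unfolding S_def sum_distrib_right[symmetric] by simp
          finally show ?thesis using err by linarith
        qed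
        moreover have "mu ?m * (?Z - ?y s) \<le> - (mu ?m * (?y s - YY n N (q l) s))"
        proof -
          have "mu ?m * (?Z - ?y s) \<le> mu ?m * (YY n N (q l) s - ?y s)"
            using IH[OF s] by (intro mult_left_mono) (auto simp: mu_def)
          then show ?thesis by (simp add: right_diff_distrib)
        qed
        ultimately show ?thesis using 1 by linarith
      qed
      have y0: "?Z \<le> ?y 0" using init by (simp add: kexp_0)
      have "\<alpha> - j * (\<Sum>i=1..?m. bq i * min t (1 / mu i)) - e \<le> ?y s" if s: "0 \<le> s" "s \<le> t" for s
      proof -
        have "?Z - (j * bq ?m + 2 * e1) * min t (1 / mu ?m) \<le> ?y s"
          by (rule ode_lower_bound[where y = ?y and y' = ?y' and t = t, OF d ge y0 _ _ s])
             (use j0 bq_pos[of ?m] e1 in \<open>auto simp: mu_def simp del: bq.simps\<close>)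
        moreover have "(j * bq ?m + 2 * e1) * min t (1 / mu ?m) \<le> j * (bq ?m * min t (1 / mu ?m)) + 2 * e1 * t"
        proof -
          have "2 * e1 * min t (1 / mu ?m) \<le> 2 * e1 * t" using e1 by (intro mult_left_mono) auto
          then show ?thesis by (simp only: distrib_right mult.assoc)
        qed
        moreover have "(\<Sum>i=1..?m. bq i * min t (1 / mu i)) = (\<Sum>i=1..l. bq i * min t (1 / mu i)) + bq ?m * min t (1 / mu ?m)"
          by simp
        then have "j * (\<Sum>i=1..?m. bq i * min t (1 / mu i)) = j * (\<Sum>i=1..l. bq i * min t (1 / mu i)) + j * (bq ?m * min t (1 / mu ?m))"
          by (simp only: distrib_left)
        moreover have X: "A - S0 - e / 3 - D \<le> y \<Longrightarrow> D \<le> G + H \<Longrightarrow> S1 = S0 + G \<Longrightarrow> H \<le> e / 3 \<Longrightarrow> A - S1 - e \<le> y"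
          for A S0 D y G H S1 :: real
          using \<open>0 < e\<close> by linarith
        ultimately show ?thesis using e1t by (intro X)
      qed
      then show ?case by blast
    qed
  qed
qed

text \<open>The limit inequalities concern numbers free of n and N, so a single good pair suffices
  for each tolerance.\<close>

lemma eventually_eventually_witness:
  assumes "\<forall>\<^sub>F n in sequentially. \<forall>\<^sub>F N in sequentially. P n N" "\<forall>\<^sub>F n in sequentially. \<forall>\<^sub>F N in sequentially. Q n N"
  shows "\<exists>n N::nat. P n N \<and> Q n (N::nat)"
proof -
  from assms have "\<forall>\<^sub>F n in sequentially. \<forall>\<^sub>F N in sequentially. P n N \<and> Q n N"
    by eventually_elim (rule eventually_conj)
  then obtain n where "\<forall>\<^sub>F N in sequentially. P n N \<and> Q n N" using eventually_happens' sequentially_bot by blast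
  then show ?thesis using eventually_happens' sequentially_bot by blast
qed

lemma q_integral_lower:
  assumes t: "0 < t"
  shows "\<alpha> - j * (\<Sum>i=1..m. bq i * min t (1 / mu i)) \<le> (LINT r:{0..1}|lborel. \<rho> r t * q m r)"
proof (rule field_le_epsilon)
  fix e :: real assume e: "0 < e"
  then have e2: "0 < e / 2" by simp
  obtain n N where "\<forall>s. 0 \<le> s \<and> s \<le> t \<longrightarrow> \<alpha> - j * (\<Sum>i=1..m. bq i * min t (1 / mu i)) - e / 2 \<le> YY n N (q m) s"
    and "\<bar>YY n N (q m) t - (LINT r:{0..1}|lborel. \<rho> r t * q m r)\<bar> \<le> e / 2"
    using eventually_eventually_witness[OF q_lower[OF t e2, of m] YY_limit[OF t cospoly_q e2, of m]] by blast
  then have "\<alpha> - j * (\<Sum>i=1..m. bq i * min t (1 / mu i)) - e / 2 \<le> YY n N (q m) t"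
    and "\<bar>YY n N (q m) t - (LINT r:{0..1}|lborel. \<rho> r t * q m r)\<bar> \<le> e / 2" using t by auto
  then show "\<alpha> - j * (\<Sum>i=1..m. bq i * min t (1 / mu i)) \<le> (LINT r:{0..1}|lborel. \<rho> r t * q m r) + e" by linarith
qed

lemma positive_at_1: "\<exists>T>0. \<forall>t\<in>{0<..T}. 0 < \<rho> 1 t"
proof -
  \<comment> \<open>With this threshold the total loss, j times the sum, is at most half of
    \<alpha>.\<close>
  have "0 < \<alpha> / (2 * j)" using alpha_pos j_pos by simp
  from bq_min_sum_small[OF this] obtain T where T: "0 < T"
    and sm: "\<And>m. (\<Sum>i=1..m. bq i * min T (1 / mu i)) \<le> \<alpha> / (2 * j)" by blast
  have "\<alpha> / 2 \<le> \<rho> 1 t" if t: "t \<in> {0<..T}" for t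
  proof (rule q_concentrates_at_1)
    have t0: "0 < t" using t by simp
    show "continuous_on {0..1} (\<lambda>r. \<rho> r t)" by (rule \<rho>_cont_t[OF t0])
    show "\<alpha> / 2 \<le> (LINT r:{0..1}|lborel. \<rho> r t * q m r)" for m
    proof -
      have "(\<Sum>i=1..m. bq i * min t (1 / mu i)) \<le> (\<Sum>i=1..m. bq i * min T (1 / mu i))"
        using t by (intro sum_mono mult_left_mono less_imp_le[OF bq_pos]) auto
      also have "\<dots> \<le> \<alpha> / (2 * j)" by (rule sm)
      finally have "j * (\<Sum>i=1..m. bq i * min t (1 / mu i)) \<le> j * (\<alpha> / (2 * j))" using j0 by (rule mult_left_mono)
      also have "\<dots> = \<alpha> / 2" using j_pos by simp
      finally show ?thesis using q_integral_lower[OF t0, of m] by linarith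
    qed
  qed
  then have "\<forall>t\<in>{0<..T}. 0 < \<rho> 1 t" using alpha_pos by (meson half_gt_zero less_le_trans)
  with T show ?thesis by blast
qed

end

section \<open>Identification of the limit\<close>

context hydrodynamic_limit
begin

text \<open>The event that the rightmost particle lies within distance \<delta> n of site n.\<close>

definition Hn :: "real \<Rightarrow> nat \<Rightarrow> config set" where
  "Hn \<delta> n = {\<eta>. \<exists>y\<le>n. (1 - \<delta>) * real n \<le> real y \<and> 0 < \<eta> y}"

lemma prob_at_mono:
  assumes n: "1 \<le> n" and s: "0 \<le> s" and sub: "A \<subseteq> A'"
  shows "prob_at n j (\<xi>0 n) ((real n)\<^sup>2 * s) A \<le> prob_at n j (\<xi>0 n) ((real n)\<^sup>2 * s) A'"
proof -
  obtain N0 where N0: "\<xi>0 n \<in> box n N0" using in_some_box[OF n] by blast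
  have \<tau>: "0 \<le> (real n)\<^sup>2 * s" using s by simp
  show ?thesis
  proof (rule LIMSEQ_le[OF prob_at_tendsto(1)[OF j0 \<tau> N0] prob_at_tendsto(1)[OF j0 \<tau> N0]], intro exI allI impI)
    fix N assume "N0 \<le> N"
    then have box: "\<xi>0 n \<in> box n N" using box_mono N0 by blast
    show "EE n N s (ind A) \<le> EE n N s (ind A')"
      by (rule kexp_mono[OF j0 \<tau> box]) (use sub in \<open>auto simp: ind_def\<close>)
  qed
qed

text \<open>By continuity the density exceeds half of rho(1,s) on some [r2, 1]. The mass there
  bounds all tails starting at or left of r from below, hence one \<open>z\<close> serves them
  all.\<close>

lemma Fmac_pos:
  assumes s: "0 < s" and pos: "0 < \<rho> 1 s" and r: "0 \<le> r" "r < 1"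
  obtains z where "0 < z" "\<And>r'. 0 \<le> r' \<Longrightarrow> r' \<le> r \<Longrightarrow> z \<le> Fmac r' (\<lambda>x. \<rho> x s)"
proof -
  let ?c = "\<rho> 1 s / 2"
  have "\<exists>d>0. \<forall>x\<in>{0..1}. dist x 1 < d \<longrightarrow> dist (\<rho> x s) (\<rho> 1 s) < ?c"
    using \<rho>_cont_t[OF s] pos unfolding continuous_on_iff by (meson atLeastAtMost_iff half_gt_zero order_refl zero_le_one)
  then obtain d where d: "0 < d" "\<And>x. x \<in> {0..1} \<Longrightarrow> dist x 1 < d \<Longrightarrow> dist (\<rho> x s) (\<rho> 1 s) < ?c" by blast
  define r2 where "r2 = max r (1 - d/2)"
  have r2: "r \<le> r2" "r2 < 1" using r d(1) by (auto simp: r2_def)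
  have ge: "?c \<le> \<rho> x s" if "x \<in> {r2..1}" for x
  proof -
    have "x \<in> {0..1}" "dist x 1 < d" using that r d(1) by (auto simp: r2_def dist_real_def)
    from d(2)[OF this] show ?thesis by (auto simp: dist_real_def abs_if split: if_splits)
  qed
  have "?c * (1 - r2) \<le> Fmac r' (\<lambda>x. \<rho> x s)" if r': "0 \<le> r'" "r' \<le> r" for r'
  proof -
    have i1: "integrable lborel (\<lambda>x. indicator {r'..1} x *\<^sub>R \<rho> x s)"
      using set_integrable_subset[OF \<rho>_int[OF s], of "{r'..1}"] r' unfolding set_integrable_def by auto
    have i2: "integrable lborel (\<lambda>x. indicator {r2..1} x *\<^sub>R ?c)"
      using borel_integrable_atLeastAtMost'[OF continuous_on_const] unfolding set_integrable_def .
    have "?c * (1 - r2) = (LINT x|lborel. indicator {r2..1} x *\<^sub>R ?c)" using r2 by simp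
    also have "\<dots> \<le> (LINT x|lborel. indicator {r'..1} x *\<^sub>R \<rho> x s)"
    proof (rule integral_mono[OF i2 i1])
      fix x
      show "indicator {r2..1} x *\<^sub>R ?c \<le> indicator {r'..1} x *\<^sub>R \<rho> x s"
        using ge[of x] \<rho>_nonneg s r' r2 by (auto simp: indicator_def)
    qed
    finally show ?thesis unfolding Fmac_def set_lebesgue_integral_def .
  qed
  then show ?thesis using that[of "?c * (1 - r2)"] pos r2 by simp
qed

text \<open>If the empirical tail were 0 at a site x with x / n \<le> 1 - \<delta> / 2, it would
  differ from the limiting tail by at least z, contradicting closeness within z / 2.\<close>

lemma rightmost_near_1:
  assumes s: "0 < s" and pos: "0 < \<rho> 1 s" and \<delta>: "0 < \<delta>" "\<delta> < 1"
  shows "(\<lambda>n. prob_at n j (\<xi>0 n) ((real n)\<^sup>2 * s) (Hn \<delta> n)) \<longlonglongrightarrow> 1"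
proof -
  have "0 \<le> 1 - \<delta> / 2" "1 - \<delta> / 2 < 1" using \<delta> by auto
  from Fmac_pos[OF s pos this] obtain z where z: "0 < z"
    and F: "\<And>r'. 0 \<le> r' \<Longrightarrow> r' \<le> 1 - \<delta> / 2 \<Longrightarrow> z \<le> Fmac r' (\<lambda>x. \<rho> x s)" by blast
  define A where "A n = {\<eta>. (\<forall>x\<in>{0..n}. \<bar>(1 / real n) * Feps n x \<eta> - Fmac (real x / real n) (\<lambda>x. \<rho> x s)\<bar> \<le> z / 2)}" for n
  have lim: "(\<lambda>n. prob_at n j (\<xi>0 n) ((real n)\<^sup>2 * s) (A n)) \<longlonglongrightarrow> 1"
    unfolding A_def using \<rho>_hydro s z by (meson half_gt_zero)
  obtain n1 :: nat where n1: "2 / \<delta> < real n1" using reals_Archimedean2 by blast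
  have sub: "A n \<subseteq> Hn \<delta> n" if n: "max 1 n1 \<le> n" for n
  proof
    fix \<eta> assume \<eta>: "\<eta> \<in> A n"
    have n0: "0 < real n" using n by simp
    have nd: "2 \<le> \<delta> * real n"
    proof -
      have "2 / \<delta> \<le> real n" using n1 n by (simp add: max_def split: if_splits)
      then show ?thesis using \<delta> by (simp add: divide_le_eq mult.commute)
    qed
    \<comment> \<open>The first site at distance at most \<delta> n from the right end. As \<delta>
      n \<ge> 2, rounding up still leaves x / n \<le> 1 - \<delta> / 2.\<close>
    define x where "x = nat \<lceil>(1 - \<delta>) * real n\<rceil>"
    have p: "0 \<le> (1 - \<delta>) * real n" using \<delta> by simp
    have x1: "(1 - \<delta>) * real n \<le> real x" unfolding x_def by (rule real_nat_ceiling_ge)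
    have x2: "real x < (1 - \<delta>) * real n + 1" unfolding x_def using p by linarith
    have e: "(1 - \<delta>) * real n = real n - \<delta> * real n" by (simp add: left_diff_distrib)
    have x3: "x \<le> n" using x2 nd unfolding e by linarith
    have "real x \<le> (1 - \<delta> / 2) * real n" using x2 nd unfolding e by (simp add: left_diff_distrib)
    then have "real x / real n \<le> 1 - \<delta> / 2" using n0 by (simp add: divide_le_eq)
    then have "z \<le> Fmac (real x / real n) (\<lambda>x. \<rho> x s)" by (intro F) auto
    moreover have "\<bar>(1 / real n) * Feps n x \<eta> - Fmac (real x / real n) (\<lambda>x. \<rho> x s)\<bar> \<le> z / 2"
      using \<eta> x3 unfolding A_def by simp
    ultimately have "0 < (1 / real n) * Feps n x \<eta>" using z by linarith
    then have "0 < Feps n x \<eta>" using n0 by (simp add: zero_less_divide_iff)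
    then have "\<exists>y\<in>{x..n}. real (\<eta> y) \<noteq> 0"
      unfolding Feps_def by (metis less_irrefl sum.neutral)
    then obtain y where "y \<in> {x..n}" "0 < \<eta> y" by auto
    then show "\<eta> \<in> Hn \<delta> n" unfolding Hn_def using x1 by (auto intro!: exI[of _ y])
  qed
  show ?thesis
  proof (rule tendsto_sandwich[OF _ _ lim tendsto_const])
    show "\<forall>\<^sub>F n in sequentially. prob_at n j (\<xi>0 n) ((real n)\<^sup>2 * s) (A n) \<le> prob_at n j (\<xi>0 n) ((real n)\<^sup>2 * s) (Hn \<delta> n)"
      using eventually_ge_at_top[of "max 1 n1"] by eventually_elim (use s in \<open>auto intro!: prob_at_mono sub\<close>)
    show "\<forall>\<^sub>F n in sequentially. prob_at n j (\<xi>0 n) ((real n)\<^sup>2 * s) (Hn \<delta> n) \<le> 1"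
      using eventually_ge_at_top[of 1]
    proof eventually_elim
      case (elim n)
      obtain N0 where N0: "\<xi>0 n \<in> box n N0" using in_some_box[OF elim] by blast
      show ?case by (rule prob_at_tendsto(3)[OF j0 _ N0]) (use s in simp)
    qed
  qed
qed

lemma continuous_on_EE:
  assumes "\<xi>0 n \<in> box n N"
  shows "continuous_on S (\<lambda>s. EE n N s f)"
  by (rule continuous_on_compose2[OF continuous_on_kexp[OF j0 assms, of UNIV]]) (auto intro!: continuous_intros)

text \<open>The hypothesis controls each time separately, while the mode equation integrates the
  source over time. Dominated convergence bridges the gap, first in N and then in n; the single time
  s = 0 is negligible.\<close>

lemma integral_away_small:
  assumes t: "0 < t" and pos: "\<And>s. 0 < s \<Longrightarrow> s \<le> t \<Longrightarrow> 0 < \<rho> 1 s" and \<delta>: "0 < \<delta>" "\<delta> < 1" and \<kappa>: "0 < \<kappa>"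
  shows "\<forall>\<^sub>F n in sequentially. \<forall>\<^sub>F N in sequentially. integral {0..t} (\<lambda>s. 1 - EE n N s (ind (Hn \<delta> n))) \<le> \<kappa>"
proof -
  define f where "f n N s = indicator {0..t} s * (1 - EE n N s (ind (Hn \<delta> n)))" for n N s
  define g where "g n s = indicator {0..t} s * (1 - prob_at n j (\<xi>0 n) ((real n)\<^sup>2 * s) (Hn \<delta> n))" for n s
  have ii: "integrable lborel (\<lambda>s. indicator {0..t} s :: real)"
    using borel_integrable_atLeastAtMost'[OF continuous_on_const[of "{0..t}" "1 :: real"]] unfolding set_integrable_def by simp
  have fm: "f n N \<in> borel_measurable lborel" if "\<xi>0 n \<in> box n N" for n N
    unfolding f_def using borel_measurable_continuous_onI[OF continuous_on_EE[OF that, of UNIV]] by measurable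
  have fg: "(\<lambda>N. f n N s) \<longlonglongrightarrow> g n s" if n: "1 \<le> n" for n s
  proof (cases "s \<in> {0..t}")
    case True
    obtain N0 where N0: "\<xi>0 n \<in> box n N0" using in_some_box[OF n] by blast
    have "(\<lambda>N. EE n N s (ind (Hn \<delta> n))) \<longlonglongrightarrow> prob_at n j (\<xi>0 n) ((real n)\<^sup>2 * s) (Hn \<delta> n)"
      by (rule prob_at_tendsto(1)[OF j0 _ N0]) (use True in simp)
    then show ?thesis unfolding f_def g_def by (intro tendsto_intros)
  qed (simp add: f_def g_def)
  have fb: "norm (f n N s) \<le> indicator {0..t} s" if box: "\<xi>0 n \<in> box n N" for n N s
  proof (cases "s \<in> {0..t}")
    case True
    then have \<tau>: "0 \<le> (real n)\<^sup>2 * s" by simp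
    have "0 \<le> EE n N s (ind (Hn \<delta> n))" by (rule kexp_nonneg[OF j0 \<tau> box]) (simp add: ind_def)
    moreover have "EE n N s (ind (Hn \<delta> n)) \<le> EE n N s (\<lambda>_. 1)" by (rule kexp_mono[OF j0 \<tau> box]) (simp add: ind_def)
    moreover have "EE n N s (\<lambda>_. 1) \<le> 1" by (rule kexp_one_le[OF j0 \<tau> box])
    ultimately show ?thesis using True unfolding f_def by simp
  qed (simp add: f_def)
  have gb: "norm (g n s) \<le> indicator {0..t} s" if n: "1 \<le> n" for n s
  proof (cases "s \<in> {0..t}")
    case True
    then have \<tau>: "0 \<le> (real n)\<^sup>2 * s" by simp
    obtain N0 where N0: "\<xi>0 n \<in> box n N0" using in_some_box[OF n] by blast
    show ?thesis using prob_at_tendsto(3,4)[OF j0 \<tau> N0, of "Hn \<delta> n"] True unfolding g_def by simp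
  qed (simp add: g_def)
  have inner: "(\<lambda>N. LINT s|lborel. f n N s) \<longlonglongrightarrow> (LINT s|lborel. g n s)" and gm: "g n \<in> borel_measurable lborel" if n: "1 \<le> n" for n
  proof -
    obtain N0 where N0: "\<xi>0 n \<in> box n N0" using in_some_box[OF n] by blast
    have box: "\<xi>0 n \<in> box n (N + N0)" for N using box_mono[of N0 "N + N0" n] N0 by auto
    have lim: "(\<lambda>N. f n (N + N0) s) \<longlonglongrightarrow> g n s" for s using fg[OF n] by (rule LIMSEQ_ignore_initial_segment)
    show gm: "g n \<in> borel_measurable lborel"
      by (rule borel_measurable_LIMSEQ_real[OF lim]) (rule fm[OF box])
    have "(\<lambda>N. LINT s|lborel. f n (N + N0) s) \<longlonglongrightarrow> (LINT s|lborel. g n s)"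
      by (rule integral_dominated_convergence[where w = "\<lambda>s. indicator {0..t} s"])
         (use gm fm[OF box] ii lim fb[OF box] in auto)
    then show "(\<lambda>N. LINT s|lborel. f n N s) \<longlonglongrightarrow> (LINT s|lborel. g n s)" by (rule LIMSEQ_offset)
  qed
  \<comment> \<open>Shifted by one because measurability and the bound on \<open>g n\<close> are
    available for n \<ge> 1.\<close>
  have "(\<lambda>n. LINT s|lborel. g (n + 1) s) \<longlonglongrightarrow> integral\<^sup>L lborel (\<lambda>_ :: real. 0 :: real)"
  proof (rule integral_dominated_convergence[where f = "\<lambda>_. 0" and s = "\<lambda>n. g (n + 1)"
        and w = "\<lambda>s::real. indicator {0..t} s"])
    show "AE s in lborel. (\<lambda>n. g (n + 1) s) \<longlonglongrightarrow> 0"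
      using AE_lborel_singleton[of 0]
    proof eventually_elim
      fix s :: real assume s0: "s \<noteq> 0"
      show "(\<lambda>n. g (n + 1) s) \<longlonglongrightarrow> 0"
      proof (cases "s \<in> {0..t}")
        case True
        then have s: "0 < s" "s \<le> t" using s0 by auto
        have "(\<lambda>n. g n s) \<longlonglongrightarrow> indicator {0..t} s * (1 - 1)"
          unfolding g_def by (intro tendsto_intros rightmost_near_1 s \<delta> pos)
        then show ?thesis by (intro LIMSEQ_ignore_initial_segment) simp
      qed (simp add: g_def)
    qed
  qed (use gm gb ii in auto)
  then have "(\<lambda>n. LINT s|lborel. g n s) \<longlonglongrightarrow> 0" using LIMSEQ_offset[of "\<lambda>n. LINT s|lborel. g n s" 1] by simp
  from order_tendstoD(2)[OF this \<kappa>] eventually_ge_at_top[of 1] show ?thesis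
  proof eventually_elim
    case (elim n)
    from order_tendstoD(2)[OF inner[OF elim(2)] elim(1)] in_box_eventually[OF elim(2)] show ?case
    proof eventually_elim
      case (elim N)
      have c: "continuous_on {0..t} (\<lambda>s. 1 - EE n N s (ind (Hn \<delta> n)))"
        using elim by (intro continuous_intros continuous_on_EE) simp
      have "integral {0..t} (\<lambda>s. 1 - EE n N s (ind (Hn \<delta> n))) = (LINT s:{0..t}|lborel. 1 - EE n N s (ind (Hn \<delta> n)))"
        by (rule set_borel_integral_eq_integral(2)[symmetric]) (rule borel_integrable_atLeastAtMost'[OF c])
      also have "\<dots> = (LINT s|lborel. f n N s)" unfolding set_lebesgue_integral_def f_def by simp
      finally show ?case using elim by simp
    qed
  qed
qed

text \<open>On \<open>Hn\<close> the Lipschitz bound for cos applies: the grid position of site 0 is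
  within 1 / n of 0, and that of R within \<delta> + 1 / n of 1. Off this event the difference is at
  most 4.\<close>

lemma Bk_close:
  assumes n: "1 \<le> n" and box: "\<xi>0 n \<in> box n N" and s: "0 \<le> s" and \<delta>: "0 < \<delta>" "\<delta> < 1"
  shows "\<bar>Bk n j N (\<xi>0 n) k s - (1 - cos (real k * pi))\<bar>
     \<le> real k * pi * (\<delta> + 2 / real n) + 4 * (1 - EE n N s (ind (Hn \<delta> n)))"
proof -
  let ?b = "1 - cos (real k * pi)"
  let ?d = "real k * pi * (\<delta> + 2 / real n)"
  have \<tau>: "0 \<le> (real n)\<^sup>2 * s" using s by simp
  have n0: "0 < real n" using n by simp
  have d0: "0 \<le> ?d" using \<delta> by simp
  have b2: "\<bar>?b\<bar> \<le> 2" using cos_ge_minus_one[of "real k * pi"] cos_le_one[of "real k * pi"] by linarith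
  have pt: "\<bar>bdry n (cosg n k) \<eta> - ?b * 1\<bar> \<le> ?d * 1 + 4 * (1 - ind (Hn \<delta> n) \<eta>)" for \<eta>
  proof (cases "\<eta> \<in> Hn \<delta> n")
    case True
    then obtain y where y: "y \<le> n" "(1 - \<delta>) * real n \<le> real y" "0 < \<eta> y" unfolding Hn_def by auto
    then have ne: "\<exists>y\<le>n. 0 < \<eta> y" by blast
    let ?R = "rightmost n \<eta>"
    have R: "?R \<le> n" "y \<le> ?R" using rightmost_props[OF ne] y by auto
    have "\<bar>cosg n k 0 - cos (real k * pi * 0)\<bar> \<le> real k * pi * (1 / real n)"
    proof -
      have "\<bar>cosg n k 0 - cos (real k * pi * 0)\<bar> \<le> \<bar>real k * pi * ((real 0 + 1/2) / (real n + 1)) - real k * pi * 0\<bar>"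
        unfolding cosg_def by (rule cos_lipschitz)
      also have "\<dots> = real k * pi * ((1/2) / (real n + 1))" by simp
      also have "\<dots> \<le> real k * pi * (1 / real n)"
        using n0 by (intro mult_left_mono frac_le) auto
      finally show ?thesis .
    qed
    moreover have "\<bar>cosg n k ?R - cos (real k * pi)\<bar> \<le> real k * pi * (\<delta> + 1 / real n)"
    proof -
      have "\<bar>cosg n k ?R - cos (real k * pi)\<bar> \<le> \<bar>real k * pi * ((real ?R + 1/2) / (real n + 1)) - real k * pi\<bar>"
        unfolding cosg_def by (rule cos_lipschitz)
      also have "real k * pi * ((real ?R + 1/2) / (real n + 1)) - real k * pi = - (real k * pi * ((real n + 1/2 - real ?R) / (real n + 1)))"
        using n0 by (simp add: field_simps)
      also have "\<bar>\<dots>\<bar> = real k * pi * ((real n + 1/2 - real ?R) / (real n + 1))"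
        using R by (simp add: abs_mult)
      also have "\<dots> \<le> real k * pi * (\<delta> + 1 / real n)"
      proof (rule mult_left_mono)
        have "real n + 1/2 - real ?R \<le> \<delta> * real n + 1"
          using y(2) R(2) by (simp add: left_diff_distrib)
        then have "(real n + 1/2 - real ?R) / (real n + 1) \<le> (\<delta> * real n + 1) / real n"
          using n0 R \<delta> by (intro frac_le) auto
        also have "\<dots> = \<delta> + 1 / real n" using n0 by (simp add: add_divide_distrib)
        finally show "(real n + 1/2 - real ?R) / (real n + 1) \<le> \<delta> + 1 / real n" .
      qed simp
      finally show ?thesis .
    qed
    moreover have "bdry n (cosg n k) \<eta> = cosg n k 0 - cosg n k ?R" unfolding bdry_def using ne by simp
    moreover have "real k * pi * (1 / real n) + real k * pi * (\<delta> + 1 / real n) = ?d"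
      by (simp add: algebra_simps add_divide_distrib)
    moreover have "ind (Hn \<delta> n) \<eta> = 1" using True by (simp add: ind_def)
    moreover have "cos (real k * pi * 0) = 1" by simp
    moreover have X: "\<bar>p - c0\<bar> \<le> x \<Longrightarrow> \<bar>r - c\<bar> \<le> y \<Longrightarrow> D = p - r \<Longrightarrow> x + y = d \<Longrightarrow> i = 1 \<Longrightarrow> c0 = 1 \<Longrightarrow>
        \<bar>D - (1 - c) * 1\<bar> \<le> d * 1 + 4 * (1 - i)" for p c0 x r c y D d i :: real
      by auto
    ultimately show ?thesis by (intro X)
  next
    case False
    have "\<bar>bdry n (cosg n k) \<eta>\<bar> \<le> 2"
      unfolding bdry_def using abs_cosg_le[of n k 0] abs_cosg_le[of n k "rightmost n \<eta>"] by auto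
    then show ?thesis using b2 d0 False by (simp add: ind_def)
  qed
  let ?E1 = "EE n N s (\<lambda>_. 1)"
  let ?EH = "EE n N s (ind (Hn \<delta> n))"
  have one: "?E1 \<le> 1" by (rule kexp_one_le[OF j0 \<tau> box])
  have "\<bar>EE n N s (\<lambda>\<eta>. bdry n (cosg n k) \<eta> - ?b * 1)\<bar> \<le> EE n N s (\<lambda>\<eta>. ?d * 1 + 4 * (1 - ind (Hn \<delta> n) \<eta>))"
    by (rule kexp_abs_le[OF j0 \<tau> box pt])
  then have "\<bar>Bk n j N (\<xi>0 n) k s - ?b * ?E1\<bar> \<le> ?d * ?E1 + 4 * (?E1 - ?EH)"
    unfolding Bk_def by (simp only: kexp_add[OF j0 box] kexp_diff[OF j0 box] kexp_cmult[OF j0 box])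
  moreover have "?d * ?E1 \<le> ?d" using mult_left_mono[OF one d0] by simp
  moreover have "\<bar>?b * ?E1 - ?b\<bar> \<le> 2 * (1 - ?E1)"
  proof -
    have "\<bar>?b * ?E1 - ?b\<bar> = \<bar>?b\<bar> * \<bar>?E1 - 1\<bar>" unfolding abs_mult[symmetric] by (simp add: right_diff_distrib)
    also have "\<dots> \<le> 2 * \<bar>?E1 - 1\<bar>" using b2 by (rule mult_right_mono) simp
    finally show ?thesis using one by simp
  qed
  \<comment> \<open>The probability lost by killing costs 2 (1 - E1), which fits under the gap
    between 4 (E1 - EH) and 4 (1 - EH).\<close>
  moreover have X: "\<bar>x - b\<bar> \<le> d + 4 * (1 - EH)"
    if "\<bar>x - b'\<bar> \<le> d' + 4 * (E1 - EH)" "d' \<le> d" "\<bar>b' - b\<bar> \<le> 2 * (1 - E1)" "E1 \<le> 1"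
    for x b b' d d' E1 EH :: real
  proof -
    have "\<bar>x - b\<bar> \<le> \<bar>x - b'\<bar> + \<bar>b' - b\<bar>" by linarith
    then show ?thesis using that by argo
  qed
  ultimately show ?thesis using one by (intro X)
qed

text \<open>The subtracted expression solves the mode equation with constant source 1 - cos (k pi)
  and the same initial value. The difference thus starts at 0 and is forced only by the deviation of
  the source and by killing.\<close>

lemma Uk_explicit_error:
  assumes n: "1 \<le> n" and N: "1 \<le> N" and box: "\<xi>0 n \<in> box n N" and t: "0 \<le> t" and \<delta>: "0 < \<delta>" "\<delta> < 1"
    and bl: "1 - cos (real k * pi) = 0 \<or> lam n k \<noteq> 0"
  shows "\<bar>Uk n j N (\<xi>0 n) k t - (exp (- lam n k * t) * (lin n (cosg n k) (\<xi>0 n) / real n)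
       + j * ((1 - cos (real k * pi)) * ((1 - exp (- lam n k * t)) / lam n k)))\<bar>
     \<le> t * (j * (real k * pi * (\<delta> + 2 / real n))
          + real n * (1 + 2 * j) * (mass n (\<xi>0 n) + 1) ^ 3 * exp (7 * j * ((real n)\<^sup>2 * t)) / real N)
       + 4 * j * integral {0..t} (\<lambda>s. 1 - EE n N s (ind (Hn \<delta> n)))"
proof -
  let ?b = "1 - cos (real k * pi)"
  let ?l = "lam n k"
  let ?U = "Uk n j N (\<xi>0 n) k"
  let ?B = "Bk n j N (\<xi>0 n) k"
  let ?Ek = "Ek n j N (\<xi>0 n) k"
  let ?u0 = "lin n (cosg n k) (\<xi>0 n) / real n"
  let ?V = "\<lambda>s. exp (- ?l * s) * ?u0 + j * (?b * ((1 - exp (- ?l * s)) / ?l))"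
  let ?h = "\<lambda>s. j * (?B s - ?b) + ?Ek s"
  let ?c = "real n * (1 + 2 * j) * (mass n (\<xi>0 n) + 1) ^ 3 * exp (7 * j * ((real n)\<^sup>2 * t)) / real N"
  let ?d = "real k * pi * (\<delta> + 2 / real n)"
  let ?H = "\<lambda>s. (j * ?d + ?c) + 4 * j * (1 - EE n N s (ind (Hn \<delta> n)))"
  have U0: "?U 0 = ?u0" unfolding Uk_def by (simp add: kexp_0)
  have cB: "continuous_on S ?B" for S unfolding Bk_def by (rule continuous_on_EE[OF box])
  have cE: "continuous_on S ?Ek" for S unfolding Ek_def by (intro continuous_intros continuous_on_EE[OF box])
  have cH: "continuous_on S (\<lambda>s. 1 - EE n N s (ind (Hn \<delta> n)))" for S by (intro continuous_intros continuous_on_EE[OF box])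
  have "\<bar>?U t - ?V t\<bar> \<le> integral {0..t} ?H"
  proof (rule ode_error_bound[where W = "\<lambda>s. ?U s - ?V s" and h = ?h, OF _ _ lam_nonneg[of n k] t])
    show "?U 0 - ?V 0 = 0" using U0 by simp
    show "continuous_on {0..t} ?h" by (intro continuous_intros cB cE)
    show "continuous_on {0..t} ?H"
      by (rule continuous_on_add[OF continuous_on_const continuous_on_mult[OF continuous_on_const cH]])
    fix s
    have e: "((\<lambda>s. exp (- ?l * s)) has_real_derivative exp (- ?l * s) * (- ?l)) (at s)"
      by (auto intro!: derivative_eq_intros)
    have DV: "(?V has_real_derivative (exp (- ?l * s) * (- ?l) * ?u0 + j * (?b * ((0 - exp (- ?l * s) * (- ?l)) / ?l)))) (at s)"
      by (rule DERIV_add[OF DERIV_cmult_right[OF e]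
            DERIV_cmult[OF DERIV_cmult[OF DERIV_cdivide[OF DERIV_diff[OF DERIV_const e]]]]])
    have DU: "((\<lambda>s. ?U s - ?V s) has_real_derivative (- ?l * ?U s + j * ?B s + ?Ek s)
        - (exp (- ?l * s) * (- ?l) * ?u0 + j * (?b * ((0 - exp (- ?l * s) * (- ?l)) / ?l)))) (at s)"
      by (rule DERIV_diff[OF Uk_has_derivative[OF j0 n box] DV])
    have X: "b = 0 \<or> l \<noteq> 0 \<Longrightarrow> (- l * U + j * B + E) - (e * (- l) * u + j * (b * ((0 - e * (- l)) / l)))
      = - l * (U - (e * u + j * (b * ((1 - e) / l)))) + (j * (B - b) + E)" for b l U B E e u :: real
      by (auto simp: field_simps)
    show "((\<lambda>s. ?U s - ?V s) has_real_derivative - ?l * (?U s - ?V s) + ?h s) (at s)"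
      using DU unfolding X[OF bl, of "?U s" "?B s" "?Ek s" "exp (- ?l * s)" ?u0] .
    assume s: "0 \<le> s" "s \<le> t"
    have "\<bar>?h s\<bar> \<le> j * \<bar>?B s - ?b\<bar> + \<bar>?Ek s\<bar>"
      using abs_triangle_ineq[of "j * (?B s - ?b)" "?Ek s"] j0 by (simp add: abs_mult)
    also have "j * \<bar>?B s - ?b\<bar> \<le> j * (?d + 4 * (1 - EE n N s (ind (Hn \<delta> n))))"
      by (rule mult_left_mono[OF Bk_close[OF n box s(1) \<delta>] j0])
    also have "\<bar>?Ek s\<bar> \<le> ?c" by (rule Ek_bound[OF j_pos n N box s])
    finally have "\<bar>?h s\<bar> \<le> j * (?d + 4 * (1 - EE n N s (ind (Hn \<delta> n)))) + ?c" by simp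
    moreover have Y: "x \<le> j * (d + 4 * y) + c \<Longrightarrow> x \<le> (j * d + c) + 4 * j * y" for x d y c :: real
      by (simp add: distrib_left)
    ultimately show "\<bar>?h s\<bar> \<le> ?H s" by (intro Y)
  qed
  also have "integral {0..t} ?H = integral {0..t} (\<lambda>s. j * ?d + ?c) + integral {0..t} (\<lambda>s. 4 * j * (1 - EE n N s (ind (Hn \<delta> n))))"
    by (rule Henstock_Kurzweil_Integration.integral_add[OF integrable_continuous_real[OF continuous_on_const]
          integrable_continuous_real[OF continuous_on_mult[OF continuous_on_const cH]]])
  also have "integral {0..t} (\<lambda>s. j * ?d + ?c) = t * (j * ?d + ?c)" using t by simp
  also have "integral {0..t} (\<lambda>s. 4 * j * (1 - EE n N s (ind (Hn \<delta> n)))) = 4 * j * integral {0..t} (\<lambda>s. 1 - EE n N s (ind (Hn \<delta> n)))"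
    by (rule integral_mult_right)
  finally show ?thesis .
qed

text \<open>Two evaluations of the same \<open>Uk\<close> at time t: by the hydrodynamic hypothesis
  it tends to the cosine coefficient of rho, and by the mode equation, now that R is near the right
  end, to the explicit expression.\<close>

lemma cos_coeff:
  assumes t: "0 < t" and pos: "\<And>s. 0 < s \<Longrightarrow> s \<le> t \<Longrightarrow> 0 < \<rho> 1 s"
  shows "(LINT r:{0..1}|lborel. \<rho> r t * cos (real k * pi * r))
    = exp (- mu k * t) * (LINT r:{0..1}|lborel. rho0 r * cos (real k * pi * r))
      + j * ((1 - cos (real k * pi)) * ((1 - exp (- mu k * t)) / mu k))"
  (is "?X = ?R")
proof -
  let ?c = "\<lambda>r. cos (real k * pi * r)"
  let ?b = "1 - cos (real k * pi)"
  have cp: "cospoly k ?c" by (rule cospoly_cos) simp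
  define v where "v n = exp (- lam n k * t) * (lin n (cosg n k) (\<xi>0 n) / real n) + j * (?b * ((1 - exp (- lam n k * t)) / lam n k))" for n
  have bm: "?b = 0 \<or> mu k \<noteq> 0" by (cases "k = 0") (auto simp: mu_def)
  have ul: "(\<lambda>n. exp (- lam n k * t) * (lin n (cosg n k) (\<xi>0 n) / real n)) \<longlonglongrightarrow> exp (- mu k * t) * (LINT r:{0..1}|lborel. rho0 r * ?c r)"
    unfolding cosg_eq_gridf by (intro tendsto_intros lam_tendsto initial_limit[OF cp])
  have bl: "(\<lambda>n. j * (?b * ((1 - exp (- lam n k * t)) / lam n k))) \<longlonglongrightarrow> j * (?b * ((1 - exp (- mu k * t)) / mu k))"
  proof (cases "?b = 0")
    case True
    then show ?thesis by simp
  next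
    case False
    then have "mu k \<noteq> 0" using bm by simp
    then show ?thesis by (intro tendsto_intros lam_tendsto)
  qed
  have vlim: "v \<longlonglongrightarrow> ?R" unfolding v_def by (rule tendsto_add[OF ul bl])
  have lam0: "\<forall>\<^sub>F n in sequentially. ?b = 0 \<or> lam n k \<noteq> 0"
  proof (cases "?b = 0")
    case False
    then have "mu k \<noteq> 0" using bm by simp
    from tendsto_imp_eventually_ne[OF lam_tendsto this] show ?thesis by eventually_elim simp
  qed simp
  have "\<bar>?X - ?R\<bar> \<le> e" if e: "0 < e" for e
  proof -
    \<comment> \<open>Four errors of e / 15 (from \<delta>, from the grid, from killing and from the
      event that R is not near the end) add up to less than e / 3. The two limits use the other two
      thirds.\<close>
    define D where "D = j * (real k * pi) * t"
    have D: "0 \<le> D" unfolding D_def using j0 t by simp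
    define \<delta> where "\<delta> = min (1/2) (e / (15 * (D + 1)))"
    have \<delta>: "0 < \<delta>" "\<delta> < 1" unfolding \<delta>_def using e D by auto
    have D\<delta>: "D * \<delta> \<le> e / 15"
    proof -
      have "D * \<delta> \<le> (D + 1) * (e / (15 * (D + 1)))"
        unfolding \<delta>_def using D e by (intro mult_mono) auto
      also have "(D + 1) * (e / (15 * (D + 1))) = e / 15"
      proof -
        have G: "G * (e / (15 * G)) = e / 15" if "G \<noteq> 0" for G :: real using that by simp
        have "D + 1 \<noteq> 0" using D by linarith
        then show ?thesis by (rule G)
      qed
      finally show ?thesis .
    qed
    have e15: "0 < e / 15" and e3: "0 < e / 3" and ej: "0 < e / (60 * j)" using e j_pos by auto
    have away: "\<forall>\<^sub>F n in sequentially. \<forall>\<^sub>F N in sequentially.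
        integral {0..t} (\<lambda>s. 1 - EE n N s (ind (Hn \<delta> n))) \<le> e / (60 * j)"
      by (rule integral_away_small[OF t _ \<delta> ej]) (rule pos)
    \<comment> \<open>The inequality does not involve n or N, so holding eventually means
      holding.\<close>
    have "\<forall>\<^sub>F n in sequentially. \<forall>\<^sub>F N in sequentially. \<bar>?X - ?R\<bar> \<le> e"
      using YY_limit[OF t cp e3] away lam0 eventually_div_le[OF e15, of "2 * D"]
        tendstoD[OF vlim e3] eventually_ge_at_top[of 1]
    proof eventually_elim
      case (elim n)
      note n = elim(6) and bl = elim(3) and Dn = elim(4) and vn = elim(5)
      let ?K = "real n * (1 + 2 * j) * (mass n (\<xi>0 n) + 1) ^ 3 * exp (7 * j * ((real n)\<^sup>2 * t))"
      from elim(1) elim(2) in_box_eventually[OF n] eventually_div_le[OF e15, of "t * ?K"] show ?case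
      proof eventually_elim
        case (elim N)
        then have N: "1 \<le> N" and box: "\<xi>0 n \<in> box n N" by auto
        let ?I = "integral {0..t} (\<lambda>s. 1 - EE n N s (ind (Hn \<delta> n)))"
        have "\<bar>Uk n j N (\<xi>0 n) k t - v n\<bar> \<le> t * (j * (real k * pi * (\<delta> + 2 / real n)) + ?K / real N) + 4 * j * ?I"
          unfolding v_def by (rule Uk_explicit_error[OF n N box less_imp_le[OF t] \<delta> bl])
        also have "t * (j * (real k * pi * (\<delta> + 2 / real n)) + ?K / real N) = D * \<delta> + 2 * D / real n + t * ?K / real N"
          unfolding D_def by (simp add: distrib_left mult_ac)
        finally have 1: "\<bar>Uk n j N (\<xi>0 n) k t - v n\<bar> \<le> D * \<delta> + 2 * D / real n + t * ?K / real N + 4 * j * ?I" .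
        have "4 * j * ?I \<le> 4 * j * (e / (60 * j))" using elim(2) j0 by (intro mult_left_mono) auto
        also have "\<dots> = e / 15" using j_pos by simp
        finally have 2: "4 * j * ?I \<le> e / 15" .
        have 3: "\<bar>Uk n j N (\<xi>0 n) k t - ?X\<bar> \<le> e / 3" unfolding Uk_eq_YY by (rule elim(1))
        have 4: "\<bar>v n - ?R\<bar> < e / 3" using vn unfolding dist_real_def .
        have X: "\<bar>U - v\<bar> \<le> a + b + c + d \<Longrightarrow> a \<le> e / 15 \<Longrightarrow> b \<le> e / 15 \<Longrightarrow> c \<le> e / 15 \<Longrightarrow> d \<le> e / 15 \<Longrightarrow>
          \<bar>U - x\<bar> \<le> e / 3 \<Longrightarrow> \<bar>v - r\<bar> < e / 3 \<Longrightarrow> \<bar>x - r\<bar> \<le> e" for U v a b c d x r :: real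
          using e by linarith
        show ?case by (rule X[OF 1 D\<delta> Dn elim(4) 2 3 4])
      qed
    qed
    then obtain n where "\<forall>\<^sub>F N in sequentially. \<bar>?X - ?R\<bar> \<le> e" using eventually_happens' sequentially_bot by blast
    then show ?thesis using eventually_happens' sequentially_bot by blast
  qed
  note close = this
  have "\<bar>?X - ?R\<bar> \<le> 0"
  proof (rule field_le_epsilon)
    fix e :: real assume "0 < e"
    then show "\<bar>?X - ?R\<bar> \<le> 0 + e" unfolding add_0_left by (rule close)
  qed
  then show ?thesis unfolding abs_le_zero_iff right_minus_eq .
qed

text \<open>Both sides are continuous in r on [0,1] and have the same cosine coefficients, which
  determine a continuous function.\<close>

lemma explicit_formula:
  assumes t: "0 < t" and pos: "\<And>s. 0 < s \<Longrightarrow> s \<le> t \<Longrightarrow> 0 < \<rho> 1 s" and r: "r \<in> {0..1}"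
  shows "\<rho> r t = Gneum_conv t rho0 r + j * (LINT s:{0..t}|lborel. Gneum s r 0 - Gneum s r 1)"
proof -
  interpret ns: neumann_solution j t rho0
    by unfold_locales (use t u0 in auto)
  have "\<rho> r t = ns.sol r"
  proof (rule cos_coeffs_unique[OF \<rho>_cont_t[OF t] ns.sol_cont _ r])
    fix k
    have b: "1 - cos (real k * pi) = 0 \<or> mu k \<noteq> 0" by (cases "k = 0") (auto simp: mu_def)
    note cc = cos_coeff[of t k, OF t]
    show "(LINT r:{0..1}|lborel. \<rho> r t * cos (real k * pi * r)) = (LINT r:{0..1}|lborel. ns.sol r * cos (real k * pi * r))"
      by (subst cc[OF pos]) (simp_all only: ns.sol_cos exp_integral[OF less_imp_le[OF t] b])
  qed
  then show ?thesis unfolding ns.sol_def .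
qed

end

theorem mainTheorem4:
  fixes j \<alpha> B :: real and rho0 :: "real \<Rightarrow> real"
    and \<xi>0 :: "nat \<Rightarrow> config" and \<rho> :: "real \<Rightarrow> real \<Rightarrow> real"
  assumes j_pos: "0 < j"
    and rho0_meas: "set_borel_measurable lborel {0..1} rho0"
    and rho0_Linf: "AE r in lborel. r \<in> {0..1} \<longrightarrow> 0 \<le> rho0 r \<and> rho0 r \<le> B"
    and alpha_pos: "0 < \<alpha>"
    and F_lower: "\<forall>r\<in>{0..1}. Fmac r rho0 \<ge> \<alpha> * (1 - r)"
    and \<xi>0_supp: "\<forall>n\<ge>1. \<forall>y>n. \<xi>0 n y = 0"
    and \<xi>0_close: "\<forall>n\<ge>1. let l = nat \<lfloor>real n powr (9/10)\<rfloor> in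
         (\<forall>x\<in>{0..n - l + 1}. \<bar>avg l x (\<xi>0 n) - avg' n l x rho0\<bar> \<le> (1 / real n) powr (1/20))"
    and \<rho>_nonneg: "\<forall>r\<in>{0..1}. \<forall>t>0. 0 \<le> \<rho> r t"
    and \<rho>_cont: "continuous_on ({0..1} \<times> {0<..}) (\<lambda>(r, t). \<rho> r t)"
    and \<rho>_init: "\<forall>r\<in>{0..1}. ((\<lambda>t. Fmac r (\<lambda>s. \<rho> s t)) \<longlongrightarrow> Fmac r rho0) (at_right 0)"
    and \<rho>_hydro: "\<forall>t>0. \<forall>\<zeta>>0.
         (\<lambda>n. prob_at n j (\<xi>0 n) (real n ^ 2 * t)
            {\<eta>. (\<forall>x\<in>{0..n}. \<bar>(1 / real n) * Feps n x \<eta> - Fmac (real x / real n) (\<lambda>s. \<rho> s t)\<bar> \<le> \<zeta>)})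
         \<longlonglongrightarrow> 1"
  shows "\<exists>T>0. (\<forall>t\<in>{0<..T}. 0 < \<rho> 1 t) \<and>
           (\<forall>r\<in>{0..1}. \<forall>t\<in>{0<..T}.
              \<rho> r t = Gneum_conv t rho0 r
                       + j * (LINT s:{0..t}|lborel. Gneum s r 0 - Gneum s r 1))"
proof -
  interpret hydrodynamic_limit j \<alpha> B rho0 \<xi>0 \<rho>
    by unfold_locales fact+
  obtain T where T: "0 < T" and pos: "\<forall>t\<in>{0<..T}. 0 < \<rho> 1 t" using positive_at_1 by blast
  have "\<rho> r t = Gneum_conv t rho0 r + j * (LINT s:{0..t}|lborel. Gneum s r 0 - Gneum s r 1)"
    if "r \<in> {0..1}" "t \<in> {0<..T}" for r t
    by (rule explicit_formula) (use that pos in auto)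
  with T pos show ?thesis by blast
qed

end
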